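(* Let $f$ be a Steinhaus random multiplicative function and let $M_f(x)=\sum_{n\le x} f(n)/\sqrt{n}$. For any $\varepsilon>0$, almost surely \[ M_f(x) \ll \exp\bigl((1+\varepsilon)\sqrt{\log_2 x \,\log_4 x}\bigr), \] i.e. almost surely there is a (random) constant $C$ such that $|M_f(x)|\le C\exp\bigl((1+\varepsilon)\sqrt{\log_2 x\log_4 x}\bigr)$ for all sufficiently large $x$.
   Context: A Steinhaus random multiplicative function is defined by taking $(f(p))_{p \text{ prime}}$ independent random variables each uniformly distributed on the unit circle $\{z\in\mathbb{C}:|z|=1\}$, and extending completely multiplicatively: $f(n)=\prod_{p\mid n} f(p)^{v_p(n)}$, where $v_p(n)$ is the $p$-adic valuation of $n$. $\log_k$ denotes the $k$-fold iterated logarithm. *)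

theory Defs
  imports "HOL-Probability.Probability" "HOL-Computational_Algebra.Primes"
begin

text \<open>The uniform (arc length) probability measure on the unit circle, as a Borel measure on the
  whole complex plane: the law of \<open>exp (2 \<pi> \<i> U)\<close> with \<open>U\<close> uniform on \<open>[0, 1]\<close>.\<close>
definition uniform_circle :: "complex measure" where
  "uniform_circle = distr (uniform_measure lborel {0..1::real}) borel (\<lambda>t. cis (2 * pi * t))"

lemma cis_2pi_measurable: "(\<lambda>t::real. cis (2 * pi * t)) \<in> borel_measurable borel"
  by (intro borel_measurable_continuous_onI continuous_intros)

lemma prob_space_uniform_circle: "prob_space uniform_circle"
proof -
  have "prob_space (uniform_measure lborel {0..1::real})"
    by (rule prob_space_uniform_measure) auto
  then show ?thesis
    unfolding uniform_circle_def
    by (rule prob_space.prob_space_distr) (use cis_2pi_measurable in simp)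
qed

lemma AE_uniform_circle_norm: "AE z in uniform_circle. norm z = 1"
  unfolding uniform_circle_def
  by (subst AE_distr_iff) (use cis_2pi_measurable in auto)

text \<open>Independence includes measurability of each \<open>f p\<close>, \<open>p\<close> prime.
  The value \<open>f 0\<close> is left unconstrained.\<close>
definition steinhaus :: "'a measure \<Rightarrow> (nat \<Rightarrow> 'a \<Rightarrow> complex) \<Rightarrow> bool" where
  "steinhaus M f \<longleftrightarrow>
     prob_space.indep_vars M (\<lambda>_. borel) f {p. prime p} \<and>
     (\<forall>p. prime p \<longrightarrow> distr M borel (f p) = uniform_circle) \<and>
     (\<forall>n\<ge>1. \<forall>\<omega>\<in>space M. f n \<omega> = (\<Prod>p\<in>prime_factors n. f p \<omega> ^ multiplicity p n))"

definition weighted_partial_sum :: "(nat \<Rightarrow> complex) \<Rightarrow> real \<Rightarrow> complex" where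
  "weighted_partial_sum g x = (\<Sum>n | 1 \<le> n \<and> real n \<le> x. g n / of_real (sqrt (real n)))"

text \<open>The iterated logarithm \<open>log\<^sub>k\<close>. It has its usual meaning only for \<open>x\<close> large in terms of
  \<open>k\<close>; elsewhere the totalised \<^const>\<open>ln\<close> makes it a junk value.\<close>
definition iter_ln :: "nat \<Rightarrow> real \<Rightarrow> real" where
  "iter_ln k = ln ^^ k"

end

theory Submission
  imports Defs "HOL-Real_Asymp.Real_Asymp"
begin

text \<open>For \<open>x\<close> in \<open>[exp (2^(k-2)), exp (2^k)]\<close> split the primes at \<open>y = exp (2^K)\<close>, where \<open>2^K\<close> is
  about \<open>2^k / k\<close>, and reveal those above \<open>y\<close> in polynomially many blocks. By orthogonality and
  repeated squaring, each increment has high moments controlled by \<open>\<Sum>b. 2^(s * \<Omega>(b)) / b *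
  |\<Psi>(x/b)|\<^sup>2\<close>, which Brun's sieve for primes in short windows bounds by the mean square of \<open>\<Psi>\<close> on
  the logarithmic scale. The mean square, divided by the Mertens product, is a supermartingale in
  the set of primes used, so on the event that all the Euler products at the point 1/2 up to this
  scale are at most \<open>sqrt B\<close>, the sum is \<open>k^O(1) * sqrt B\<close> up to events of summable probability.
  The upper half of the law of the iterated logarithm, applied to the logarithms of the Euler
  products, allows \<open>sqrt B = exp ((1 + o(1)) * sqrt (ln ln x * ln ln ln ln x))\<close>. Between polynomially
  dense test points the sums are compared by a fourth moment and dyadic chaining.\<close>

subsection \<open>Smooth numbers and Euler products\<close>

text \<open>The leading constant is that of the law of the iterated logarithm: the logarithm of the
  Euler product at 1/2 has real part close to the sum of Re f(p) / sqrt p, whose variance is about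
  (ln ln x) / 2, and sqrt (2 * 1/2 * ln ln x * ln ln ln ln x) is the exponent. Here k is about ln ln
  x / ln 2, so factors k^O(1) are negligible and constants may be crude. A factor 2^(c * k) would be
  fatal, however: the 2^k in the Mertens product has to cancel, up to powers of k, against the 1/2^k
  supplied by the sieve. The obstacle is uniformity in x. A scale needs up to 2^(11 * k) test
  points, too many for a union bound with second moments; moments of order about k suffice. Their
  price is the weight 2^(s * \<Omega>(b)) with 2^s about k, which is summable only if a block has
  prime reciprocal sum of order 1/k; polynomially many such blocks still reach all primes of the
  scale. The event on which the Euler products are bounded is only required for primes up to y in
  the mean square estimates, so it is decided before any block is revealed and all later primes can
  be averaged out on it.\<close>

definition smooth_over :: "nat set \<Rightarrow> nat set" where
  "smooth_over S = {n. n > 0 \<and> prime_factors n \<subseteq> S}"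

lemma smooth_over_pos: "n \<in> smooth_over S \<Longrightarrow> n > 0"
  by (simp add: smooth_over_def)

lemma one_smooth_over [simp]: "Suc 0 \<in> smooth_over S"
  by (simp add: smooth_over_def)

lemma smooth_over_mono: "S \<subseteq> T \<Longrightarrow> smooth_over S \<subseteq> smooth_over T"
  by (auto simp: smooth_over_def)

lemma smooth_over_mult: "m \<in> smooth_over S \<Longrightarrow> n \<in> smooth_over S \<Longrightarrow> m * n \<in> smooth_over S"
  by (auto simp: smooth_over_def prime_factorization_mult)

lemma smooth_over_empty: "smooth_over {} = {1}"
  by (auto simp: smooth_over_def prime_factorization_empty_iff)

lemma smooth_over_multD:
  assumes "m * n \<in> smooth_over S" shows "m \<in> smooth_over S" "n \<in> smooth_over S"
  using assms by (auto simp: smooth_over_def prime_factorization_mult)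

lemma smooth_over_Un_decomp:
  assumes "n \<in> smooth_over (S \<union> T)"
  obtains a b where "n = a * b" "a \<in> smooth_over S" "b \<in> smooth_over T"
proof -
  have "\<exists>a b. n = a * b \<and> a \<in> smooth_over S \<and> b \<in> smooth_over T" using assms
  proof (induction n rule: less_induct)
    case (less n)
    show ?case
    proof (cases "n = 1")
      case True then show ?thesis by (intro exI[of _ 1]) auto
    next
      case False
      then obtain p where p: "prime p" "p dvd n" using prime_factor_nat by blast
      then obtain m where m: "n = p * m" by (auto elim: dvdE)
      have n0: "n > 0" using less.prems smooth_over_pos by blast
      then have m0: "m > 0" "m < n" using m p prime_gt_1_nat[of p] by auto
      have "m \<in> smooth_over (S \<union> T)" using less.prems m smooth_over_multD by blast
      then obtain a b where ab: "m = a * b" "a \<in> smooth_over S" "b \<in> smooth_over T"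
        using less.IH m0 by blast
      have "p \<in> S \<union> T" using less.prems p n0
        by (auto simp: smooth_over_def in_prime_factors_iff)
      then consider "p \<in> smooth_over S" | "p \<in> smooth_over T"
        using p prime_gt_0_nat[of p] by (auto simp: smooth_over_def prime_prime_factors)
      then show ?thesis
      proof cases
        case 1 then show ?thesis
          by (intro exI[of _ "p * a"] exI[of _ b]) (use ab m smooth_over_mult in auto)
      next
        case 2 then show ?thesis
          by (intro exI[of _ "a"] exI[of _ "p * b"]) (use ab m smooth_over_mult in auto)
      qed
    qed
  qed
  then show ?thesis using that by blast
qed

lemma smooth_over_coprime:
  assumes "a \<in> smooth_over S" "b \<in> smooth_over T" "S \<inter> T = {}"
  shows "coprime a b"
proof (rule ccontr)
  assume "\<not> coprime a b"
  then have "gcd a b \<noteq> 1" by (simp add: coprime_iff_gcd_eq_1)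
  then obtain p where "prime p" "p dvd gcd a b" using prime_factor_nat by blast
  then have "p dvd a" "p dvd b" by auto
  then have "p \<in> prime_factors a" "p \<in> prime_factors b"
    using assms \<open>prime p\<close> by (auto simp: smooth_over_def in_prime_factors_iff)
  then show False using assms by (auto simp: smooth_over_def)
qed

text \<open>Coprimality of the two parts makes the splitting of a smooth number unique. Thus
  \<open>smooth_over (S \<union> T)\<close> is in effect a product set, the fact behind both the
  Euler products and \<open>Psi_Un\<close>.\<close>

lemma smooth_over_mult_inj:
  assumes "S \<inter> T = {}"
  shows "inj_on (\<lambda>(a, b). a * b) (smooth_over S \<times> smooth_over T)"
proof (rule inj_onI, clarsimp)
  fix a b c d assume *: "a \<in> smooth_over S" "b \<in> smooth_over T" "c \<in> smooth_over S"
    "d \<in> smooth_over T" "a * b = c * d"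
  have "coprime a d" "coprime c b" using * assms smooth_over_coprime by blast+
  have "a dvd c * d" "c dvd a * b" using *(5) by (metis dvd_triv_left)+
  then have "a dvd c" "c dvd a"
    using \<open>coprime a d\<close> \<open>coprime c b\<close> by (simp_all add: coprime_dvd_mult_left_iff)
  then have "a = c" by (simp add: dvd_antisym)
  then show "a = c \<and> b = d" using * smooth_over_pos by fastforce
qed

lemma smooth_over_Un_image:
  "smooth_over (S \<union> T) = (\<lambda>(a, b). a * b) ` (smooth_over S \<times> smooth_over T)"
proof
  show "smooth_over (S \<union> T) \<subseteq> (\<lambda>(a, b). a * b) ` (smooth_over S \<times> smooth_over T)"
    using smooth_over_Un_decomp by (auto simp: image_iff) (metis)
  show "(\<lambda>(a, b). a * b) ` (smooth_over S \<times> smooth_over T) \<subseteq> smooth_over (S \<union> T)"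
    using smooth_over_mono[of S "S \<union> T"] smooth_over_mono[of T "S \<union> T"]
    by (auto intro!: smooth_over_mult)
qed

lemma smooth_over_single:
  assumes "prime p"
  shows "smooth_over {p} = range (\<lambda>k. p ^ k)"
proof
  show "range (\<lambda>k. p ^ k) \<subseteq> smooth_over {p}"
    using assms prime_factorization_prime_power[OF assms] prime_gt_0_nat[OF assms]
    by (auto simp: smooth_over_def split: if_splits)
  show "smooth_over {p} \<subseteq> range (\<lambda>k. p ^ k)"
  proof
    fix n assume n: "n \<in> smooth_over {p}"
    then have "n > 0" "prime_factors n \<subseteq> {p}" by (auto simp: smooth_over_def)
    then have "n = (\<Prod>p \<in> prime_factors n. p ^ multiplicity p n)" by (intro prime_factorization_nat)
    also have "\<dots> = (\<Prod>p \<in> {p}. p ^ multiplicity p n)"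
      using \<open>prime_factors n \<subseteq> {p}\<close> assms \<open>n > 0\<close>
      by (intro prod.mono_neutral_left) (auto simp: prime_factors_multiplicity)
    finally show "n \<in> range (\<lambda>k. p ^ k)" by auto
  qed
qed

lemma has_sum_geometric:
  fixes z :: "'a::{real_normed_field,banach}"
  assumes "norm z < 1"
  shows "((\<lambda>k. z ^ k) has_sum (1 / (1 - z))) UNIV"
  using assms by (intro norm_summable_imp_has_sum) (auto simp: norm_power intro!: summable_geometric geometric_sums)

lemma has_sum_product_norm:
  fixes f :: "'b \<Rightarrow> 'a::{real_normed_field,banach}" and g :: "'c \<Rightarrow> 'a"
  assumes f: "(f has_sum a) A" "(\<lambda>x. norm (f x)) summable_on A"
    and g: "(g has_sum b) B" "(\<lambda>x. norm (g x)) summable_on B"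
  shows "((\<lambda>(x, y). f x * g y) has_sum (a * b)) (A \<times> B)"
    and "(\<lambda>(x, y). norm (f x * g y)) summable_on (A \<times> B)"
proof -
  show 1: "(\<lambda>(x, y). norm (f x * g y)) summable_on (A \<times> B)"
  proof (rule summable_on_SigmaI)
    show "((\<lambda>y. case (x, y) of (x, y) \<Rightarrow> norm (f x * g y)) has_sum
        (norm (f x) * infsum (\<lambda>y. norm (g y)) B)) B" if "x \<in> A" for x
      using g(2) by (auto simp: norm_mult intro!: has_sum_cmult_right)
    show "(\<lambda>x. norm (f x) * (\<Sum>\<^sub>\<infinity>y\<in>B. norm (g y))) summable_on A"
      using f(2) by (rule summable_on_cmult_left)
  qed auto
  show "((\<lambda>(x, y). f x * g y) has_sum (a * b)) (A \<times> B)"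
  proof (rule has_sum_SigmaI)
    show "((\<lambda>y. case (x, y) of (x, y) \<Rightarrow> f x * g y) has_sum (f x * b)) B" if "x \<in> A" for x
      using g(1) by (auto intro!: has_sum_cmult_right)
    show "((\<lambda>x. f x * b) has_sum a * b) A" using f(1) by (rule has_sum_cmult_left)
    show "(\<lambda>(x, y). f x * g y) summable_on A \<times> B"
      by (rule abs_summable_summable) (use 1 in \<open>simp add: case_prod_unfold\<close>)
  qed
qed

text \<open>Primes are adjoined one at a time: a smooth number for \<open>insert p S\<close> is a
  power of p times a smooth number for S, and the geometric series contributes one factor. Absolute
  summability is carried through the induction because the double sum is rearranged. The value type
  is general, since h is real in Mertens products and Rankin bounds and complex in the random Euler
  product.\<close>

lemma euler_product:
  fixes h :: "nat \<Rightarrow> 'a::{real_normed_field,banach}"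
  assumes "finite S" "\<And>p. p \<in> S \<Longrightarrow> prime p" "h 1 = 1"
    and mult: "\<And>m n. m > 0 \<Longrightarrow> n > 0 \<Longrightarrow> h (m * n) = h m * h n"
    and "\<And>p. p \<in> S \<Longrightarrow> norm (h p) < 1"
  shows "(h has_sum (\<Prod>p\<in>S. 1 / (1 - h p))) (smooth_over S)"
    and "(\<lambda>n. norm (h n)) summable_on (smooth_over S)"
proof -
  have "(h has_sum (\<Prod>p\<in>S. 1 / (1 - h p))) (smooth_over S)
       \<and> (\<lambda>n. norm (h n)) summable_on (smooth_over S)"
    using assms(1,2,5)
  proof (induction S rule: finite_induct)
    case empty
    then show ?case using \<open>h 1 = 1\<close> has_sum_finite[of "{1}" h] by (simp add: smooth_over_empty)
  next
    case (insert p S)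
    have p: "prime p" "norm (h p) < 1" using insert by auto
    have hpow: "h (p ^ k) = h p ^ k" for k
      by (induction k) (use \<open>h 1 = 1\<close> mult p prime_gt_0_nat in auto)
    have inj: "inj_on (\<lambda>k. p ^ k) UNIV" using p prime_gt_1_nat by (auto intro!: injI)
    have 1: "(h has_sum 1 / (1 - h p)) (smooth_over {p})"
      unfolding smooth_over_single[OF p(1)] has_sum_reindex[OF inj]
      using has_sum_geometric[OF p(2)] by (simp add: o_def hpow)
    have 2: "(\<lambda>n. norm (h n)) summable_on (smooth_over {p})"
      unfolding smooth_over_single[OF p(1)] summable_on_reindex[OF inj]
      using has_sum_geometric[of "norm (h p)"] p(2)
      by (auto simp add: o_def hpow norm_power summable_on_def)
    have IH: "(h has_sum (\<Prod>p\<in>S. 1 / (1 - h p))) (smooth_over S)"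
       "(\<lambda>n. norm (h n)) summable_on (smooth_over S)" using insert by auto
    note P = has_sum_product_norm[OF 1 2 IH]
    have inj2: "inj_on (\<lambda>(a, b). a * b) (smooth_over {p} \<times> smooth_over S)"
      using insert by (intro smooth_over_mult_inj) auto
    have im: "smooth_over (insert p S) = (\<lambda>(a, b). a * b) ` (smooth_over {p} \<times> smooth_over S)"
      using smooth_over_Un_image[of "{p}" S] by simp
    have eq: "(case x of (a, b) \<Rightarrow> h a * h b) = h (case x of (a, b) \<Rightarrow> a * b)"
      if "x \<in> smooth_over {p} \<times> smooth_over S" for x
      using that mult smooth_over_pos by (auto split: prod.split)
    show ?case
    proof
      show "(h has_sum (\<Prod>p\<in>insert p S. 1 / (1 - h p))) (smooth_over (insert p S))"
        unfolding im has_sum_reindex[OF inj2] using P(1) insert eq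
        by (subst has_sum_cong[where g = "\<lambda>(a,b). h a * h b"]) auto
      show "(\<lambda>n. norm (h n)) summable_on smooth_over (insert p S)"
        unfolding im summable_on_reindex[OF inj2] using P(2) insert eq
        by (subst summable_on_cong[where g = "\<lambda>(a,b). norm (h a * h b)"]) auto
    qed
  qed
  then show "(h has_sum (\<Prod>p\<in>S. 1 / (1 - h p))) (smooth_over S)"
    "(\<lambda>n. norm (h n)) summable_on (smooth_over S)" by auto
qed

section \<open>Harmonic sums, sums over primes and Mertens products\<close>

lemma real_le_iff_nat_floor: "z \<ge> 0 \<Longrightarrow> real n \<le> z \<longleftrightarrow> n \<le> nat \<lfloor>z\<rfloor>"
  by (simp add: le_nat_iff le_floor_iff)

lemma sum_inverse_le:
  assumes "z \<ge> 1"
  shows "(\<Sum>n | 0 < n \<and> real n \<le> z. 1 / real n) \<le> 1 + ln z"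
proof -
  have *: "(\<Sum>n=1..Suc N. 1 / real n) \<le> 1 + ln (real (Suc N))" for N
  proof (induction N)
    case (Suc N)
    have "ln (real (Suc N) / real (Suc (Suc N))) \<le> real (Suc N) / real (Suc (Suc N)) - 1"
      by (intro ln_le_minus_one) auto
    then have "1 / real (Suc (Suc N)) \<le> ln (real (Suc (Suc N))) - ln (real (Suc N))"
      by (simp add: ln_div field_simps)
    then show ?case using Suc by simp
  qed auto
  define N where "N = nat \<lfloor>z\<rfloor> - 1"
  have "nat \<lfloor>z\<rfloor> \<ge> 1" using assms real_le_iff_nat_floor[of z 1] by simp
  then have SN: "Suc N = nat \<lfloor>z\<rfloor>" by (simp add: N_def)
  have z0: "z \<ge> 0" using assms by simp
  have N: "real (Suc N) \<le> z" "{n. 0 < n \<and> real n \<le> z} = {1..Suc N}"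
    unfolding SN real_le_iff_nat_floor[OF z0] by auto
  have "ln (real (Suc N)) \<le> ln z" using N(1) by (intro ln_mono) auto
  then show ?thesis unfolding N(2) using *[of N] by linarith
qed

lemma ln_le_sum_inverse:
  assumes "z \<ge> 1"
  shows "ln z \<le> (\<Sum>n | 0 < n \<and> real n \<le> z. 1 / real n)"
proof -
  have *: "ln (real (Suc N)) \<le> (\<Sum>n=1..N. 1 / real n)" for N
  proof (induction N)
    case (Suc N)
    have "ln (real (Suc (Suc N)) / real (Suc N)) \<le> real (Suc (Suc N)) / real (Suc N) - 1"
      by (intro ln_le_minus_one) auto
    then have "1 / real (Suc N) \<ge> ln (real (Suc (Suc N))) - ln (real (Suc N))"
      by (simp add: ln_div field_simps)
    then show ?case using Suc by simp
  qed auto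
  define N where "N = nat \<lfloor>z\<rfloor>"
  have z0: "z \<ge> 0" using assms by simp
  have N: "real (Suc N) \<ge> z" "{n. 0 < n \<and> real n \<le> z} = {1..N}"
    unfolding real_le_iff_nat_floor[OF z0] N_def by (auto intro: real_nat_ceiling_ge) linarith
  have "ln z \<le> ln (real (Suc N))" using N(1) assms by (intro ln_mono) auto
  then show ?thesis unfolding N(2) using *[of N] by linarith
qed

text \<open>Telescoping takes the place of the integral comparison: (1 - 1/m) powr (-\<sigma>) >= 1
  + \<sigma>/m shows that m powr (-1-\<sigma>) is at most ((m-1) powr (-\<sigma>) - m powr
  (-\<sigma>)) / \<sigma>.\<close>

lemma sum_powr_le:
  assumes "\<sigma> > 0"
  shows "(\<Sum>n=1..N. real n powr (-1-\<sigma>)) \<le> 1 + 1 / \<sigma>"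
proof -
  have *: "(\<Sum>n=1..Suc N. real n powr (-1-\<sigma>)) \<le> 1 + 1 / \<sigma> - real (Suc N) powr (-\<sigma>) / \<sigma>" for N
  proof (induction N)
    case (Suc N)
    define m where "m = real (Suc (Suc N))"
    have m: "m > 1" "real (Suc N) = m * (1 - 1 / m)" by (auto simp: m_def field_simps)
    have "ln (1 - 1 / m) \<le> - (1 / m)" using ln_le_minus_one[of "1 - 1/m"] m by auto
    then have "\<sigma> / m \<le> - \<sigma> * ln (1 - 1 / m)"
      using mult_left_mono[of "ln (1 - 1 / m)" "- (1 / m)" \<sigma>] assms by simp
    then have "1 + \<sigma> / m \<le> exp (- \<sigma> * ln (1 - 1 / m))"
      using exp_ge_add_one_self[of "\<sigma> / m"] by (smt (verit) exp_le_cancel_iff)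
    then have "1 + \<sigma> / m \<le> (1 - 1 / m) powr (-\<sigma>)" using m by (simp add: powr_def)
    then have "m powr (-\<sigma>) * (1 + \<sigma> / m) \<le> m powr (-\<sigma>) * (1 - 1 / m) powr (-\<sigma>)"
      by (intro mult_left_mono) auto
    also have "\<dots> = (m * (1 - 1 / m)) powr (-\<sigma>)" using m by (intro powr_mult[symmetric])
    finally have "m powr (-\<sigma>) * (1 + \<sigma> / m) \<le> real (Suc N) powr (-\<sigma>)" using m by metis
    moreover have "m powr (-1-\<sigma>) = m powr (-\<sigma>) / m" using m by (simp add: powr_diff powr_minus field_simps)
    ultimately have "m powr (-\<sigma>) + \<sigma> * m powr (-1-\<sigma>) \<le> real (Suc N) powr (-\<sigma>)"
      by (simp add: algebra_simps)
    then have "m powr (-1-\<sigma>) \<le> (real (Suc N) powr (-\<sigma>) - m powr (-\<sigma>)) / \<sigma>"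
      using assms by (simp add: pos_le_divide_eq algebra_simps del: of_nat_Suc)
    then have "m powr (-1-\<sigma>) \<le> real (Suc N) powr (-\<sigma>) / \<sigma> - m powr (-\<sigma>) / \<sigma>"
      by (simp add: diff_divide_distrib)
    then show ?case using Suc by (simp add: m_def)
  qed auto
  show ?thesis
  proof (cases N)
    case (Suc k)
    then show ?thesis using *[of k] assms
      by (smt (verit) divide_nonneg_pos powr_ge_zero)
  qed (use assms in auto)
qed

definition primes_upto :: "real \<Rightarrow> nat set" where
  "primes_upto y = {p. prime p \<and> real p \<le> y}"

lemma finite_nat_le_real [simp]: "finite {n::nat. real n \<le> y}"
  by (rule finite_subset[of _ "{..nat \<lfloor>y\<rfloor>}"]) (auto simp: le_nat_floor)

lemma finite_primes_upto [simp]: "finite (primes_upto y)"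
  by (rule finite_subset[OF _ finite_nat_le_real[of y]]) (auto simp: primes_upto_def)

lemma primes_upto_prime: "p \<in> primes_upto y \<Longrightarrow> prime p"
  by (simp add: primes_upto_def)

lemma primes_upto_mono: "y \<le> z \<Longrightarrow> primes_upto y \<subseteq> primes_upto z"
  by (auto simp: primes_upto_def)

lemma prime_real_ge_2: "prime p \<Longrightarrow> real p \<ge> 2"
  using prime_ge_2_nat[of p] by simp

text \<open>Comparison with the Euler product at 1 + \<sigma>, where \<sigma> = \<eta> / ln y: it is
  at most 1 + 1/\<sigma>, and for p <= y the shift by \<sigma> costs only a factor exp (-\<eta>).
  Small \<eta> brings the leading constant close to 1, as the law of the iterated logarithm and
  \<open>eventually_mertens_le\<close> require; elsewhere \<eta> = 1 is enough.\<close>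

lemma primes_upto_sum_le:
  assumes "y > 1" "\<eta> > 0"
  shows "(\<Sum>p\<in>primes_upto y. 1 / real p) \<le> exp \<eta> * ln (1 + ln y / \<eta>)"
proof -
  define \<sigma> where "\<sigma> = \<eta> / ln y"
  have ly: "ln y > 0" using assms by simp
  have \<sigma>: "\<sigma> > 0" using assms by (simp add: \<sigma>_def)
  define h where "h n = real n powr (-1-\<sigma>)" for n :: nat
  let ?S = "primes_upto y"
  have h1: "0 < h p" "h p < 1" if "p \<in> ?S" for p
  proof -
    have "real p > 1" using prime_real_ge_2[OF primes_upto_prime[OF that]] by simp
    then show "0 < h p" "h p < 1" using \<sigma> by (auto simp: h_def powr_less_one)
  qed
  have hs: "(h has_sum (\<Prod>p\<in>?S. 1 / (1 - h p))) (smooth_over ?S)"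
  proof (rule euler_product)
    show "h (m * n) = h m * h n" for m n by (simp add: h_def powr_mult)
    show "norm (h p) < 1" if "p \<in> ?S" for p using h1[OF that] by simp
  qed (auto simp: h_def primes_upto_prime)
  have "(\<Prod>p\<in>?S. 1 / (1 - h p)) \<le> 1 + 1 / \<sigma>"
  proof (rule has_sum_le_finite_sums[OF hs])
    fix F assume F: "finite F" "F \<subseteq> smooth_over ?S"
    have "sum h F \<le> sum h {1..Max (insert 0 F)}"
      using F smooth_over_pos by (intro sum_mono2) (auto simp: h_def Suc_le_eq)
    also have "\<dots> \<le> 1 + 1 / \<sigma>" unfolding h_def by (rule sum_powr_le[OF \<sigma>])
    finally show "sum h F \<le> 1 + 1 / \<sigma>" .
  qed
  moreover have "0 < (\<Prod>p\<in>?S. 1 / (1 - h p))" using h1 by (intro prod_pos) simp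
  ultimately have "ln (\<Prod>p\<in>?S. 1 / (1 - h p)) \<le> ln (1 + 1 / \<sigma>)"
    using ln_mono by blast
  also have "ln (\<Prod>p\<in>?S. 1 / (1 - h p)) = (\<Sum>p\<in>?S. ln (1 / (1 - h p)))"
    using h1 by (intro ln_prod) (auto simp: less_imp_neq dest: less_imp_neq)
  finally have le: "(\<Sum>p\<in>?S. ln (1 / (1 - h p))) \<le> ln (1 + ln y / \<eta>)"
    by (simp add: \<sigma>_def)
  have "exp (-\<eta>) * (\<Sum>p\<in>?S. 1 / real p) \<le> (\<Sum>p\<in>?S. ln (1 / (1 - h p)))"
    unfolding sum_distrib_left
  proof (rule sum_mono)
    fix p assume p: "p \<in> ?S"
    have rp: "real p \<ge> 2" using p prime_real_ge_2 primes_upto_prime by blast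
    have "ln (real p) \<le> ln y" using p rp by (auto simp: primes_upto_def)
    then have "\<sigma> * ln (real p) \<le> \<eta>" using ly assms by (simp add: \<sigma>_def field_simps)
    then have "exp (-\<eta>) \<le> real p powr (-\<sigma>)" using rp by (simp add: powr_def)
    then have "exp (-\<eta>) * (1 / real p) \<le> real p powr (-\<sigma>) * (1 / real p)"
      by (intro mult_right_mono) auto
    also have "\<dots> = real p powr (-\<sigma>) * real p powr (-1)" using rp by (simp add: powr_minus field_simps)
    also have "\<dots> = real p powr (-\<sigma> + -1)" by (rule powr_add[symmetric])
    also have "-\<sigma> + -1 = -1 - \<sigma>" by simp
    also have "real p powr (-1 - \<sigma>) = h p" by (simp add: h_def)
    also have "\<dots> \<le> ln (1 / (1 - h p))"
      using h1[OF p] ln_le_minus_one[of "1 - h p"] by (simp add: ln_div)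
    finally show "exp (-\<eta>) * (1 / real p) \<le> ln (1 / (1 - h p))" .
  qed
  then have "exp (-\<eta>) * (\<Sum>p\<in>?S. 1 / real p) \<le> ln (1 + ln y / \<eta>)" using le by linarith
  then show ?thesis by (simp add: exp_minus field_simps)
qed

definition mertens :: "nat set \<Rightarrow> real" where
  "mertens S = (\<Prod>p\<in>S. 1 / (1 - 1 / real p))"

lemma mertens_has_sum:
  assumes "finite S" "\<And>p. p \<in> S \<Longrightarrow> prime p"
  shows "((\<lambda>n. 1 / real n) has_sum mertens S) (smooth_over S)"
  unfolding mertens_def
proof (rule euler_product(1)[where h = "\<lambda>n. 1 / real n"])
  show "norm (1 / real p) < 1" if "p \<in> S" for p
    using prime_real_ge_2[OF assms(2)[OF that]] by simp
qed (use assms in auto)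

lemma sum_inverse_smooth_le:
  assumes "finite S" "\<And>p. p \<in> S \<Longrightarrow> prime p" "finite B" "B \<subseteq> smooth_over S"
  shows "(\<Sum>n\<in>B. 1 / real n) \<le> mertens S"
  by (rule finite_sum_le_has_sum[OF mertens_has_sum]) (use assms in auto)

lemma mertens_ge_1:
  assumes "finite S" "\<And>p. p \<in> S \<Longrightarrow> prime p"
  shows "mertens S \<ge> 1"
  using sum_inverse_smooth_le[OF assms, of "{1}"] by simp

lemma mertens_primes_upto_ge:
  assumes "y \<ge> 1"
  shows "ln y \<le> mertens (primes_upto y)"
proof -
  have "ln y \<le> (\<Sum>n | 0 < n \<and> real n \<le> y. 1 / real n)" using ln_le_sum_inverse assms by auto
  also have "\<dots> \<le> mertens (primes_upto y)"
  proof (rule sum_inverse_smooth_le)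
    show "{n. 0 < n \<and> real n \<le> y} \<subseteq> smooth_over (primes_upto y)"
    proof
      fix n assume n: "n \<in> {n. 0 < n \<and> real n \<le> y}"
      have "real p \<le> y" if "p \<in> prime_factors n" for p
      proof -
        have "p \<le> n" using that n by (auto simp: in_prime_factors_iff intro: dvd_imp_le)
        then show ?thesis using n by auto
      qed
      then show "n \<in> smooth_over (primes_upto y)" using n
        by (auto simp: smooth_over_def primes_upto_def)
    qed
  qed (auto intro: primes_upto_prime)
  finally show ?thesis .
qed

lemma mertens_Un:
  assumes "finite S" "finite T" "S \<inter> T = {}"
  shows "mertens (S \<union> T) = mertens S * mertens T"
  unfolding mertens_def using assms by (rule prod.union_disjoint)

lemma minus_ln_one_minus_le:
  assumes "0 \<le> x" "x \<le> 1/2"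
  shows "- ln (1 - x) \<le> x + 2 * x\<^sup>2" "- ln (1 - x) \<le> 2 * (x::real)"
proof -
  show 1: "- ln (1 - x) \<le> x + 2 * x\<^sup>2" using ln_one_minus_pos_lower_bound[OF assms] by simp
  have "2 * x\<^sup>2 \<le> x"
    using mult_left_mono[of x "1/2" x] assms by (simp add: power2_eq_square)
  then show "- ln (1 - x) \<le> 2 * x" using 1 by simp
qed

lemma sum_inverse_square_primes_le:
  assumes "finite S" "\<And>p. p \<in> S \<Longrightarrow> prime p"
  shows "(\<Sum>p\<in>S. 1 / (real p)\<^sup>2) \<le> 1"
proof -
  have *: "(\<Sum>n=2..Suc N. 1 / (real n)\<^sup>2) \<le> 1 - 1 / real (Suc N)" for N
  proof (induction N)
    case (Suc N)
    have "1 / (real (Suc (Suc N)))\<^sup>2 \<le> 1 / (real (Suc N) * real (Suc (Suc N)))"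
      by (intro divide_left_mono) (auto simp: power2_eq_square)
    also have "\<dots> = 1 / real (Suc N) - 1 / real (Suc (Suc N))" by (simp add: field_simps)
    finally show ?case using Suc by (simp add: algebra_simps)
  qed auto
  have "(\<Sum>p\<in>S. 1 / (real p)\<^sup>2) \<le> (\<Sum>n=2..Suc (Max (insert 0 S)). 1 / (real n)\<^sup>2)"
  proof (rule sum_mono2)
    show "S \<subseteq> {2..Suc (Max (insert 0 S))}"
    proof
      fix p assume "p \<in> S"
      then have "p \<le> Max (insert 0 S)" "p \<ge> 2" using assms prime_ge_2_nat by auto
      then show "p \<in> {2..Suc (Max (insert 0 S))}" by auto
    qed
  qed auto
  also have "\<dots> \<le> 1" using *[of "Max (insert 0 S)"]
    by (smt (verit) divide_nonneg_nonneg of_nat_0_le_iff)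
  finally show ?thesis .
qed

lemma mertens_le:
  assumes "finite S" "\<And>p. p \<in> S \<Longrightarrow> prime p"
  shows "mertens S \<le> exp (2 + (\<Sum>p\<in>S. 1 / real p))"
proof -
  have *: "1 / (1 - 1 / real p) \<le> exp (1 / real p + 2 * (1 / (real p)\<^sup>2))" if "p \<in> S" for p
  proof -
    have p: "real p \<ge> 2" using assms that prime_real_ge_2 by blast
    then have "- ln (1 - 1 / real p) \<le> 1 / real p + 2 * (1 / (real p)\<^sup>2)"
      using minus_ln_one_minus_le(1)[of "1 / real p"] by (simp add: power_divide)
    then have "exp (- ln (1 - 1 / real p)) \<le> exp (1 / real p + 2 * (1 / (real p)\<^sup>2))" by simp
    then show ?thesis using p by (simp add: exp_minus field_simps)
  qed
  have "mertens S \<le> (\<Prod>p\<in>S. exp (1 / real p + 2 * (1 / (real p)\<^sup>2)))"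
    unfolding mertens_def
  proof (rule prod_mono)
    fix p assume p: "p \<in> S"
    then have "real p \<ge> 2" using assms prime_real_ge_2 by blast
    then show "0 \<le> 1 / (1 - 1 / real p) \<and> 1 / (1 - 1 / real p) \<le> exp (1 / real p + 2 * (1 / (real p)\<^sup>2))"
      using *[OF p] by simp
  qed
  also have "\<dots> = exp ((\<Sum>p\<in>S. 1 / real p) + 2 * (\<Sum>p\<in>S. 1 / (real p)\<^sup>2))"
    using assms by (simp add: exp_sum[symmetric] sum.distrib sum_distrib_left)
  also have "\<dots> \<le> exp (2 + (\<Sum>p\<in>S. 1 / real p))"
    using sum_inverse_square_primes_le[OF assms] by simp
  finally show ?thesis .
qed

subsection \<open>Divisor bounds and the sieve\<close>

definition divisor_count :: "nat \<Rightarrow> nat" where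
  "divisor_count n = card {d. d dvd n}"

lemma divisor_count_mult_le:
  assumes "m > 0" "n > 0"
  shows "divisor_count (m * n) \<le> divisor_count m * divisor_count n"
proof -
  have "{d. d dvd m * n} \<subseteq> (\<lambda>(a, b). a * b) ` ({d. d dvd m} \<times> {d. d dvd n})"
  proof
    fix d assume "d \<in> {d. d dvd m * n}"
    then obtain b c where "d = b * c" "b dvd m" "c dvd n" using division_decomp by blast
    then show "d \<in> (\<lambda>(a, b). a * b) ` ({d. d dvd m} \<times> {d. d dvd n})" by auto
  qed
  then have "divisor_count (m * n) \<le> card ({d. d dvd m} \<times> {d. d dvd n})"
    unfolding divisor_count_def using assms by (intro surj_card_le) auto
  then show ?thesis by (simp add: divisor_count_def card_cartesian_product)
qed

definition Omega_count :: "nat \<Rightarrow> nat" where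
  "Omega_count n = size (prime_factorization n)"

lemma Omega_count_mult: "m > 0 \<Longrightarrow> n > 0 \<Longrightarrow> Omega_count (m * n) = Omega_count m + Omega_count n"
  by (simp add: Omega_count_def prime_factorization_mult)

lemma Omega_count_prime: "prime p \<Longrightarrow> Omega_count p = 1"
  by (simp add: Omega_count_def prime_factorization_prime)

lemma Omega_count_1: "Omega_count 1 = 0" "Omega_count (Suc 0) = 0"
  by (simp_all add: Omega_count_def)

lemma divisor_count_le_Omega:
  assumes "n > 0"
  shows "divisor_count n \<le> 2 ^ Omega_count n"
  using assms
proof (induction n rule: less_induct)
  case (less n)
  show ?case
  proof (cases "n = 1")
    case True then show ?thesis by (simp add: divisor_count_def)
  next
    case False
    then obtain p where "prime p" "p dvd n" using prime_factor_nat by blast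
    then obtain m where p: "prime p" "n = p * m" by (auto elim: dvdE)
    then have m: "m > 0" "m < n" using less.prems prime_gt_1_nat[of p] by auto
    have "{d. d dvd p} = {1, p}" using p(1) by (auto simp: prime_nat_iff)
    then have dp: "divisor_count p = 2" using prime_gt_1_nat[OF p(1)] by (simp add: divisor_count_def)
    have "divisor_count n \<le> 2 * divisor_count m"
      using divisor_count_mult_le[of p m] p m prime_gt_0_nat[of p] dp by simp
    also have "\<dots> \<le> 2 ^ Omega_count n"
      using less.IH[OF m(2,1)] p m prime_gt_0_nat[of p] by (simp add: Omega_count_mult Omega_count_prime)
    finally show ?thesis .
  qed
qed

lemma sum_divisor_count_le:
  assumes "z \<ge> 1"
  shows "(\<Sum>n | 0 < n \<and> real n \<le> z. real (divisor_count n) / real n) \<le> (1 + ln z)\<^sup>2"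
proof -
  let ?A = "{n. 0 < n \<and> real n \<le> z}"
  have fin: "finite ?A" by (rule finite_subset[OF _ finite_nat_le_real[of z]]) auto
  have "(\<Sum>n\<in>?A. real (divisor_count n) / real n) = (\<Sum>n\<in>?A. \<Sum>d | d dvd n. 1 / real n)"
    by (simp add: divisor_count_def)
  also have "\<dots> = (\<Sum>(n, d)\<in>(SIGMA n:?A. {d. d dvd n}). 1 / real n)"
    using fin by (intro sum.Sigma) auto
  also have "\<dots> \<le> (\<Sum>(a, b)\<in>?A \<times> ?A. 1 / real a * (1 / real b))"
  proof (rule sum_le_included[where i = "\<lambda>(a, b). (a * b, a)"])
    show "\<forall>x\<in>SIGMA n:?A. {d. d dvd n}. \<exists>y\<in>?A \<times> ?A. (case y of (a, b) \<Rightarrow> (a * b, a)) = x \<and>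
        (case x of (n, d) \<Rightarrow> 1 / real n) \<le> (case y of (a, b) \<Rightarrow> 1 / real a * (1 / real b))"
    proof (clarify)
      fix n d assume "0 < n" "real n \<le> z" "d dvd n"
      then obtain e where e: "n = d * e" by (auto elim: dvdE)
      then have pos: "d > 0" "e > 0" using \<open>0 < n\<close> by auto
      then have "d \<le> n" "e \<le> n" using e by auto
      then have "real d \<le> z" "real e \<le> z" using \<open>real n \<le> z\<close> by linarith+
      then show "\<exists>y\<in>?A \<times> ?A. (case y of (a, b) \<Rightarrow> (a * b, a)) = (n, d) \<and>
        1 / real n \<le> (case y of (a, b) \<Rightarrow> 1 / real a * (1 / real b))"
        using e pos by (intro bexI[of _ "(d, e)"]) auto
    qed
  qed (use fin in \<open>auto intro: finite_divisors_nat\<close>)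
  also have "\<dots> = (\<Sum>n\<in>?A. 1 / real n)\<^sup>2"
    by (simp add: power2_eq_square sum_product sum.cartesian_product)
  also have "\<dots> \<le> (1 + ln z)\<^sup>2"
    using sum_inverse_le[OF assms] by (intro power_mono sum_nonneg) auto
  finally show ?thesis .
qed

text \<open>Bonferroni's inequality: for nonempty Q the truncated sum collapses to the binomial
  coefficient of card Q - 1 over r, with sign +1 because r is even; for empty Q only the term D = {}
  remains.\<close>

lemma truncated_alternating_sum_ge:
  assumes "finite Q" "even r"
  shows "(if Q = {} then 1 else 0) \<le> (\<Sum>D | D \<subseteq> Q \<and> card D \<le> r. (-1::real) ^ card D)"
proof -
  have fin: "finite {D. D \<subseteq> Q \<and> card D \<le> r}"
    by (rule finite_subset[of _ "Pow Q"]) (use assms in auto)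
  have "(\<Sum>D | D \<subseteq> Q \<and> card D \<le> r. (-1::real) ^ card D)
      = (\<Sum>j\<le>r. \<Sum>D\<in>{D \<in> {D. D \<subseteq> Q \<and> card D \<le> r}. card D = j}. (-1) ^ card D)"
    by (rule sum.group[symmetric]) (use fin in auto)
  also have "\<dots> = (\<Sum>j\<le>r. \<Sum>D | D \<subseteq> Q \<and> card D = j. (-1) ^ j)"
    by (intro sum.cong refl) auto
  also have "\<dots> = (\<Sum>j\<le>r. (real (card Q) gchoose j) * (-1) ^ j)"
    using assms by (simp add: n_subsets binomial_gbinomial)
  also have "\<dots> = (real (card Q) - 1 gchoose r)"
    using assms by (simp add: gbinomial_sum_lower_neg)
  finally have eq: "(\<Sum>D | D \<subseteq> Q \<and> card D \<le> r. (-1::real) ^ card D) = (real (card Q) - 1 gchoose r)" .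
  show ?thesis
  proof (cases "Q = {}")
    case True
    then have "{D. D \<subseteq> Q \<and> card D \<le> r} = {{}}" by auto
    then show ?thesis using True by simp
  next
    case False
    then have "card Q \<ge> 1" using assms by (simp add: Suc_le_eq card_gt_0_iff)
    then have "(real (card Q) - 1 gchoose r) = real ((card Q - 1) choose r)"
      by (simp add: binomial_gbinomial of_nat_diff)
    then show ?thesis using eq False by simp
  qed
qed

lemma card_subsets_le:
  assumes "finite P"
  shows "card {D. D \<subseteq> P \<and> card D \<le> r} \<le> (card P + 1) ^ r"
proof -
  have fin: "finite {D. D \<subseteq> P \<and> card D \<le> r}"
    by (rule finite_subset[of _ "Pow P"]) (use assms in auto)
  have "card {D. D \<subseteq> P \<and> card D \<le> r} = (\<Sum>D | D \<subseteq> P \<and> card D \<le> r. 1)" by simp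
  also have "\<dots> = (\<Sum>j\<le>r. \<Sum>D\<in>{D \<in> {D. D \<subseteq> P \<and> card D \<le> r}. card D = j}. 1)"
    by (rule sum.group[symmetric]) (use fin in auto)
  also have "\<dots> = (\<Sum>j\<le>r. \<Sum>D | D \<subseteq> P \<and> card D = j. 1)"
    by (intro sum.cong refl) auto
  also have "\<dots> = (\<Sum>j\<le>r. card P choose j)"
    using assms by (simp add: n_subsets)
  also have "\<dots> \<le> (\<Sum>j\<le>r. (r choose j) * card P ^ j)"
  proof (rule sum_mono)
    fix j assume "j \<in> {..r}"
    then have "1 \<le> r choose j" by (simp add: Suc_le_eq)
    moreover have "card P choose j \<le> card P ^ j"
      by (cases "j \<le> card P") (auto simp: binomial_le_pow binomial_eq_0)
    ultimately show "card P choose j \<le> (r choose j) * card P ^ j"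
      by (metis mult_le_mono nat_mult_1)
  qed
  also have "\<dots> = (card P + 1) ^ r" using binomial_ring[of "card P" 1 r] by simp
  finally show ?thesis .
qed

lemma card_multiples_interval:
  assumes "d > 0" "0 \<le> a" "a \<le> b"
  shows "\<bar>real (card {n::nat. a < real n \<and> real n \<le> b \<and> d dvd n}) - (b - a) / real d\<bar> \<le> 1"
proof -
  have eq: "{n. a < real n \<and> real n \<le> b \<and> d dvd n} = (\<lambda>k. d * k) ` {nat \<lfloor>a / d\<rfloor> <.. nat \<lfloor>b / d\<rfloor>}"
  proof -
    have "a < real (d * k) \<longleftrightarrow> nat \<lfloor>a / d\<rfloor> < k" "real (d * k) \<le> b \<longleftrightarrow> k \<le> nat \<lfloor>b / d\<rfloor>" for k
    proof -
      have "real (d * k) \<le> c \<longleftrightarrow> real k \<le> c / d" for c using assms by (simp add: field_simps)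
      moreover have "0 \<le> a / d" "0 \<le> b / d" using assms by auto
      ultimately show "a < real (d * k) \<longleftrightarrow> nat \<lfloor>a / d\<rfloor> < k" "real (d * k) \<le> b \<longleftrightarrow> k \<le> nat \<lfloor>b / d\<rfloor>"
        using real_le_iff_nat_floor by (metis not_le)+
    qed
    then show ?thesis by (fastforce elim!: dvdE)
  qed
  have "card {n. a < real n \<and> real n \<le> b \<and> d dvd n} = card {nat \<lfloor>a / d\<rfloor> <.. nat \<lfloor>b / d\<rfloor>}"
    unfolding eq using assms by (intro card_image) (auto simp: inj_on_def)
  moreover have le: "nat \<lfloor>a / d\<rfloor> \<le> nat \<lfloor>b / d\<rfloor>"
    using assms by (intro nat_mono floor_mono divide_right_mono) auto
  moreover have "0 \<le> \<lfloor>a / d\<rfloor>" "0 \<le> \<lfloor>b / d\<rfloor>" using assms by auto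
  ultimately have "real (card {n. a < real n \<and> real n \<le> b \<and> d dvd n}) = real_of_int \<lfloor>b / d\<rfloor> - real_of_int \<lfloor>a / d\<rfloor>"
    by (simp add: of_nat_diff)
  moreover have "(b - a) / real d = b / d - a / d" by (simp add: diff_divide_distrib)
  ultimately show ?thesis by linarith
qed

lemma prod_primes_dvd_iff:
  fixes D :: "nat set"
  assumes "finite D" "\<And>p. p \<in> D \<Longrightarrow> prime p"
  shows "(\<Prod>D) dvd n \<longleftrightarrow> (\<forall>p\<in>D. p dvd n)"
proof
  assume "\<Prod>D dvd n" then show "\<forall>p\<in>D. p dvd n"
    using assms(1) dvd_prodI dvd_trans by (metis (full_types))
next
  assume "\<forall>p\<in>D. p dvd n"
  with assms show "\<Prod>D dvd n"
  proof (induction D rule: finite_induct)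
    case (insert p D)
    have "coprime p (\<Prod>D)"
      by (rule prod_coprime_right) (use insert in \<open>metis insertCI primes_coprime\<close>)
    then show ?case using insert by (simp add: divides_mult)
  qed simp
qed

text \<open>Brun's pure sieve, with Rankin's trick (parameter \<open>t\<close>) for the truncation error.\<close>
lemma brun_sieve:
  fixes w \<delta> z t :: real
  assumes "0 < \<delta>" "\<delta> \<le> 1" "2 \<le> z" "z \<le> w" "even r" "1 \<le> t"
  shows "real (card {p. prime p \<and> w < real p \<and> real p \<le> w * exp \<delta>})
    \<le> 2 * \<delta> * w * (1 / ln z + exp (t * (\<Sum>p\<in>primes_upto z. 1 / real p)) / t ^ r) + (z + 1) ^ r"
proof -
  define P where "P = primes_upto z"
  define W where "W = {n::nat. w < real n \<and> real n \<le> w * exp \<delta>}"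
  define H where "H = w * exp \<delta> - w"
  define DD where "DD = {D. D \<subseteq> P \<and> card D \<le> r}"
  have finP: "finite P" by (simp add: P_def)
  have finW: "finite W" unfolding W_def by (rule finite_subset[OF _ finite_nat_le_real[of "w * exp \<delta>"]]) auto
  have finD: "finite DD" unfolding DD_def by (rule finite_subset[of _ "Pow P"]) (use finP in auto)
  have prP: "prime p" if "p \<in> P" for p using that by (simp add: P_def primes_upto_def)
  have w0: "w > 0" using assms by simp
  have "exp \<delta> \<le> 1 + \<delta> + \<delta>\<^sup>2" using assms by (intro exp_bound) auto
  moreover have "\<delta>\<^sup>2 \<le> \<delta>" using assms by (simp add: power2_eq_square mult_left_le)
  ultimately have "exp \<delta> - 1 \<le> 2 * \<delta>" by simp
  from mult_left_mono[OF this, of w] have H: "0 \<le> H" "H \<le> 2 * \<delta> * w"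
    using w0 assms by (auto simp: H_def algebra_simps)
  have prod_pos: "\<Prod>D > 0" if "D \<in> DD" for D
    using that prP prime_gt_0_nat by (intro prod_pos) (auto simp: DD_def)
  have "real (card {p. prime p \<and> w < real p \<and> real p \<le> w * exp \<delta>})
      \<le> real (card {n\<in>W. {p\<in>P. p dvd n} = {}})"
  proof (intro of_nat_mono card_mono)
    show "{p. prime p \<and> w < real p \<and> real p \<le> w * exp \<delta>} \<subseteq> {n\<in>W. {p\<in>P. p dvd n} = {}}"
    proof clarify
      fix q assume q: "prime q" "w < real q" "real q \<le> w * exp \<delta>"
      have "\<not> p dvd q" if "p \<in> P" for p
      proof
        assume "p dvd q"
        then have "p = q" using q(1) prP[OF that] by (simp add: primes_dvd_imp_eq)
        then show False using that q assms by (simp add: P_def primes_upto_def)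
      qed
      then show "q \<in> W \<and> {p \<in> P. p dvd q} = {}" using q by (auto simp: W_def)
    qed
  qed (use finW in auto)
  also have "\<dots> = (\<Sum>n\<in>W. if {p\<in>P. p dvd n} = {} then 1 else 0)"
    using finW by (subst sum.inter_filter[symmetric]) auto
  \<comment> \<open>The even truncation majorises the indicator of n having no prime factor in P.
    Only products of at most r primes occur as moduli, so the rounding errors, at most 1 for each
    modulus, add up to at most (z + 1)^r.\<close>
  also have "\<dots> \<le> (\<Sum>n\<in>W. \<Sum>D | D \<subseteq> {p\<in>P. p dvd n} \<and> card D \<le> r. (-1) ^ card D)"
    using finP assms by (intro sum_mono truncated_alternating_sum_ge) auto
  also have "\<dots> = (\<Sum>n\<in>W. \<Sum>D\<in>DD. if \<Prod>D dvd n then (-1) ^ card D else 0)"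
  proof (rule sum.cong[OF refl])
    fix n
    have "{D. D \<subseteq> {p\<in>P. p dvd n} \<and> card D \<le> r} = {D\<in>DD. \<Prod>D dvd n}"
    proof -
      have "\<Prod>D dvd n \<longleftrightarrow> (\<forall>p\<in>D. p dvd n)" if "D \<subseteq> P" for D
        using that finP prP by (intro prod_primes_dvd_iff) (auto intro: finite_subset)
      then show ?thesis unfolding DD_def by blast
    qed
    then show "(\<Sum>D | D \<subseteq> {p\<in>P. p dvd n} \<and> card D \<le> r. (-1::real) ^ card D)
       = (\<Sum>D\<in>DD. if \<Prod>D dvd n then (-1) ^ card D else 0)"
      using finD by (simp add: sum.inter_filter)
  qed
  also have "\<dots> = (\<Sum>D\<in>DD. \<Sum>n\<in>W. if \<Prod>D dvd n then (-1) ^ card D else 0)"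
    by (rule sum.swap)
  also have "\<dots> = (\<Sum>D\<in>DD. (-1) ^ card D * real (card {n\<in>W. \<Prod>D dvd n}))"
    using finW by (intro sum.cong refl) (simp add: sum.inter_filter[symmetric])
  also have "\<dots> \<le> (\<Sum>D\<in>DD. (-1) ^ card D * (H / real (\<Prod>D)) + 1)"
  proof (rule sum_mono)
    fix D assume D: "D \<in> DD"
    have "w \<le> w * exp \<delta>" using H(1) by (simp add: H_def)
    from card_multiples_interval[OF prod_pos[OF D] less_imp_le[OF w0] this]
    have b: "\<bar>real (card {n\<in>W. \<Prod>D dvd n}) - H / real (\<Prod>D)\<bar> \<le> 1"
      by (simp add: W_def H_def)
    obtain s :: real where s: "(-1) ^ card D = s" "s = 1 \<or> s = -1"
      by (metis neg_one_even_power neg_one_odd_power)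
    then show "(-1) ^ card D * real (card {n\<in>W. \<Prod>D dvd n}) \<le> (-1) ^ card D * (H / real (\<Prod>D)) + 1"
      unfolding s(1) using b s(2) by (auto simp: abs_le_iff)
  qed
  also have "\<dots> = H * (\<Sum>D\<in>DD. (-1) ^ card D / real (\<Prod>D)) + real (card DD)"
    by (simp add: sum.distrib sum_distrib_left mult_ac)
  also have "\<dots> \<le> 2 * \<delta> * w * (1 / ln z + exp (t * (\<Sum>p\<in>P. 1 / real p)) / t ^ r) + (z + 1) ^ r"
  proof (rule add_mono)
    have "card P \<le> card {1..nat \<lfloor>z\<rfloor>}"
      using assms prime_ge_1_nat real_le_iff_nat_floor[of z]
      by (intro card_mono) (auto simp: P_def primes_upto_def)
    then have "real (card P) \<le> z" using assms real_le_iff_nat_floor[of z "card P"] by simp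
    have "real (card DD) \<le> real ((card P + 1) ^ r)"
      unfolding DD_def by (intro of_nat_mono card_subsets_le finP)
    also have "\<dots> \<le> (z + 1) ^ r"
      using \<open>real (card P) \<le> z\<close> by (simp, intro power_mono) auto
    finally show "real (card DD) \<le> (z + 1) ^ r" .
    have full: "(\<Sum>D\<in>Pow P. (-1) ^ card D / real (\<Prod>D)) = 1 / mertens P"
    proof -
      have "(\<Prod>p\<in>P. - (1 / real p) + 1) = (\<Sum>D\<in>Pow P. (\<Prod>p\<in>D. - (1 / real p)) * (\<Prod>p\<in>P-D. 1))"
        by (rule prod_add[OF finP])
      also have "\<dots> = (\<Sum>D\<in>Pow P. (-1) ^ card D / real (\<Prod>D))"
        by (intro sum.cong refl) (simp add: prod_uminus prod_dividef)
      finally show ?thesis by (simp add: mertens_def prod_dividef)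
    qed
    \<comment> \<open>Over all subsets the main term would be exactly 1 / mertens P. The subsets
      left out have at least r elements, so each may be multiplied by t^(card D) / t^r >= 1; the
      enlarged sum is then bounded by the full product of 1 + t/p.\<close>
    have rest: "(\<Sum>D\<in>Pow P - DD. 1 / real (\<Prod>D)) \<le> exp (t * (\<Sum>p\<in>P. 1 / real p)) / t ^ r"
    proof -
      have "(\<Sum>D\<in>Pow P - DD. 1 / real (\<Prod>D)) \<le> (\<Sum>D\<in>Pow P - DD. (\<Prod>p\<in>D. t / real p) / t ^ r)"
      proof (rule sum_mono)
        fix D assume "D \<in> Pow P - DD"
        then have "card D \<ge> r" by (auto simp: DD_def)
        then have "t ^ r \<le> t ^ card D" using assms by (intro power_increasing) auto
        then have "1 \<le> t ^ card D / t ^ r" using assms by simp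
        then have "1 / real (\<Prod>D) \<le> (t ^ card D / t ^ r) / real (\<Prod>D)"
          by (intro divide_right_mono) (auto intro: prod_nonneg)
        then show "1 / real (\<Prod>D) \<le> (\<Prod>p\<in>D. t / real p) / t ^ r"
          by (simp add: prod_dividef mult.commute)
      qed
      also have "\<dots> \<le> (\<Sum>D\<in>Pow P. (\<Prod>p\<in>D. t / real p) / t ^ r)"
        using finP assms by (intro sum_mono2) (auto intro!: divide_nonneg_nonneg prod_nonneg)
      also have "\<dots> = (\<Prod>p\<in>P. t / real p + 1) / t ^ r"
        using prod_add[OF finP, of "\<lambda>p. t / real p" "\<lambda>_. 1"] by (simp add: sum_divide_distrib)
      also have "\<dots> \<le> (\<Prod>p\<in>P. exp (t / real p)) / t ^ r"
        using assms by (intro divide_right_mono prod_mono) (auto simp: add.commute)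
      also have "\<dots> = exp (t * (\<Sum>p\<in>P. 1 / real p)) / t ^ r"
        using finP by (simp add: exp_sum[symmetric] sum_distrib_left)
      finally show ?thesis .
    qed
    have "(\<Sum>D\<in>DD. (-1) ^ card D / real (\<Prod>D))
        = (\<Sum>D\<in>Pow P. (-1) ^ card D / real (\<Prod>D)) - (\<Sum>D\<in>Pow P - DD. (-1) ^ card D / real (\<Prod>D))"
      using finP by (subst sum_diff) (auto simp: DD_def)
    also have "\<dots> \<le> (\<Sum>D\<in>Pow P. (-1) ^ card D / real (\<Prod>D)) + (\<Sum>D\<in>Pow P - DD. 1 / real (\<Prod>D))"
    proof -
      have "\<bar>\<Sum>D\<in>Pow P - DD. (-1) ^ card D / real (\<Prod>D)\<bar> \<le> (\<Sum>D\<in>Pow P - DD. \<bar>(-1) ^ card D / real (\<Prod>D)\<bar>)"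
        by (rule sum_abs)
      also have "\<dots> = (\<Sum>D\<in>Pow P - DD. 1 / real (\<Prod>D))" by (simp add: power_abs prod_nonneg abs_of_nonneg)
      finally show ?thesis by linarith
    qed
    also have "\<dots> \<le> 1 / ln z + exp (t * (\<Sum>p\<in>P. 1 / real p)) / t ^ r"
    proof -
      have "ln z > 0" using assms by simp
      then have "1 / mertens P \<le> 1 / ln z"
        using mertens_primes_upto_ge[of z] assms mertens_ge_1[of P] prP finP
        by (intro divide_left_mono) (auto simp: P_def intro!: mult_pos_pos)
      then show ?thesis using full rest by simp
    qed
    finally have S: "(\<Sum>D\<in>DD. (-1) ^ card D / real (\<Prod>D)) \<le> 1 / ln z + exp (t * (\<Sum>p\<in>P. 1 / real p)) / t ^ r" .
    have "0 \<le> 1 / ln z + exp (t * (\<Sum>p\<in>P. 1 / real p)) / t ^ r" using assms by auto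
    with S H show "H * (\<Sum>D\<in>DD. (-1) ^ card D / real (\<Prod>D))
        \<le> 2 * \<delta> * w * (1 / ln z + exp (t * (\<Sum>p\<in>P. 1 / real p)) / t ^ r)"
      by (meson mult_left_mono mult_right_mono order_trans)
  qed
  finally show ?thesis by (simp add: P_def)
qed

subsection \<open>Orthogonality and moments\<close>

text \<open>Independence, modulus one and vanishing positive moments at primes are what makes the
  functions \<open>F n\<close> orthonormal. The modulus is one everywhere and not just almost
  everywhere, so that finite sums are bounded functions; a Steinhaus function is brought to this
  form by a change on a null set.\<close>

locale unimodular_primes = prob_space M for M :: "'a measure" +
  fixes g :: "nat \<Rightarrow> 'a \<Rightarrow> complex"
  assumes indep: "indep_vars (\<lambda>_. borel) g {p. prime p}"
    and norm_g [simp]: "\<And>p \<omega>. norm (g p \<omega>) = 1"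
    and moment_g: "\<And>p n. prime p \<Longrightarrow> n > 0 \<Longrightarrow> expectation (\<lambda>\<omega>. g p \<omega> ^ n) = 0"
begin

definition F :: "nat \<Rightarrow> 'a \<Rightarrow> complex" where
  "F n \<omega> = (\<Prod>p\<in>prime_factors n. g p \<omega> ^ multiplicity p n)"

text \<open>The information carried by the values g p with p in S. Pulling back the product
  sigma-algebra along the restricted family matches the statement that disjoint subfamilies of an
  independent family are independent.\<close>

definition prime_sigma :: "nat set \<Rightarrow> 'a measure" where
  "prime_sigma S = vimage_algebra (space M) (\<lambda>\<omega>. restrict (\<lambda>p. g p \<omega>) S) (PiM S (\<lambda>_. borel))"

lemma F_superset:
  assumes "finite Q" "prime_factors n \<subseteq> Q" "\<And>p. p \<in> Q \<Longrightarrow> prime p" "n > 0"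
  shows "F n \<omega> = (\<Prod>p\<in>Q. g p \<omega> ^ multiplicity p n)"
  unfolding F_def
proof (rule prod.mono_neutral_left)
  show "\<forall>p\<in>Q - prime_factors n. g p \<omega> ^ multiplicity p n = 1"
    using assms by (auto simp: prime_factors_multiplicity)
qed (use assms in auto)

lemma F_1 [simp]: "F (Suc 0) \<omega> = 1" by (simp add: F_def)

lemma norm_F [simp]: "norm (F n \<omega>) = 1"
  by (simp add: F_def prod_norm[symmetric] norm_power)

lemma F_prime: "prime p \<Longrightarrow> F p \<omega> = g p \<omega>"
  by (simp add: F_def prime_prime_factors)

lemma F_mult:
  assumes "m > 0" "n > 0"
  shows "F (m * n) \<omega> = F m \<omega> * F n \<omega>"
proof -
  define Q where "Q = prime_factors m \<union> prime_factors n"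
  have Q: "finite Q" "\<And>p. p \<in> Q \<Longrightarrow> prime p" "prime_factors (m * n) \<subseteq> Q" "prime_factors m \<subseteq> Q" "prime_factors n \<subseteq> Q"
    using assms by (auto simp: Q_def prime_factorization_mult)
  have "multiplicity p (m * n) = multiplicity p m + multiplicity p n" if "p \<in> Q" for p
    using assms Q(2)[OF that] by (simp add: prime_elem_multiplicity_mult_distrib)
  then show ?thesis
    using F_superset[OF Q(1,3,2)] F_superset[OF Q(1,4,2)] F_superset[OF Q(1,5,2)] assms
    by (simp add: prod.distrib[symmetric] power_add)
qed

section \<open>Sigma-algebras generated by sets of primes\<close>

lemma space_prime_sigma [simp]: "space (prime_sigma S) = space M"
  by (simp add: prime_sigma_def)

lemma g_prime_sigma [measurable]: "p \<in> S \<Longrightarrow> g p \<in> borel_measurable (prime_sigma S)"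
proof -
  assume p: "p \<in> S"
  have "(\<lambda>\<omega>. restrict (\<lambda>p. g p \<omega>) S) \<in> measurable (prime_sigma S) (PiM S (\<lambda>_. borel))"
    unfolding prime_sigma_def by (rule measurable_vimage_algebra1) (auto simp: space_PiM)
  from measurable_compose[OF this measurable_component_singleton[OF p]]
  show ?thesis using p by simp
qed

lemma F_prime_sigma: "n \<in> smooth_over S \<Longrightarrow> F n \<in> borel_measurable (prime_sigma S)"
  unfolding F_def smooth_over_def
  by (intro borel_measurable_prod borel_measurable_power) (auto intro: g_prime_sigma)

lemma g_M: "prime p \<Longrightarrow> g p \<in> borel_measurable M"
  using indep by (auto simp: indep_vars_def)

lemma sets_prime_sigma: "sets (prime_sigma S) = {(\<lambda>\<omega>. restrict (\<lambda>p. g p \<omega>) S) -` A \<inter> space M |A. A \<in> sets (PiM S (\<lambda>_. borel))}"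
  unfolding prime_sigma_def by (rule sets_vimage_algebra2) (auto simp: space_PiM)

lemma restrict_g_M:
  assumes "S \<subseteq> {p. prime p}"
  shows "(\<lambda>\<omega>. restrict (\<lambda>p. g p \<omega>) S) \<in> measurable M (PiM S (\<lambda>_. borel))"
  using assms g_M by (intro measurable_restrict) auto

lemma sets_prime_sigma_subset: "S \<subseteq> {p. prime p} \<Longrightarrow> sets (prime_sigma S) \<subseteq> events"
  using restrict_g_M by (auto simp: sets_prime_sigma intro: measurable_sets)

lemma prime_sigma_M: "S \<subseteq> {p. prime p} \<Longrightarrow> U \<in> measurable (prime_sigma S) N \<Longrightarrow> U \<in> measurable M N"
  using sets_prime_sigma_subset[of S] unfolding measurable_def by auto

lemma prime_sigma_mono:
  assumes "S \<subseteq> T" "U \<in> measurable (prime_sigma S) N"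
  shows "U \<in> measurable (prime_sigma T) N"
proof -
  have "sets (prime_sigma S) \<subseteq> sets (prime_sigma T)"
  proof
    fix X assume "X \<in> sets (prime_sigma S)"
    then obtain A where A: "A \<in> sets (PiM S (\<lambda>_. borel))" "X = (\<lambda>\<omega>. restrict (\<lambda>p. g p \<omega>) S) -` A \<inter> space M"
      by (auto simp: sets_prime_sigma)
    have "(\<lambda>\<omega>. restrict (\<lambda>p. g p \<omega>) S) \<in> measurable (prime_sigma T) (PiM S (\<lambda>_. borel))"
      using assms by (intro measurable_restrict) auto
    from measurable_sets[OF this A(1)] show "X \<in> sets (prime_sigma T)" using A(2) by simp
  qed
  then show ?thesis using assms(2) unfolding measurable_def by auto
qed

text \<open>Variables determined by the primes in S and bounded everywhere. The class is closed
  under finite sums, products and conjugation, so integrability and independence become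
  syntactic.\<close>

definition bounded_adapted :: "nat set \<Rightarrow> ('a \<Rightarrow> complex) \<Rightarrow> bool" where
  "bounded_adapted S U \<longleftrightarrow> U \<in> borel_measurable (prime_sigma S) \<and> (\<exists>C. \<forall>\<omega>. norm (U \<omega>) \<le> C)"

lemma bounded_adaptedI: "U \<in> borel_measurable (prime_sigma S) \<Longrightarrow> (\<And>\<omega>. norm (U \<omega>) \<le> C) \<Longrightarrow> bounded_adapted S U"
  by (auto simp: bounded_adapted_def)

lemma bounded_adapted_mono: "S \<subseteq> T \<Longrightarrow> bounded_adapted S U \<Longrightarrow> bounded_adapted T U"
  using prime_sigma_mono by (auto simp: bounded_adapted_def)

lemma bounded_adapted_const: "bounded_adapted S (\<lambda>_. c)" by (auto simp: bounded_adapted_def)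

lemma bounded_adapted_mult: "bounded_adapted S U \<Longrightarrow> bounded_adapted S V \<Longrightarrow> bounded_adapted S (\<lambda>\<omega>. U \<omega> * V \<omega>)"
proof -
  assume "bounded_adapted S U" "bounded_adapted S V"
  then obtain C D where *: "U \<in> borel_measurable (prime_sigma S)" "V \<in> borel_measurable (prime_sigma S)"
    "\<And>\<omega>. norm (U \<omega>) \<le> C" "\<And>\<omega>. norm (V \<omega>) \<le> D" by (auto simp: bounded_adapted_def)
  have "norm (U \<omega> * V \<omega>) \<le> C * D" for \<omega>
    using mult_mono[OF *(3,4)] order_trans[OF norm_ge_zero *(3)] by (simp add: norm_mult)
  then show ?thesis using * by (intro bounded_adaptedI) auto
qed

lemma bounded_adapted_add: "bounded_adapted S U \<Longrightarrow> bounded_adapted S V \<Longrightarrow> bounded_adapted S (\<lambda>\<omega>. U \<omega> + V \<omega>)"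
proof -
  assume "bounded_adapted S U" "bounded_adapted S V"
  then obtain C D where *: "U \<in> borel_measurable (prime_sigma S)" "V \<in> borel_measurable (prime_sigma S)"
    "\<And>\<omega>. norm (U \<omega>) \<le> C" "\<And>\<omega>. norm (V \<omega>) \<le> D" by (auto simp: bounded_adapted_def)
  have "norm (U \<omega> + V \<omega>) \<le> C + D" for \<omega>
    using norm_triangle_mono[OF *(3,4)] .
  then show ?thesis using * by (intro bounded_adaptedI) auto
qed

lemma bounded_adapted_sum: "(\<And>i. i \<in> I \<Longrightarrow> bounded_adapted S (U i)) \<Longrightarrow> bounded_adapted S (\<lambda>\<omega>. \<Sum>i\<in>I. U i \<omega>)"
  by (induction I rule: infinite_finite_induct) (auto intro: bounded_adapted_add bounded_adapted_const)

lemma bounded_adapted_cnj: "bounded_adapted S U \<Longrightarrow> bounded_adapted S (\<lambda>\<omega>. cnj (U \<omega>))"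
  unfolding bounded_adapted_def
  by (auto intro!: borel_measurable_continuous_on[where f = cnj] continuous_intros)

lemma bounded_adapted_F: "n \<in> smooth_over S \<Longrightarrow> bounded_adapted S (F n)"
  by (rule bounded_adaptedI[OF F_prime_sigma, where C = 1]) auto

lemma bounded_adapted_g: "p \<in> S \<Longrightarrow> bounded_adapted S (g p)"
  by (rule bounded_adaptedI[OF g_prime_sigma, where C = 1]) auto

lemma bounded_adapted_power: "bounded_adapted S U \<Longrightarrow> bounded_adapted S (\<lambda>\<omega>. U \<omega> ^ k)"
  by (induction k) (auto intro: bounded_adapted_mult bounded_adapted_const)

lemma bounded_adapted_prod: "(\<And>i. i \<in> I \<Longrightarrow> bounded_adapted S (U i)) \<Longrightarrow> bounded_adapted S (\<lambda>\<omega>. \<Prod>i\<in>I. U i \<omega>)"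
  by (induction I rule: infinite_finite_induct) (auto intro: bounded_adapted_mult bounded_adapted_const)

lemma bounded_adapted_bound: "bounded_adapted S U \<Longrightarrow> \<exists>C. \<forall>\<omega>. norm (U \<omega>) \<le> C" by (simp add: bounded_adapted_def)

lemma bounded_adapted_M: "S \<subseteq> {p. prime p} \<Longrightarrow> bounded_adapted S U \<Longrightarrow> U \<in> borel_measurable M"
  using prime_sigma_M by (auto simp: bounded_adapted_def)

lemma bounded_adapted_integrable: "S \<subseteq> {p. prime p} \<Longrightarrow> bounded_adapted S U \<Longrightarrow> integrable M U"
  using bounded_adapted_bound bounded_adapted_M by (metis (no_types, lifting) AE_I2 integrable_const_bound)

lemma bounded_adapted_indep:
  assumes "bounded_adapted S U" "bounded_adapted T V" "S \<inter> T = {}" "S \<subseteq> {p. prime p}" "T \<subseteq> {p. prime p}"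
  shows "expectation (\<lambda>\<omega>. U \<omega> * V \<omega>) = expectation U * expectation V"
proof -
  have "indep_var (PiM S (\<lambda>_. borel)) (\<lambda>\<omega>. restrict (\<lambda>i. g i \<omega>) S) (PiM T (\<lambda>_. borel)) (\<lambda>\<omega>. restrict (\<lambda>i. g i \<omega>) T)"
    by (rule indep_var_restrict[OF indep assms(3,4,5)])
  then have ind: "indep_set (sets (prime_sigma S)) (sets (prime_sigma T))"
    unfolding indep_var_eq prime_sigma_def sets_vimage_algebra by auto
  have sub: "sigma_sets (space M) {X -` A \<inter> space M |A. A \<in> sets borel} \<subseteq> sets (prime_sigma S')"
    if "X \<in> borel_measurable (prime_sigma S')" for X :: "'a \<Rightarrow> complex" and S'
  proof -
    have "sigma_sets (space (prime_sigma S')) {X -` A \<inter> space M |A. A \<in> sets borel} \<subseteq> sets (prime_sigma S')"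
      using measurable_sets[OF that] by (intro sets.sigma_sets_subset) auto
    then show ?thesis by simp
  qed
  have "indep_var borel U borel V"
    unfolding indep_var_eq
  proof (intro conjI)
    show "random_variable borel U" "random_variable borel V" using assms bounded_adapted_M by auto
    have "U \<in> borel_measurable (prime_sigma S)" "V \<in> borel_measurable (prime_sigma T)" using assms by (auto simp: bounded_adapted_def)
    from sub[OF this(1)] sub[OF this(2)] ind
    show "indep_set (sigma_sets (space M) {U -` A \<inter> space M |A. A \<in> sets borel})
       (sigma_sets (space M) {V -` A \<inter> space M |A. A \<in> sets borel})"
      unfolding indep_sets2_eq by blast
  qed
  then show ?thesis
    using indep_var_lebesgue_integral bounded_adapted_integrable assms by blast
qed

lemma g_mult_cnj: "g p \<omega> * cnj (g p \<omega>) = 1"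
  using complex_norm_square[of "g p \<omega>"] by simp

lemma expectation_g_power_cnj:
  assumes "prime p" "a \<noteq> b"
  shows "expectation (\<lambda>\<omega>. g p \<omega> ^ a * cnj (g p \<omega>) ^ b) = 0"
proof (cases "a > b")
  case True
  have "g p \<omega> ^ a * cnj (g p \<omega>) ^ b = g p \<omega> ^ (a - b)" for \<omega>
  proof -
    have "g p \<omega> ^ a * cnj (g p \<omega>) ^ b = g p \<omega> ^ (a - b) * (g p \<omega> * cnj (g p \<omega>)) ^ b"
      using True by (simp add: power_mult_distrib power_add[symmetric] mult.assoc[symmetric])
    then show ?thesis by (simp add: g_mult_cnj)
  qed
  then show ?thesis using moment_g[OF assms(1), of "a - b"] True by simp
next
  case False
  have "g p \<omega> ^ a * cnj (g p \<omega>) ^ b = cnj (g p \<omega> ^ (b - a))" for \<omega>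
  proof -
    have "g p \<omega> ^ a * cnj (g p \<omega>) ^ b = (g p \<omega> * cnj (g p \<omega>)) ^ a * cnj (g p \<omega>) ^ (b - a)"
      using False by (simp add: power_mult_distrib power_add[symmetric] mult.assoc)
    then show ?thesis by (simp add: g_mult_cnj)
  qed
  then have "expectation (\<lambda>\<omega>. g p \<omega> ^ a * cnj (g p \<omega>) ^ b) = cnj (expectation (\<lambda>\<omega>. g p \<omega> ^ (b - a)))"
    using integral_bounded_linear'[OF bounded_linear_cnj bounded_linear_cnj, of M "\<lambda>\<omega>. g p \<omega> ^ (b - a)"] by simp
  then show ?thesis using moment_g[OF assms(1), of "b - a"] False assms by simp
qed

text \<open>Some prime p divides b and c to different powers. All other factors, among them U, are
  independent of g p because p lies in T and not in S, and the mean of g p ^ m * cnj (g p) ^ n is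
  zero for m \<noteq> n.\<close>

lemma orthogonal_aux:
  assumes "bounded_adapted S U" "S \<subseteq> {p. prime p}" "T \<subseteq> {p. prime p}" "S \<inter> T = {}"
    and "b \<in> smooth_over T" "c \<in> smooth_over T" "b \<noteq> c"
  shows "expectation (\<lambda>\<omega>. U \<omega> * (F b \<omega> * cnj (F c \<omega>))) = 0"
proof -
  have pos: "b > 0" "c > 0" using assms smooth_over_pos by auto
  obtain p where p: "prime p" "multiplicity p b \<noteq> multiplicity p c"
    using multiplicity_eq_nat[OF pos] assms(7) by blast
  define Q where "Q = (prime_factors b \<union> prime_factors c)"
  have Q: "finite Q" "Q \<subseteq> T" "\<And>p. p \<in> Q \<Longrightarrow> prime p" "prime_factors b \<subseteq> Q" "prime_factors c \<subseteq> Q"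
    using assms by (auto simp: Q_def smooth_over_def)
  have pQ: "p \<in> Q" using p by (auto simp: Q_def prime_factors_multiplicity)
  define R where "R d \<omega> = (\<Prod>q\<in>Q-{p}. g q \<omega> ^ multiplicity q d)" for d \<omega>
  have Fb: "F d \<omega> = g p \<omega> ^ multiplicity p d * R d \<omega>" if "d = b \<or> d = c" for d \<omega>
  proof -
    have "F d \<omega> = (\<Prod>q\<in>Q. g q \<omega> ^ multiplicity q d)"
      using that Q pos by (intro F_superset) auto
    then show ?thesis unfolding R_def using Q(1) pQ by (simp add: prod.remove)
  qed
  define S' where "S' = S \<union> (Q - {p})"
  have "bounded_adapted S' (\<lambda>\<omega>. U \<omega> * (R b \<omega> * cnj (R c \<omega>)))"
    unfolding R_def S'_def
    by (intro bounded_adapted_mult bounded_adapted_cnj bounded_adapted_prod bounded_adapted_power bounded_adapted_mono[OF _ assms(1)] bounded_adapted_g) auto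
  moreover have "bounded_adapted {p} (\<lambda>\<omega>. g p \<omega> ^ multiplicity p b * cnj (g p \<omega>) ^ multiplicity p c)"
    by (intro bounded_adapted_mult bounded_adapted_cnj bounded_adapted_power bounded_adapted_g) auto
  moreover have "S' \<inter> {p} = {}" "S' \<subseteq> {p. prime p}" "{p} \<subseteq> {p. prime p}"
    using pQ Q assms p by (auto simp: S'_def)
  ultimately have "expectation (\<lambda>\<omega>. (U \<omega> * (R b \<omega> * cnj (R c \<omega>))) * (g p \<omega> ^ multiplicity p b * cnj (g p \<omega>) ^ multiplicity p c)) = 0"
    by (subst bounded_adapted_indep[of S' _ "{p}"]) (simp_all add: expectation_g_power_cnj[OF p])
  moreover have "U \<omega> * (F b \<omega> * cnj (F c \<omega>)) = (U \<omega> * (R b \<omega> * cnj (R c \<omega>))) * (g p \<omega> ^ multiplicity p b * cnj (g p \<omega>) ^ multiplicity p c)" for \<omega>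
    by (simp only: Fb[OF disjI1[OF refl]] Fb[OF disjI2[OF refl]] complex_cnj_mult complex_cnj_power mult_ac)
  ultimately show ?thesis by (simp only:)
qed

lemma F_mult_cnj: "F n \<omega> * cnj (F n \<omega>) = 1"
  using complex_norm_square[of "F n \<omega>"] by simp

lemma bounded_integrable:
  fixes U :: "'a \<Rightarrow> real"
  assumes "U \<in> borel_measurable M" "\<And>\<omega>. \<bar>U \<omega>\<bar> \<le> C"
  shows "integrable M U"
  using assms by (intro integrable_const_bound[of _ C]) auto

lemma bounded_adapted_norm_power_integrable:
  assumes "S \<subseteq> {p. prime p}" "bounded_adapted S U"
  shows "integrable M (\<lambda>\<omega>. norm (U \<omega>) ^ k)"
proof -
  obtain C where C: "\<And>\<omega>. norm (U \<omega>) \<le> C" using bounded_adapted_bound assms by blast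
  show ?thesis
    by (rule bounded_integrable[of _ "C ^ k"]) (use bounded_adapted_M[OF assms] C in \<open>auto intro!: power_mono\<close>)
qed

text \<open>Parseval's identity conditionally on S: the coefficients may be random as long as they
  are determined by primes outside T. Such coefficients arise when the T-smooth part of an integer
  is split off.\<close>

lemma second_moment:
  assumes A: "\<And>b. b \<in> B \<Longrightarrow> bounded_adapted S (A b)" and "S \<subseteq> {p. prime p}" "T \<subseteq> {p. prime p}" "S \<inter> T = {}"
    and B: "finite B" "B \<subseteq> smooth_over T"
  shows "expectation (\<lambda>\<omega>. (norm (\<Sum>b\<in>B. A b \<omega> * F b \<omega>))\<^sup>2) = (\<Sum>b\<in>B. expectation (\<lambda>\<omega>. (norm (A b \<omega>))\<^sup>2))"
proof -
  have ST: "S \<union> T \<subseteq> {p. prime p}" using assms by auto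
  have admF: "bounded_adapted (S \<union> T) (F b)" if "b \<in> B" for b
    using that B smooth_over_mono[of T "S \<union> T"] by (intro bounded_adapted_F) auto
  have admA: "bounded_adapted (S \<union> T) (A b)" if "b \<in> B" for b by (rule bounded_adapted_mono[OF _ A[OF that]]) auto
  have inner: "expectation (\<lambda>\<omega>. (A b \<omega> * cnj (A c \<omega>)) * (F b \<omega> * cnj (F c \<omega>)))
      = (if b = c then of_real (expectation (\<lambda>\<omega>. (norm (A b \<omega>))\<^sup>2)) else 0)" if "b \<in> B" "c \<in> B" for b c
  proof (cases "b = c")
    case True
    have "(A b \<omega> * cnj (A b \<omega>)) * (F b \<omega> * cnj (F b \<omega>)) = complex_of_real ((norm (A b \<omega>))\<^sup>2)" for \<omega>
      by (simp only: F_mult_cnj complex_norm_square mult_1_right)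
    then have "expectation (\<lambda>\<omega>. (A b \<omega> * cnj (A b \<omega>)) * (F b \<omega> * cnj (F b \<omega>)))
        = expectation (\<lambda>\<omega>. complex_of_real ((norm (A b \<omega>))\<^sup>2))" by (simp only:)
    also have "\<dots> = of_real (expectation (\<lambda>\<omega>. (norm (A b \<omega>))\<^sup>2))" by (rule integral_complex_of_real)
    finally show ?thesis using True by simp
  next
    case False
    then show ?thesis
      using orthogonal_aux[OF bounded_adapted_mult[OF A bounded_adapted_cnj[OF A]] assms(2,3,4), of b c b c] that B by auto
  qed
  have "complex_of_real (expectation (\<lambda>\<omega>. (norm (\<Sum>b\<in>B. A b \<omega> * F b \<omega>))\<^sup>2))
      = expectation (\<lambda>\<omega>. complex_of_real ((norm (\<Sum>b\<in>B. A b \<omega> * F b \<omega>))\<^sup>2))"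
    by (rule integral_complex_of_real[symmetric])
  also have "(\<lambda>\<omega>. complex_of_real ((norm (\<Sum>b\<in>B. A b \<omega> * F b \<omega>))\<^sup>2))
      = (\<lambda>\<omega>. \<Sum>b\<in>B. \<Sum>c\<in>B. (A b \<omega> * cnj (A c \<omega>)) * (F b \<omega> * cnj (F c \<omega>)))"
    by (rule ext, subst complex_norm_square) (simp add: sum_product mult_ac)
  also have "expectation \<dots> = (\<Sum>b\<in>B. \<Sum>c\<in>B. expectation (\<lambda>\<omega>. (A b \<omega> * cnj (A c \<omega>)) * (F b \<omega> * cnj (F c \<omega>))))"
    using admF admA
    by (simp add: Bochner_Integration.integral_sum Bochner_Integration.integrable_sum
        bounded_adapted_integrable[OF ST] bounded_adapted_mult bounded_adapted_cnj)
  also have "\<dots> = (\<Sum>b\<in>B. \<Sum>c\<in>B. if b = c then of_real (expectation (\<lambda>\<omega>. (norm (A b \<omega>))\<^sup>2)) else 0)"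
    by (intro sum.cong refl inner)
  also have "\<dots> = of_real (\<Sum>b\<in>B. expectation (\<lambda>\<omega>. (norm (A b \<omega>))\<^sup>2))"
    using B by simp
  finally show ?thesis using of_real_eq_iff by blast
qed

text \<open>Cauchy--Schwarz on the fibre over m, which has at most d(m) elements since the first
  factor determines the pair and divides m.\<close>

lemma norm_convolution_sq_le:
  fixes a :: "nat \<Rightarrow> complex"
  assumes "finite B" "m > 0"
  shows "(norm (\<Sum>(b, c) | (b, c) \<in> B \<times> B \<and> b * c = m. a b * a c))\<^sup>2
     \<le> real (divisor_count m) * (\<Sum>(b, c) | (b, c) \<in> B \<times> B \<and> b * c = m. (norm (a b))\<^sup>2 * (norm (a c))\<^sup>2)"
proof -
  let ?P = "{(b, c). (b, c) \<in> B \<times> B \<and> b * c = m}"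
  have fin: "finite ?P" by (rule finite_subset[of _ "B \<times> B"]) (use assms in auto)
  have card: "card ?P \<le> divisor_count m"
    unfolding divisor_count_def
  proof (rule card_inj_on_le[where f = fst])
    show "inj_on fst ?P" using assms by (auto simp: inj_on_def)
  qed (use assms in auto)
  have "(norm (\<Sum>x\<in>?P. case x of (b, c) \<Rightarrow> a b * a c))\<^sup>2 \<le> (\<Sum>x\<in>?P. norm (case x of (b, c) \<Rightarrow> a b * a c))\<^sup>2"
    by (intro power_mono norm_sum) auto
  also have "\<dots> = (\<Sum>x\<in>?P. 1 * norm (case x of (b, c) \<Rightarrow> a b * a c))\<^sup>2" by simp
  also have "\<dots> \<le> (\<Sum>x\<in>?P. 1\<^sup>2) * (\<Sum>x\<in>?P. (norm (case x of (b, c) \<Rightarrow> a b * a c))\<^sup>2)"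
    by (rule Cauchy_Schwarz_ineq_sum)
  also have "\<dots> = real (card ?P) * (\<Sum>(b, c)\<in>?P. (norm (a b))\<^sup>2 * (norm (a c))\<^sup>2)"
    by (simp add: norm_mult power_mult_distrib case_prod_unfold)
  also have "\<dots> \<le> real (divisor_count m) * (\<Sum>(b, c)\<in>?P. (norm (a b))\<^sup>2 * (norm (a c))\<^sup>2)"
    using card by (intro mult_right_mono sum_nonneg) auto
  finally show ?thesis by (simp add: case_prod_unfold)
qed

text \<open>Squaring turns the sum into one of the same shape, whose coefficients are controlled by
  Cauchy--Schwarz and the submultiplicativity of the divisor function.\<close>
lemma dyadic_moment:
  assumes "\<And>b. b \<in> B \<Longrightarrow> bounded_adapted S (A b)" "S \<subseteq> {p. prime p}" "T \<subseteq> {p. prime p}" "S \<inter> T = {}"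
    and "finite B" "B \<subseteq> smooth_over T"
  shows "expectation (\<lambda>\<omega>. norm (\<Sum>b\<in>B. A b \<omega> * F b \<omega>) ^ (2 ^ Suc s))
    \<le> expectation (\<lambda>\<omega>. (\<Sum>b\<in>B. (norm (A b \<omega>))\<^sup>2 * real (divisor_count b) ^ s) ^ (2 ^ s))"
  using assms(1,5,6)
proof (induction s arbitrary: A B)
  case 0
  have "integrable M (\<lambda>\<omega>. (norm (A b \<omega>))\<^sup>2)" if "b \<in> B" for b
    using bounded_adapted_norm_power_integrable[OF assms(2) 0(1)[OF that]] .
  then show ?case using second_moment[OF 0(1) assms(2,3,4) 0(2,3)]
    by (simp add: Bochner_Integration.integral_sum)
next
  case (Suc s)
  let ?BB = "(\<lambda>(b, c). b * c) ` (B \<times> B)"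
  define P where "P m = {(b, c). (b, c) \<in> B \<times> B \<and> b * c = m}" for m
  define C where "C m \<omega> = (\<Sum>(b, c)\<in>P m. A b \<omega> * A c \<omega>)" for m \<omega>
  have pos: "b > 0" if "b \<in> B" for b using that Suc.prems smooth_over_pos by blast
  have finBB: "finite ?BB" "?BB \<subseteq> smooth_over T"
    using Suc.prems by (auto intro!: smooth_over_mult)
  have admC: "bounded_adapted S (C m)" for m
    unfolding C_def P_def case_prod_unfold by (intro bounded_adapted_sum bounded_adapted_mult) (use Suc.prems in auto)
  have sq: "(\<Sum>b\<in>B. A b \<omega> * F b \<omega>)\<^sup>2 = (\<Sum>m\<in>?BB. C m \<omega> * F m \<omega>)" for \<omega>
  proof -
    have "(\<Sum>b\<in>B. A b \<omega> * F b \<omega>)\<^sup>2 = (\<Sum>x\<in>B\<times>B. A (fst x) \<omega> * A (snd x) \<omega> * F (fst x * snd x) \<omega>)"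
      unfolding power2_eq_square sum_product sum.cartesian_product
      by (intro sum.cong refl) (auto simp: F_mult pos)
    also have "\<dots> = (\<Sum>m\<in>?BB. \<Sum>x\<in>{x \<in> B \<times> B. (case x of (b, c) \<Rightarrow> b * c) = m}. A (fst x) \<omega> * A (snd x) \<omega> * F (fst x * snd x) \<omega>)"
      using Suc.prems by (intro sum.group[symmetric]) auto
    also have "\<dots> = (\<Sum>m\<in>?BB. C m \<omega> * F m \<omega>)"
      unfolding C_def P_def sum_distrib_right
      by (intro sum.cong refl) (auto simp: case_prod_unfold)
    finally show ?thesis .
  qed
  have "expectation (\<lambda>\<omega>. norm (\<Sum>b\<in>B. A b \<omega> * F b \<omega>) ^ (2 ^ Suc (Suc s)))
      = expectation (\<lambda>\<omega>. norm ((\<Sum>b\<in>B. A b \<omega> * F b \<omega>)\<^sup>2) ^ (2 ^ Suc s))"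
    by (simp add: norm_power power_mult[symmetric])
  also have "\<dots> = expectation (\<lambda>\<omega>. norm (\<Sum>m\<in>?BB. C m \<omega> * F m \<omega>) ^ (2 ^ Suc s))"
    unfolding sq ..
  also have "\<dots> \<le> expectation (\<lambda>\<omega>. (\<Sum>m\<in>?BB. (norm (C m \<omega>))\<^sup>2 * real (divisor_count m) ^ s) ^ (2 ^ s))"
    using admC finBB by (intro Suc.IH) auto
  also have "\<dots> \<le> expectation (\<lambda>\<omega>. (\<Sum>b\<in>B. (norm (A b \<omega>))\<^sup>2 * real (divisor_count b) ^ Suc s) ^ (2 ^ Suc s))"
  proof (rule integral_mono)
    have int: "integrable M (\<lambda>\<omega>. (\<Sum>m\<in>X. (norm (U m \<omega>))\<^sup>2 * real (divisor_count m) ^ k) ^ l)"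
      if "finite X" "\<And>m. m \<in> X \<Longrightarrow> bounded_adapted S (U m)" for X U k l
    proof -
      have "bounded_adapted S (\<lambda>\<omega>. \<Sum>m\<in>X. (U m \<omega> * cnj (U m \<omega>)) * of_real (real (divisor_count m) ^ k))"
        using that by (intro bounded_adapted_sum bounded_adapted_mult bounded_adapted_cnj bounded_adapted_const) auto
      moreover have "(\<Sum>m\<in>X. (U m \<omega> * cnj (U m \<omega>)) * of_real (real (divisor_count m) ^ k))
         = of_real (\<Sum>m\<in>X. (norm (U m \<omega>))\<^sup>2 * real (divisor_count m) ^ k)" for \<omega>
        by (simp add: complex_norm_square[symmetric])
      ultimately have "bounded_adapted S (\<lambda>\<omega>. of_real (\<Sum>m\<in>X. (norm (U m \<omega>))\<^sup>2 * real (divisor_count m) ^ k))" by (simp only:)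
      from bounded_adapted_norm_power_integrable[OF assms(2) this, of l] show ?thesis
        by (simp only: norm_of_real) (simp only: abs_of_nonneg sum_nonneg zero_le_mult_iff zero_le_power of_nat_0_le_iff norm_ge_zero simp_thms)
    qed
    show "integrable M (\<lambda>\<omega>. (\<Sum>m\<in>?BB. (norm (C m \<omega>))\<^sup>2 * real (divisor_count m) ^ s) ^ (2 ^ s))"
      using finBB admC by (intro int) auto
    show "integrable M (\<lambda>\<omega>. (\<Sum>b\<in>B. (norm (A b \<omega>))\<^sup>2 * real (divisor_count b) ^ Suc s) ^ (2 ^ Suc s))"
      using Suc.prems by (intro int) auto
    fix \<omega>
    let ?t = "\<lambda>b. (norm (A b \<omega>))\<^sup>2 * real (divisor_count b) ^ Suc s"
    \<comment> \<open>Pointwise in \<omega>: Cauchy--Schwarz adds one factor d(m) to the s factors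
      present, and d(m)^(s+1) <= d(b)^(s+1) * d(c)^(s+1) splits the double sum into a
      square.\<close>
    have "(\<Sum>m\<in>?BB. (norm (C m \<omega>))\<^sup>2 * real (divisor_count m) ^ s) \<le> (\<Sum>m\<in>?BB. \<Sum>(b, c)\<in>P m. ?t b * ?t c)"
    proof (rule sum_mono)
      fix m assume m: "m \<in> ?BB"
      then have m0: "m > 0" using pos by auto
      have "(norm (C m \<omega>))\<^sup>2 * real (divisor_count m) ^ s
          \<le> real (divisor_count m) * (\<Sum>(b, c)\<in>P m. (norm (A b \<omega>))\<^sup>2 * (norm (A c \<omega>))\<^sup>2) * real (divisor_count m) ^ s"
        unfolding C_def P_def
        using norm_convolution_sq_le[OF \<open>finite B\<close> m0, of "\<lambda>b. A b \<omega>"] by (intro mult_right_mono) auto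
      also have "\<dots> = (\<Sum>(b, c)\<in>P m. (norm (A b \<omega>))\<^sup>2 * (norm (A c \<omega>))\<^sup>2 * real (divisor_count m) ^ Suc s)"
        by (simp add: sum_distrib_left sum_distrib_right case_prod_unfold mult_ac)
      also have "\<dots> \<le> (\<Sum>(b, c)\<in>P m. ?t b * ?t c)"
      proof (rule sum_mono, clarsimp simp only: split_paired_all prod.case)
        fix b c assume "(b, c) \<in> P m"
        then have bc: "b \<in> B" "c \<in> B" "b * c = m" by (auto simp: P_def)
        have "real (divisor_count m) \<le> real (divisor_count b) * real (divisor_count c)"
          using divisor_count_mult_le[OF pos[OF bc(1)] pos[OF bc(2)]] bc(3) by (metis of_nat_le_iff of_nat_mult)
        then have "real (divisor_count m) ^ Suc s \<le> (real (divisor_count b) * real (divisor_count c)) ^ Suc s"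
          by (intro power_mono) auto
        then have "((norm (A b \<omega>))\<^sup>2 * (norm (A c \<omega>))\<^sup>2) * real (divisor_count m) ^ Suc s
           \<le> ((norm (A b \<omega>))\<^sup>2 * (norm (A c \<omega>))\<^sup>2) * (real (divisor_count b) * real (divisor_count c)) ^ Suc s"
          by (intro mult_left_mono) auto
        also have "\<dots> = ?t b * ?t c" by (simp only: power_mult_distrib mult_ac)
        finally show "(norm (A b \<omega>))\<^sup>2 * (norm (A c \<omega>))\<^sup>2 * real (divisor_count m) ^ Suc s \<le> ?t b * ?t c" .
      qed
      finally show "(norm (C m \<omega>))\<^sup>2 * real (divisor_count m) ^ s \<le> (\<Sum>(b, c)\<in>P m. ?t b * ?t c)" .
    qed
    also have "\<dots> = (\<Sum>m\<in>?BB. \<Sum>x\<in>{x \<in> B \<times> B. (case x of (b, c) \<Rightarrow> b * c) = m}. case x of (b, c) \<Rightarrow> ?t b * ?t c)"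
      unfolding P_def by (intro sum.cong refl) auto
    also have "\<dots> = (\<Sum>x\<in>B \<times> B. case x of (b, c) \<Rightarrow> ?t b * ?t c)"
      using Suc.prems by (intro sum.group) auto
    also have "\<dots> = (\<Sum>b\<in>B. ?t b)\<^sup>2"
      by (simp only: power2_eq_square sum_product sum.cartesian_product)
    finally have "(\<Sum>m\<in>?BB. (norm (C m \<omega>))\<^sup>2 * real (divisor_count m) ^ s) ^ (2 ^ s) \<le> ((\<Sum>b\<in>B. ?t b)\<^sup>2) ^ (2 ^ s)"
      by (intro power_mono sum_nonneg) auto
    then show "(\<Sum>m\<in>?BB. (norm (C m \<omega>))\<^sup>2 * real (divisor_count m) ^ s) ^ (2 ^ s) \<le> (\<Sum>b\<in>B. ?t b) ^ (2 ^ Suc s)"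
      by (simp only: power_mult[symmetric] power_Suc)
  qed
  finally show ?case .
qed

subsection \<open>A maximal inequality for short sums\<close>

text \<open>A majorant for the fourth powers of all initial sums over an interval of length 2^r,
  built from complete dyadic sums (Rademacher--Menshov chaining). The factors ((r+2)/(r+1))^3
  telescope along the levels, so together they grow like r^3 and not exponentially.\<close>

fun chain_bound :: "(nat \<Rightarrow> 'a \<Rightarrow> complex) \<Rightarrow> nat \<Rightarrow> nat \<Rightarrow> 'a \<Rightarrow> real" where
  "chain_bound X 0 c \<omega> = norm (X c \<omega>) ^ 4"
| "chain_bound X (Suc r) c \<omega> = ((real r + 2) / (real r + 1)) ^ 3 * (chain_bound X r c \<omega> + chain_bound X r (c + 2 ^ r) \<omega>)
     + (real r + 2) ^ 3 * norm (\<Sum>n=c..<c + 2 ^ r. X n \<omega>) ^ 4"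

lemma chain_bound_nonneg: "chain_bound X r c \<omega> \<ge> 0"
  by (induction r arbitrary: c) auto

text \<open>Convexity of the fourth power at x / (1 - \<theta>) and y / \<theta> with weights 1 -
  \<theta> and \<theta> = 1 / (r + 2). Letting \<theta> depend on the level makes the factor of x
  tend to 1.\<close>

lemma add_power4_le:
  fixes x y :: real
  assumes "x \<ge> 0" "y \<ge> 0"
  shows "(x + y) ^ 4 \<le> ((real r + 2) / (real r + 1)) ^ 3 * x ^ 4 + (real r + 2) ^ 3 * y ^ 4"
proof -
  define \<theta> where "\<theta> = 1 / (real r + 2)"
  have \<theta>: "0 < \<theta>" "\<theta> < 1" "1 - \<theta> = (real r + 1) / (real r + 2)" by (auto simp: \<theta>_def field_simps)
  have scale: "d * (u / d) ^ 4 = (1 / d) ^ 3 * u ^ 4" if "d > 0" for d u :: real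
    using that by (simp add: field_simps power3_eq_cube power4_eq_xxxx)
  have "convex_on UNIV (\<lambda>x::real. x ^ 4)" by (rule convex_power_even) simp
  from convex_onD[OF this, of \<theta> "x / (1 - \<theta>)" "y / \<theta>"]
  have "((1 - \<theta>) * (x / (1 - \<theta>)) + \<theta> * (y / \<theta>)) ^ 4 \<le> (1 - \<theta>) * (x / (1 - \<theta>)) ^ 4 + \<theta> * (y / \<theta>) ^ 4"
    using \<theta> by simp
  also have "(1 - \<theta>) * (x / (1 - \<theta>)) ^ 4 = (1 / (1 - \<theta>)) ^ 3 * x ^ 4"
    using \<theta> by (intro scale) simp
  also have "\<theta> * (y / \<theta>) ^ 4 = (1 / \<theta>) ^ 3 * y ^ 4"
    using \<theta> by (intro scale) simp
  also have "1 / (1 - \<theta>) = (real r + 2) / (real r + 1)" using \<theta>(3) by simp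
  also have "1 / \<theta> = real r + 2" by (simp add: \<theta>_def)
  finally show ?thesis using \<theta> by simp
qed

text \<open>An initial segment lies in the left half, or it is the whole left half followed by an
  initial segment of the right half. In the second case the complete left sum takes the large factor
  and the recursive part the factor near 1.\<close>

lemma chain_bound_max:
  assumes "j \<le> 2 ^ r"
  shows "norm (\<Sum>n=c..<c + j. X n \<omega>) ^ 4 \<le> chain_bound X r c \<omega>"
  using assms
proof (induction r arbitrary: c j)
  case 0
  then have "j = 0 \<or> j = 1" by auto
  then show ?case by auto
next
  case (Suc r)
  let ?\<kappa> = "((real r + 2) / (real r + 1)) ^ 3"
  have \<kappa>: "?\<kappa> \<ge> 1" by (intro one_le_power) simp
  show ?case
  proof (cases "j \<le> 2 ^ r")
    case True
    have "norm (\<Sum>n=c..<c + j. X n \<omega>) ^ 4 \<le> chain_bound X r c \<omega>" using Suc.IH True by simp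
    also have "\<dots> \<le> chain_bound X r c \<omega> + chain_bound X r (c + 2 ^ r) \<omega>" using chain_bound_nonneg by simp
    also have "\<dots> \<le> ?\<kappa> * (chain_bound X r c \<omega> + chain_bound X r (c + 2 ^ r) \<omega>)"
      using mult_right_mono[OF \<kappa>, of "chain_bound X r c \<omega> + chain_bound X r (c + 2 ^ r) \<omega>"]
      by (simp add: chain_bound_nonneg)
    also have "\<dots> \<le> chain_bound X (Suc r) c \<omega>" by simp
    finally show ?thesis .
  next
    case False
    define i where "i = j - 2 ^ r"
    have i: "j = 2 ^ r + i" "i \<le> 2 ^ r" using False Suc.prems by (auto simp: i_def)
    let ?a = "norm (\<Sum>n=c + 2 ^ r..<c + 2 ^ r + i. X n \<omega>)" and ?b = "norm (\<Sum>n=c..<c + 2 ^ r. X n \<omega>)"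
    have "(\<Sum>n=c..<c + j. X n \<omega>) = (\<Sum>n=c..<c + 2 ^ r. X n \<omega>) + (\<Sum>n=c + 2 ^ r..<c + 2 ^ r + i. X n \<omega>)"
      unfolding i(1) by (subst sum.atLeastLessThan_concat) (auto simp: add.assoc)
    then have "norm (\<Sum>n=c..<c + j. X n \<omega>) \<le> ?a + ?b" using norm_triangle_ineq by (simp add: add.commute)
    then have "norm (\<Sum>n=c..<c + j. X n \<omega>) ^ 4 \<le> (?a + ?b) ^ 4" by (intro power_mono) auto
    also have "\<dots> \<le> ?\<kappa> * ?a ^ 4 + (real r + 2) ^ 3 * ?b ^ 4" by (rule add_power4_le) auto
    also have "?\<kappa> * ?a ^ 4 \<le> ?\<kappa> * (chain_bound X r c \<omega> + chain_bound X r (c + 2 ^ r) \<omega>)"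
      using Suc.IH[OF i(2), of "c + 2 ^ r"] chain_bound_nonneg[of X r c \<omega>] by (intro mult_left_mono) auto
    finally show ?thesis by simp
  qed
qed

lemma fourth_moment:
  fixes a :: "nat \<Rightarrow> real"
  assumes "finite B" "\<And>b. b \<in> B \<Longrightarrow> b > 0"
  shows "expectation (\<lambda>\<omega>. norm (\<Sum>n\<in>B. of_real (a n) * F n \<omega>) ^ 4) \<le> (\<Sum>n\<in>B. (a n)\<^sup>2 * real (divisor_count n))\<^sup>2"
proof -
  have "expectation (\<lambda>\<omega>. norm (\<Sum>n\<in>B. of_real (a n) * F n \<omega>) ^ (2 ^ Suc 1))
    \<le> expectation (\<lambda>\<omega>. (\<Sum>b\<in>B. (norm (complex_of_real (a b)))\<^sup>2 * real (divisor_count b) ^ 1) ^ (2 ^ 1))"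
    by (rule dyadic_moment[where S = "{}" and T = "{p. prime p}"])
      (use assms in \<open>auto intro: bounded_adapted_const simp: smooth_over_def\<close>)
  then show ?thesis by (simp add: prob_space power2_abs)
qed

text \<open>Of the four powers of r + 1, three come from the telescoping factors and one counts the
  levels. The two halves are recombined by u^2 + v^2 <= (u + v)^2, which is why the square of the
  total weight appears.\<close>

lemma chain_bound_expectation:
  fixes a :: "nat \<Rightarrow> real"
  defines "X \<equiv> \<lambda>n \<omega>. of_real (a n) * F n \<omega>"
  assumes "c > 0"
  shows "integrable M (chain_bound X r c) \<and>
    expectation (chain_bound X r c) \<le> (real r + 1) ^ 4 * (\<Sum>n=c..<c + 2 ^ r. (a n)\<^sup>2 * real (divisor_count n))\<^sup>2"
  using assms(2)
proof (induction r arbitrary: c)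
  case 0
  have "bounded_adapted {p. prime p} (X c)"
    unfolding X_def using 0 by (intro bounded_adapted_mult bounded_adapted_const bounded_adapted_F) (auto simp: smooth_over_def)
  then have "integrable M (\<lambda>\<omega>. norm (X c \<omega>) ^ 4)"
    using bounded_adapted_norm_power_integrable by blast
  moreover have "expectation (\<lambda>\<omega>. norm (X c \<omega>) ^ 4) \<le> ((a c)\<^sup>2 * real (divisor_count c))\<^sup>2"
    using fourth_moment[of "{c}" a] 0 by (simp add: X_def)
  ultimately show ?case by simp
next
  case (Suc r)
  let ?\<kappa> = "((real r + 2) / (real r + 1)) ^ 3"
  let ?w = "\<lambda>c. \<Sum>n=c..<c + 2 ^ r. (a n)\<^sup>2 * real (divisor_count n)"
  have "bounded_adapted {p. prime p} (\<lambda>\<omega>. \<Sum>n=c..<c + 2 ^ r. X n \<omega>)"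
    unfolding X_def using Suc.prems by (intro bounded_adapted_sum bounded_adapted_mult bounded_adapted_const bounded_adapted_F) (auto simp: smooth_over_def)
  then have int: "integrable M (\<lambda>\<omega>. norm (\<Sum>n=c..<c + 2 ^ r. X n \<omega>) ^ 4)"
    using bounded_adapted_norm_power_integrable by blast
  have le: "expectation (\<lambda>\<omega>. norm (\<Sum>n=c..<c + 2 ^ r. X n \<omega>) ^ 4) \<le> (?w c)\<^sup>2"
    unfolding X_def by (rule fourth_moment) (use Suc.prems in auto)
  note IH = Suc.IH[OF Suc.prems] Suc.IH[of "c + 2 ^ r"]
  have eq: "chain_bound X (Suc r) c = (\<lambda>\<omega>. ?\<kappa> * (chain_bound X r c \<omega> + chain_bound X r (c + 2 ^ r) \<omega>)
     + (real r + 2) ^ 3 * norm (\<Sum>n=c..<c + 2 ^ r. X n \<omega>) ^ 4)"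
    by (rule ext) simp
  have integ: "integrable M (chain_bound X (Suc r) c)"
    unfolding eq using IH int Suc.prems by (intro Bochner_Integration.integrable_add integrable_mult_right) auto
  have "expectation (chain_bound X (Suc r) c) = ?\<kappa> * (expectation (chain_bound X r c) + expectation (chain_bound X r (c + 2 ^ r)))
     + (real r + 2) ^ 3 * expectation (\<lambda>\<omega>. norm (\<Sum>n=c..<c + 2 ^ r. X n \<omega>) ^ 4)"
    unfolding eq using IH int Suc.prems by simp
  also have "\<dots> \<le> ?\<kappa> * ((real r + 1) ^ 4 * (?w c)\<^sup>2 + (real r + 1) ^ 4 * (?w (c + 2 ^ r))\<^sup>2) + (real r + 2) ^ 3 * (?w c)\<^sup>2"
    using IH le Suc.prems by (intro add_mono mult_left_mono) auto
  also have "\<dots> = (real r + 2) ^ 3 * ((real r + 1) * ((?w c)\<^sup>2 + (?w (c + 2 ^ r))\<^sup>2) + (?w c)\<^sup>2)"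
  proof -
    have scale: "(b / a) ^ 3 * a ^ 4 = b ^ 3 * a" if "a > 0" for a b :: real
      using that by (simp add: field_simps power3_eq_cube power4_eq_xxxx)
    have dist: "k * (A * u + A * v) + B * u = (k * A) * (u + v) + B * u" for k A B u v :: real
      by (simp only: algebra_simps)
    have \<kappa>: "?\<kappa> * (real r + 1) ^ 4 = (real r + 2) ^ 3 * (real r + 1)" by (rule scale) simp
    show ?thesis unfolding dist \<kappa> by (simp only: algebra_simps)
  qed
  also have "\<dots> \<le> (real r + 2) ^ 3 * ((real r + 2) * (?w c + ?w (c + 2 ^ r))\<^sup>2)"
  proof (rule mult_left_mono)
    have "0 \<le> ?w c" "0 \<le> ?w (c + 2 ^ r)" by (auto intro: sum_nonneg)
    moreover have "(\<rho> + 1) * (u\<^sup>2 + v\<^sup>2) + u\<^sup>2 \<le> (\<rho> + 2) * (u + v)\<^sup>2"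
      if "0 \<le> u" "0 \<le> v" "0 \<le> \<rho>" for u v \<rho> :: real
    proof -
      have "u\<^sup>2 + v\<^sup>2 \<le> (u + v)\<^sup>2" using that by (simp add: power2_sum)
      from mult_left_mono[OF this, of "\<rho> + 2"] that(3)
      have "(\<rho> + 2) * (u\<^sup>2 + v\<^sup>2) \<le> (\<rho> + 2) * (u + v)\<^sup>2" by simp
      then show ?thesis using zero_le_power2[of v] by (simp only: algebra_simps)
    qed
    ultimately show "(real r + 1) * ((?w c)\<^sup>2 + (?w (c + 2 ^ r))\<^sup>2) + (?w c)\<^sup>2 \<le> (real r + 2) * (?w c + ?w (c + 2 ^ r))\<^sup>2"
      by simp
  qed simp
  also have "?w c + ?w (c + 2 ^ r) = (\<Sum>n=c..<c + 2 ^ Suc r. (a n)\<^sup>2 * real (divisor_count n))"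
    by (subst sum.atLeastLessThan_concat) (auto simp: add.assoc mult_2)
  also have "(real r + 2) ^ 3 * ((real r + 2) * (\<Sum>n=c..<c + 2 ^ Suc r. (a n)\<^sup>2 * real (divisor_count n))\<^sup>2)
     = (real (Suc r) + 1) ^ 4 * (\<Sum>n=c..<c + 2 ^ Suc r. (a n)\<^sup>2 * real (divisor_count n))\<^sup>2"
    by (simp add: power3_eq_cube power4_eq_xxxx add.commute)
  finally show ?case using integ by blast
qed

text \<open>The test points are the first elements of the groups on which the integer part of
  \<open>(\<Sum>m\<le>n. d(m) / m) / \<eta>\<close> is constant, so that the weight between a point and its test point is
  at most \<open>\<eta>\<close>.\<close>
lemma test_points:
  fixes \<eta> :: real and I :: "nat set"
  assumes "\<eta> > 0" "I \<subseteq> {1..N}" "N \<ge> 1" "N \<le> 2 ^ r"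
  obtains P t R where "P \<subseteq> I" "real (card P) \<le> (1 + ln N)\<^sup>2 / \<eta> + 1"
    "\<And>n. n \<in> I \<Longrightarrow> t n \<in> P \<and> t n \<le> n"
    "R \<in> borel_measurable M" "\<And>\<omega>. R \<omega> \<ge> 0"
    "(\<integral>\<^sup>+\<omega>. ennreal (R \<omega>) \<partial>M) \<le> ennreal (card P * (real r + 1) ^ 4 * \<eta>\<^sup>2)"
    "\<And>n \<omega>. n \<in> I \<Longrightarrow> norm (\<Sum>m\<in>{t n<..n}. F m \<omega> / of_real (sqrt m)) ^ 4 \<le> R \<omega>"
proof -
  define w where "w m = real (divisor_count m) / real m" for m
  have w0: "w m \<ge> 0" for m by (simp add: w_def)
  define G where "G n = (\<Sum>m=1..n. w m)" for n
  define \<tau> where "\<tau> n = nat \<lfloor>G n / \<eta>\<rfloor>" for n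
  have G0: "G n \<ge> 0" for n unfolding G_def by (intro sum_nonneg w0)
  have Gmono: "G m \<le> G n" if "m \<le> n" for m n
    unfolding G_def using that w0 by (intro sum_mono2) auto
  have \<tau>mono: "\<tau> m \<le> \<tau> n" if "m \<le> n" for m n
    unfolding \<tau>_def using Gmono[OF that] assms(1) by (intro nat_mono floor_mono divide_right_mono) auto
  define t where "t n = (LEAST m. m \<in> I \<and> \<tau> m = \<tau> n)" for n
  have t: "t n \<in> I" "\<tau> (t n) = \<tau> n" "t n \<le> n" if "n \<in> I" for n
    using LeastI[of "\<lambda>m. m \<in> I \<and> \<tau> m = \<tau> n" n] Least_le[of "\<lambda>m. m \<in> I \<and> \<tau> m = \<tau> n" n] that
    unfolding t_def by auto
  have t_cong: "t x = t y" if "\<tau> x = \<tau> y" for x y unfolding t_def that ..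
  define P where "P = t ` I"
  have finI: "finite I" using assms finite_subset by blast
  have tt: "t s = s" if s: "s \<in> P" for s
  proof -
    obtain n where "n \<in> I" "s = t n" using s by (auto simp: P_def)
    then show ?thesis using t_cong[of s n] t(2)[of n] by simp
  qed
  have "inj_on \<tau> P"
  proof (rule inj_onI)
    fix x y assume "x \<in> P" "y \<in> P" "\<tau> x = \<tau> y"
    then show "x = y" using tt t_cong by metis
  qed
  moreover have "\<tau> ` P \<subseteq> {..\<tau> N}"
  proof (rule image_subsetI)
    fix s assume "s \<in> P"
    then have "s \<in> I" using t by (auto simp: P_def)
    then show "\<tau> s \<in> {..\<tau> N}" using assms(2) \<tau>mono[of s N] by auto
  qed
  ultimately have "card P \<le> card {..\<tau> N}" by (intro card_inj_on_le) auto
  then have "card P \<le> \<tau> N + 1" by simp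
  then have "real (card P) \<le> real (\<tau> N) + 1" by linarith
  moreover have "real (\<tau> N) \<le> G N / \<eta>"
    unfolding \<tau>_def using G0[of N] assms(1) by (intro of_nat_floor) simp
  ultimately have "real (card P) \<le> G N / \<eta> + 1" by linarith
  also have "G N \<le> (1 + ln N)\<^sup>2"
  proof -
    have "{n. 0 < n \<and> real n \<le> real N} = {1..N}" by auto
    then show ?thesis using sum_divisor_count_le[of "real N"] assms(3) by (simp add: G_def w_def)
  qed
  finally have cardP: "real (card P) \<le> (1 + ln N)\<^sup>2 / \<eta> + 1"
    using assms(1) by (simp add: divide_right_mono)
  \<comment> \<open>The coefficients vanish except on the part of the group of s beyond s. For n in
    that group the sum from 1 to n is therefore the increment from the test point, and one chain
    over {1..2^r} of total weight at most \<eta> serves each s.\<close>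
  define a where "a s m = (if s < m \<and> m \<in> {1..N} \<and> \<tau> m = \<tau> s then 1 / sqrt (real m) else 0)" for s m
  define X where "X s m \<omega> = complex_of_real (a s m) * F m \<omega>" for s m \<omega>
  define R where "R \<omega> = (\<Sum>s\<in>P. chain_bound (X s) r 1 \<omega>)" for \<omega>
  have weight: "(\<Sum>n=1..<1 + 2 ^ r. (a s n)\<^sup>2 * real (divisor_count n)) \<le> \<eta>" for s
  proof -
    define A where "A = {m. s < m \<and> m \<in> {1..N} \<and> \<tau> m = \<tau> s}"
    have "(\<Sum>n=1..<1 + 2 ^ r. (a s n)\<^sup>2 * real (divisor_count n)) = (\<Sum>n\<in>A. w n)"
      by (rule sum.mono_neutral_cong_right) (use assms(4) in \<open>auto simp: A_def a_def w_def power_divide\<close>)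
    also have "\<dots> \<le> \<eta>"
    proof (cases "A = {}")
      case False
      have finA: "finite A" by (simp add: A_def)
      define e where "e = Max A"
      have e: "e \<in> A" using Max_in[OF finA False] by (simp add: e_def)
      have "A \<subseteq> {s<..e}" using finA by (auto simp: A_def e_def)
      then have "(\<Sum>n\<in>A. w n) \<le> (\<Sum>n\<in>{s<..e}. w n)" using w0 by (intro sum_mono2) auto
      also have "{s<..e} = {1..e} - {1..s}" by auto
      also have "(\<Sum>n\<in>{1..e} - {1..s}. w n) = G e - G s"
        unfolding G_def using e by (intro sum_diff) (auto simp: A_def)
      also have "\<dots> \<le> \<eta>"
      proof -
        have "nat \<lfloor>G e / \<eta>\<rfloor> = nat \<lfloor>G s / \<eta>\<rfloor>" using e by (simp add: A_def \<tau>_def)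
        moreover have "0 \<le> \<lfloor>G e / \<eta>\<rfloor>" "0 \<le> \<lfloor>G s / \<eta>\<rfloor>" using G0 assms(1) by auto
        ultimately have "\<lfloor>G e / \<eta>\<rfloor> = \<lfloor>G s / \<eta>\<rfloor>" by linarith
        then have "G e / \<eta> - G s / \<eta> \<le> 1" by linarith
        then show ?thesis using assms(1) by (simp add: field_simps)
      qed
      finally show ?thesis .
    qed (use assms(1) in auto)
    finally show ?thesis .
  qed
  have chain: "integrable M (chain_bound (X s) r 1)" "expectation (chain_bound (X s) r 1) \<le> (real r + 1) ^ 4 * \<eta>\<^sup>2" for s
  proof -
    note * = chain_bound_expectation[of 1 "a s" r, folded X_def]
    then show "integrable M (chain_bound (X s) r 1)" by (simp add: X_def[abs_def])
    have "expectation (chain_bound (X s) r 1) \<le> (real r + 1) ^ 4 * (\<Sum>n=1..<1 + 2 ^ r. (a s n)\<^sup>2 * real (divisor_count n))\<^sup>2"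
      using * by (simp add: X_def[abs_def])
    also have "\<dots> \<le> (real r + 1) ^ 4 * \<eta>\<^sup>2"
      using weight[of s] by (intro mult_left_mono power_mono sum_nonneg) auto
    finally show "expectation (chain_bound (X s) r 1) \<le> (real r + 1) ^ 4 * \<eta>\<^sup>2" .
  qed
  have R0: "R \<omega> \<ge> 0" for \<omega> unfolding R_def by (intro sum_nonneg chain_bound_nonneg)
  have Rint: "integrable M R" unfolding R_def[abs_def] using chain by auto
  have "expectation R = (\<Sum>s\<in>P. expectation (chain_bound (X s) r 1))"
    unfolding R_def[abs_def] using chain by (intro Bochner_Integration.integral_sum) auto
  also have "\<dots> \<le> (\<Sum>s\<in>P. (real r + 1) ^ 4 * \<eta>\<^sup>2)" by (intro sum_mono chain)
  finally have "expectation R \<le> card P * (real r + 1) ^ 4 * \<eta>\<^sup>2" by simp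
  then have ER: "(\<integral>\<^sup>+\<omega>. ennreal (R \<omega>) \<partial>M) \<le> ennreal (card P * (real r + 1) ^ 4 * \<eta>\<^sup>2)"
    using Rint R0 by (simp add: nn_integral_eq_integral ennreal_leI)
  have bound: "norm (\<Sum>m\<in>{t n<..n}. F m \<omega> / of_real (sqrt m)) ^ 4 \<le> R \<omega>" if n: "n \<in> I" for n \<omega>
  proof -
    have "t n \<in> {1..N}" using n t(1) assms(2) by blast
    then have tn: "t n \<in> P" "1 \<le> t n" "n \<le> N" using n assms(2) by (auto simp: P_def)
    have \<tau>eq: "\<tau> m = \<tau> (t n)" if "m \<in> {t n<..n}" for m
      using \<tau>mono[of "t n" m] \<tau>mono[of m n] t(2)[OF n] that by simp
    have "(\<Sum>m\<in>{t n<..n}. F m \<omega> / of_real (sqrt m)) = (\<Sum>m=1..<1+n. X (t n) m \<omega>)"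
    proof (rule sum.mono_neutral_cong_left)
      show "\<forall>m\<in>{1..<1+n} - {t n<..n}. X (t n) m \<omega> = 0" by (auto simp: X_def a_def)
      fix m assume m: "m \<in> {t n<..n}"
      then have "a (t n) m = 1 / sqrt (real m)" using \<tau>eq[OF m] tn by (simp add: a_def)
      then show "F m \<omega> / of_real (sqrt m) = X (t n) m \<omega>" by (simp add: X_def)
    qed auto
    moreover have "n \<le> 2 ^ r" using tn(3) assms(4) by linarith
    ultimately have "norm (\<Sum>m\<in>{t n<..n}. F m \<omega> / of_real (sqrt m)) ^ 4 \<le> chain_bound (X (t n)) r 1 \<omega>"
      using chain_bound_max[where j = n and r = r and c = 1 and X = "X (t n)" and \<omega> = \<omega>] by simp
    also have "\<dots> \<le> R \<omega>" unfolding R_def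
      using tn(1) finI by (intro member_le_sum chain_bound_nonneg) (auto simp: P_def)
    finally show ?thesis .
  qed
  show ?thesis
    by (rule that[OF _ cardP _ _ R0 ER bound]) (use t Rint in \<open>auto simp: P_def\<close>)
qed

section \<open>Partial sums over smooth numbers\<close>

definition Psi :: "nat set \<Rightarrow> real \<Rightarrow> 'a \<Rightarrow> complex" where
  "Psi S z \<omega> = (\<Sum>n | n \<in> smooth_over S \<and> real n \<le> z. F n \<omega> / of_real (sqrt (real n)))"

lemma bounded_adapted_scaled_F: "n \<in> smooth_over S \<Longrightarrow> bounded_adapted S (\<lambda>\<omega>. F n \<omega> / of_real (sqrt (real n)))"
  unfolding divide_inverse by (intro bounded_adapted_mult bounded_adapted_F bounded_adapted_const)

lemma bounded_adapted_Psi: "bounded_adapted S (Psi S z)"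
  unfolding Psi_def[abs_def] by (intro bounded_adapted_sum bounded_adapted_scaled_F) auto

lemma Psi_eq_0: "z < 1 \<Longrightarrow> Psi S z \<omega> = 0"
  unfolding Psi_def by (intro sum.neutral) (auto dest!: smooth_over_pos)

text \<open>Each smooth n is uniquely a * b with a smooth over S and b smooth over T. For fixed b
  the inner sum is determined by S, so the outer sum has the shape to which the conditional moment
  identities apply.\<close>

lemma Psi_Un:
  assumes "S \<inter> T = {}"
  shows "Psi (S \<union> T) z \<omega> = (\<Sum>b | b \<in> smooth_over T \<and> real b \<le> z. (F b \<omega> / of_real (sqrt (real b))) * Psi S (z / real b) \<omega>)"
proof -
  let ?B = "{b. b \<in> smooth_over T \<and> real b \<le> z}"
  let ?A = "\<lambda>b. {a. a \<in> smooth_over S \<and> real a \<le> z / real b}"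
  have "(\<Sum>b\<in>?B. (F b \<omega> / of_real (sqrt (real b))) * Psi S (z / real b) \<omega>)
      = (\<Sum>b\<in>?B. \<Sum>a\<in>?A b. (F b \<omega> / of_real (sqrt (real b))) * (F a \<omega> / of_real (sqrt (real a))))"
    by (simp add: Psi_def sum_distrib_left)
  also have "\<dots> = (\<Sum>(b, a)\<in>(SIGMA b:?B. ?A b). (F b \<omega> / of_real (sqrt (real b))) * (F a \<omega> / of_real (sqrt (real a))))"
    by (intro sum.Sigma) auto
  also have "\<dots> = (\<Sum>n | n \<in> smooth_over (S \<union> T) \<and> real n \<le> z. F n \<omega> / of_real (sqrt (real n)))"
  proof (rule sum.reindex_bij_betw[THEN trans[rotated], of "\<lambda>(b, a). a * b"])
    show "bij_betw (\<lambda>(b, a). a * b) (SIGMA b:?B. ?A b) {n. n \<in> smooth_over (S \<union> T) \<and> real n \<le> z}"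
    proof (rule bij_betwI')
      fix x y assume "x \<in> (SIGMA b:?B. ?A b)" "y \<in> (SIGMA b:?B. ?A b)"
      then show "((case x of (b, a) \<Rightarrow> a * b) = (case y of (b, a) \<Rightarrow> a * b)) = (x = y)"
        using inj_onD[OF smooth_over_mult_inj[OF assms], of "(snd x, fst x)" "(snd y, fst y)"]
        by (auto simp: case_prod_unfold prod_eq_iff)
    next
      fix x assume x: "x \<in> (SIGMA b:?B. ?A b)"
      then have "fst x \<in> smooth_over T" "snd x \<in> smooth_over S" "real (snd x) \<le> z / real (fst x)" by auto
      moreover from this have "fst x > 0" using smooth_over_pos by blast
      ultimately show "(case x of (b, a) \<Rightarrow> a * b) \<in> {n. n \<in> smooth_over (S \<union> T) \<and> real n \<le> z}"
        unfolding smooth_over_Un_image by (auto simp: case_prod_unfold field_simps image_iff) (metis mult.commute)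
    next
      fix n assume n: "n \<in> {n. n \<in> smooth_over (S \<union> T) \<and> real n \<le> z}"
      then obtain a b where ab: "n = a * b" "a \<in> smooth_over S" "b \<in> smooth_over T"
        using smooth_over_Un_decomp by blast
      then have pos: "a > 0" "b > 0" using smooth_over_pos by auto
      have "b \<le> n" using ab pos by simp
      then have "real b \<le> z" using n by (simp add: order_trans[of "real b" "real n"])
      moreover have "real a \<le> z / real b" using n ab pos by (simp add: field_simps)
      ultimately show "\<exists>x\<in>(SIGMA b:?B. ?A b). n = (case x of (b, a) \<Rightarrow> a * b)"
        using ab by (intro bexI[of _ "(b, a)"]) auto
    qed
    show "(\<Sum>(b, a)\<in>(SIGMA b:?B. ?A b). (F b \<omega> / of_real (sqrt (real b))) * (F a \<omega> / of_real (sqrt (real a))))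
       = (\<Sum>x\<in>(SIGMA b:?B. ?A b). F (case x of (b, a) \<Rightarrow> a * b) \<omega> / of_real (sqrt (real (case x of (b, a) \<Rightarrow> a * b))))"
      by (intro sum.cong refl) (auto simp: F_mult smooth_over_pos real_sqrt_mult mult_ac)
  qed
  finally show ?thesis by (simp add: Psi_def)
qed

lemma space_in_prime_sigma: "space M \<in> sets (prime_sigma S)"
  using sets.top[of "prime_sigma S"] by simp

text \<open>An event decided by S can be absorbed into the coefficients. Integrals over such events
  do the work of conditional expectations from here on.\<close>

lemma second_moment_nn:
  assumes A: "\<And>b. b \<in> B \<Longrightarrow> bounded_adapted S (A b)" and S: "S \<subseteq> {p. prime p}" and T: "T \<subseteq> {p. prime p}" "S \<inter> T = {}"
    and B: "finite B" "B \<subseteq> smooth_over T" and G: "G \<in> sets (prime_sigma S)"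
  shows "(\<integral>\<^sup>+\<omega>. ennreal ((norm (\<Sum>b\<in>B. A b \<omega> * F b \<omega>))\<^sup>2) * indicator G \<omega> \<partial>M)
    = (\<Sum>b\<in>B. \<integral>\<^sup>+\<omega>. ennreal ((norm (A b \<omega>))\<^sup>2) * indicator G \<omega> \<partial>M)"
proof -
  let ?A = "\<lambda>b \<omega>. A b \<omega> * indicator G \<omega>"
  have G': "bounded_adapted S (indicator G)"
    by (rule bounded_adaptedI[where C = 1]) (use G in \<open>auto simp: indicator_def\<close>)
  have bounded_adapted: "bounded_adapted S (?A b)" if "b \<in> B" for b using A[OF that] G' by (rule bounded_adapted_mult)
  have ST: "S \<union> T \<subseteq> {p. prime p}" using S T by auto
  have "bounded_adapted (S \<union> T) (\<lambda>\<omega>. \<Sum>b\<in>B. ?A b \<omega> * F b \<omega>)"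
  proof (intro bounded_adapted_sum bounded_adapted_mult[of _ "\<lambda>\<omega>. ?A _ \<omega>"])
    fix b assume b: "b \<in> B"
    show "bounded_adapted (S \<union> T) (?A b)" by (rule bounded_adapted_mono[OF _ bounded_adapted[OF b]]) auto
    show "bounded_adapted (S \<union> T) (F b)" by (rule bounded_adapted_mono[of T]) (use b B in \<open>auto intro: bounded_adapted_F\<close>)
  qed
  then have int: "integrable M (\<lambda>\<omega>. (norm (\<Sum>b\<in>B. ?A b \<omega> * F b \<omega>))\<^sup>2)"
    using bounded_adapted_norm_power_integrable[OF ST] by blast
  have "(\<integral>\<^sup>+\<omega>. ennreal ((norm (\<Sum>b\<in>B. A b \<omega> * F b \<omega>))\<^sup>2) * indicator G \<omega> \<partial>M)
      = (\<integral>\<^sup>+\<omega>. ennreal ((norm (\<Sum>b\<in>B. ?A b \<omega> * F b \<omega>))\<^sup>2) \<partial>M)"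
    by (intro nn_integral_cong) (auto simp: indicator_def)
  also have "\<dots> = ennreal (expectation (\<lambda>\<omega>. (norm (\<Sum>b\<in>B. ?A b \<omega> * F b \<omega>))\<^sup>2))"
    using int by (intro nn_integral_eq_integral) auto
  also have "\<dots> = ennreal (\<Sum>b\<in>B. expectation (\<lambda>\<omega>. (norm (?A b \<omega>))\<^sup>2))"
    using second_moment[OF bounded_adapted S T B] by simp
  also have "\<dots> = (\<Sum>b\<in>B. ennreal (expectation (\<lambda>\<omega>. (norm (?A b \<omega>))\<^sup>2)))"
    by (intro sum_ennreal[symmetric]) simp
  also have "\<dots> = (\<Sum>b\<in>B. \<integral>\<^sup>+\<omega>. ennreal ((norm (?A b \<omega>))\<^sup>2) \<partial>M)"
    using bounded_adapted_norm_power_integrable[OF S bounded_adapted] by (intro sum.cong refl nn_integral_eq_integral[symmetric]) auto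
  also have "\<dots> = (\<Sum>b\<in>B. \<integral>\<^sup>+\<omega>. ennreal ((norm (A b \<omega>))\<^sup>2) * indicator G \<omega> \<partial>M)"
    by (intro sum.cong refl nn_integral_cong) (auto simp: indicator_def)
  finally show ?thesis .
qed

lemma Psi_M: "S \<subseteq> {p. prime p} \<Longrightarrow> Psi S z \<in> borel_measurable M"
  using bounded_adapted_M bounded_adapted_Psi by blast

lemma ennreal_norm_scaled:
  assumes "b > 0"
  shows "ennreal ((norm (c / complex_of_real (sqrt (real b))))\<^sup>2) = ennreal (1 / real b) * ennreal ((norm c)\<^sup>2)"
  using assms by (simp add: norm_divide power_divide ennreal_mult[symmetric])

lemma Psi_Un_second_moment:
  assumes S: "S \<subseteq> {p. prime p}" and T: "T \<subseteq> {p. prime p}" "S \<inter> T = {}" and G: "G \<in> sets (prime_sigma S)"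
  shows "(\<integral>\<^sup>+\<omega>. ennreal ((norm (Psi (S \<union> T) z \<omega>))\<^sup>2) * indicator G \<omega> \<partial>M)
    = (\<Sum>b | b \<in> smooth_over T \<and> real b \<le> z. ennreal (1 / real b) *
         (\<integral>\<^sup>+\<omega>. ennreal ((norm (Psi S (z / real b) \<omega>))\<^sup>2) * indicator G \<omega> \<partial>M))"
proof -
  let ?B = "{b. b \<in> smooth_over T \<and> real b \<le> z}"
  define A where "A b \<omega> = Psi S (z / real b) \<omega> / complex_of_real (sqrt (real b))" for b \<omega>
  have bounded_adapted: "bounded_adapted S (A b)" for b
    unfolding A_def divide_inverse by (intro bounded_adapted_mult bounded_adapted_Psi bounded_adapted_const)
  have "(\<integral>\<^sup>+\<omega>. ennreal ((norm (Psi (S \<union> T) z \<omega>))\<^sup>2) * indicator G \<omega> \<partial>M)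
     = (\<integral>\<^sup>+\<omega>. ennreal ((norm (\<Sum>b\<in>?B. A b \<omega> * F b \<omega>))\<^sup>2) * indicator G \<omega> \<partial>M)"
    unfolding Psi_Un[OF T(2)] A_def by (simp add: mult_ac)
  also have "\<dots> = (\<Sum>b\<in>?B. \<integral>\<^sup>+\<omega>. ennreal ((norm (A b \<omega>))\<^sup>2) * indicator G \<omega> \<partial>M)"
    by (rule second_moment_nn[OF bounded_adapted S T _ _ G]) auto
  also have "\<dots> = (\<Sum>b\<in>?B. ennreal (1 / real b) * (\<integral>\<^sup>+\<omega>. ennreal ((norm (Psi S (z / real b) \<omega>))\<^sup>2) * indicator G \<omega> \<partial>M))"
  proof (rule sum.cong[OF refl])
    fix b assume "b \<in> ?B"
    then have "b > 0" using smooth_over_pos by blast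
    have [measurable]: "Psi S (z / real b) \<in> borel_measurable M" "G \<in> events"
      using Psi_M[OF S] sets_prime_sigma_subset[OF S] G by auto
    show "(\<integral>\<^sup>+\<omega>. ennreal ((norm (A b \<omega>))\<^sup>2) * indicator G \<omega> \<partial>M)
       = ennreal (1 / real b) * (\<integral>\<^sup>+\<omega>. ennreal ((norm (Psi S (z / real b) \<omega>))\<^sup>2) * indicator G \<omega> \<partial>M)"
      unfolding A_def ennreal_norm_scaled[OF \<open>b > 0\<close>] mult.assoc by (rule nn_integral_cmult) measurable
  qed
  finally show ?thesis .
qed

lemma Psi_diff_second_moment:
  assumes "S \<subseteq> {p. prime p}" "z \<le> z'"
  shows "(\<integral>\<^sup>+\<omega>. ennreal ((norm (Psi S z' \<omega> - Psi S z \<omega>))\<^sup>2) \<partial>M)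
    = ennreal (\<Sum>n | n \<in> smooth_over S \<and> z < real n \<and> real n \<le> z'. 1 / real n)"
proof -
  let ?N = "{n. n \<in> smooth_over S \<and> z < real n \<and> real n \<le> z'}"
  have fin: "finite ?N" by (rule finite_subset[OF _ finite_nat_le_real[of z']]) auto
  have eq: "Psi S z' \<omega> - Psi S z \<omega> = (\<Sum>n\<in>?N. of_real (1 / sqrt (real n)) * F n \<omega>)" for \<omega>
  proof -
    have "Psi S z' \<omega> - Psi S z \<omega> = (\<Sum>n\<in>{n. n \<in> smooth_over S \<and> real n \<le> z'} - {n. n \<in> smooth_over S \<and> real n \<le> z}. F n \<omega> / of_real (sqrt (real n)))"
      unfolding Psi_def using assms(2) by (intro sum_diff[symmetric]) auto
    also have "{n. n \<in> smooth_over S \<and> real n \<le> z'} - {n. n \<in> smooth_over S \<and> real n \<le> z} = ?N" by auto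
    finally show ?thesis by simp
  qed
  have "(\<integral>\<^sup>+\<omega>. ennreal ((norm (Psi S z' \<omega> - Psi S z \<omega>))\<^sup>2) \<partial>M)
     = (\<integral>\<^sup>+\<omega>. ennreal ((norm (\<Sum>n\<in>?N. of_real (1 / sqrt (real n)) * F n \<omega>))\<^sup>2) * indicator (space M) \<omega> \<partial>M)"
    unfolding eq by (intro nn_integral_cong) simp
  also have "\<dots> = (\<Sum>n\<in>?N. \<integral>\<^sup>+\<omega>. ennreal ((norm (complex_of_real (1 / sqrt (real n))))\<^sup>2) * indicator (space M) \<omega> \<partial>M)"
    by (rule second_moment_nn[where S = "{}" and T = S])
      (use assms(1) fin in \<open>auto intro: bounded_adapted_const space_in_prime_sigma\<close>)
  also have "\<dots> = (\<Sum>n\<in>?N. ennreal (1 / real n))"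
  proof (rule sum.cong[OF refl])
    fix n assume "n \<in> ?N"
    then have "n > 0" using smooth_over_pos by blast
    then have "(norm (complex_of_real (1 / sqrt (real n))))\<^sup>2 = 1 / real n" by (simp add: power_divide norm_divide)
    then show "(\<integral>\<^sup>+\<omega>. ennreal ((norm (complex_of_real (1 / sqrt (real n))))\<^sup>2) * indicator (space M) \<omega> \<partial>M) = ennreal (1 / real n)"
      by (simp only: nn_integral_cmult_indicator sets.top emeasure_space_1 mult_1_right)
  qed
  also have "\<dots> = ennreal (\<Sum>n\<in>?N. 1 / real n)" by (intro sum_ennreal) auto
  finally show ?thesis .
qed

subsection \<open>Mean squares on the logarithmic scale\<close>

text \<open>The integral of |Psi|^2 dx / x up to exp U, after the substitution x = exp u. The range
  is unbounded below because \<open>Psi\<close> vanishes for u < 0; translating u by ln b then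
  creates no boundary term.\<close>

definition mean_sq :: "nat set \<Rightarrow> real \<Rightarrow> 'a \<Rightarrow> ennreal" where
  "mean_sq S U \<omega> = (\<integral>\<^sup>+u. ennreal ((norm (Psi S (exp u) \<omega>))\<^sup>2) * indicator {..U} u \<partial>lborel)"

text \<open>With a fixed finite index set and u only in the conditions, measurability in u and joint
  measurability in (\<omega>, u) follow term by term; Fubini's theorem relies on this.\<close>

lemma Psi_exp_trunc:
  assumes "u \<le> U"
  shows "Psi S (exp u) \<omega> = (\<Sum>n | n \<in> smooth_over S \<and> real n \<le> exp U. (if ln (real n) \<le> u then F n \<omega> / of_real (sqrt (real n)) else 0))"
proof -
  have "Psi S (exp u) \<omega> = (\<Sum>n | n \<in> smooth_over S \<and> real n \<le> exp u. F n \<omega> / of_real (sqrt (real n)))"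
    by (simp add: Psi_def)
  also have "{n. n \<in> smooth_over S \<and> real n \<le> exp u} = {n. n \<in> smooth_over S \<and> real n \<le> exp U} \<inter> {n. ln (real n) \<le> u}"
  proof -
    have "real n \<le> exp u \<longleftrightarrow> ln (real n) \<le> u" if "n \<in> smooth_over S" for n
      using smooth_over_pos[OF that] by (simp add: ln_le_cancel_iff[symmetric, of "real n" "exp u"] del: ln_le_cancel_iff)
    moreover have "exp u \<le> exp U" using assms by simp
    ultimately show ?thesis by (auto intro: order_trans)
  qed
  also have "(\<Sum>n\<in>{n. n \<in> smooth_over S \<and> real n \<le> exp U} \<inter> {n. ln (real n) \<le> u}. F n \<omega> / of_real (sqrt (real n)))
     = (\<Sum>n | n \<in> smooth_over S \<and> real n \<le> exp U. (if ln (real n) \<le> u then F n \<omega> / of_real (sqrt (real n)) else 0))"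
    by (subst sum.inter_restrict) auto
  finally show ?thesis .
qed

lemma measurable_Psi_exp_trunc [measurable]:
  assumes S: "S \<subseteq> {p. prime p}"
  shows "(\<lambda>x. Psi S (exp (snd x)) (fst x) * indicator {..U} (snd x)) \<in> borel_measurable (M \<Otimes>\<^sub>M lborel)"
proof -
  have "(\<lambda>x. Psi S (exp (snd x)) (fst x) * indicator {..U} (snd x))
    = (\<lambda>x. (\<Sum>n | n \<in> smooth_over S \<and> real n \<le> exp U. (if ln (real n) \<le> snd x then F n (fst x) / of_real (sqrt (real n)) else 0)) * indicator {..U} (snd x))"
  proof
    fix x :: "'a \<times> real"
    show "Psi S (exp (snd x)) (fst x) * indicator {..U} (snd x) = (\<Sum>n | n \<in> smooth_over S \<and> real n \<le> exp U. (if ln (real n) \<le> snd x then F n (fst x) / of_real (sqrt (real n)) else 0)) * indicator {..U} (snd x)"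
      by (cases "snd x \<le> U") (simp_all add: Psi_exp_trunc[of _ U])
  qed
  moreover have "\<dots> \<in> borel_measurable (M \<Otimes>\<^sub>M lborel)"
  proof (intro borel_measurable_times borel_measurable_sum)
    fix n assume "n \<in> {n. n \<in> smooth_over S \<and> real n \<le> exp U}"
    then have [measurable]: "F n \<in> borel_measurable M" using bounded_adapted_M[OF S bounded_adapted_F] by auto
    show "(\<lambda>x. if ln (real n) \<le> snd x then F n (fst x) / of_real (sqrt (real n)) else 0) \<in> borel_measurable (M \<Otimes>\<^sub>M lborel)"
      by measurable
  qed measurable
  ultimately show ?thesis by simp
qed

lemma norm_sq_indicator:
  "ennreal ((norm (c :: complex))\<^sup>2) * indicator A u = ennreal ((norm (c * indicator A u))\<^sup>2)"
  by (simp add: indicator_def)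

lemma measurable_norm_Psi_exp:
  assumes S: "S \<subseteq> {p. prime p}"
  shows "(\<lambda>x. ennreal ((norm (Psi S (exp (snd x)) (fst x)))\<^sup>2) * indicator {..U} (snd x)) \<in> borel_measurable (M \<Otimes>\<^sub>M lborel)"
  unfolding norm_sq_indicator using measurable_Psi_exp_trunc[OF S, of U] by measurable

lemma mean_sq_M: "S \<subseteq> {p. prime p} \<Longrightarrow> mean_sq S U \<in> borel_measurable M"
  unfolding mean_sq_def[abs_def]
  using lborel.borel_measurable_nn_integral[of "\<lambda>\<omega> u. ennreal ((norm (Psi S (exp u) \<omega>))\<^sup>2) * indicator {..U} u" M]
    measurable_norm_Psi_exp[of S U] by (simp add: case_prod_unfold)

lemma mean_sq_mono: "U \<le> V \<Longrightarrow> mean_sq S U \<omega> \<le> mean_sq S V \<omega>"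
  unfolding mean_sq_def by (intro nn_integral_mono mult_left_mono) (auto simp: indicator_def)

lemma mean_sq_Fubini:
  assumes S: "S \<subseteq> {p. prime p}" and G: "G \<in> events"
  shows "(\<integral>\<^sup>+\<omega>. mean_sq S U \<omega> * indicator G \<omega> \<partial>M)
    = (\<integral>\<^sup>+u. (\<integral>\<^sup>+\<omega>. ennreal ((norm (Psi S (exp u) \<omega>))\<^sup>2) * indicator G \<omega> \<partial>M) * indicator {..U} u \<partial>lborel)"
    and "(\<lambda>u. (\<integral>\<^sup>+\<omega>. ennreal ((norm (Psi S (exp u) \<omega>))\<^sup>2) * indicator G \<omega> \<partial>M) * indicator {..U} u) \<in> borel_measurable lborel"
proof -
  interpret pair_sigma_finite M lborel ..
  define h where "h x = ennreal ((norm (Psi S (exp (snd x)) (fst x)))\<^sup>2) * indicator {..U} (snd x) * indicator G (fst x)" for x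
  have h[measurable]: "h \<in> borel_measurable (M \<Otimes>\<^sub>M lborel)"
    unfolding h_def[abs_def] using measurable_norm_Psi_exp[OF S, of U] G by measurable
  have m: "Psi S z \<in> borel_measurable M" for z using Psi_M[OF S] .
  have in1: "(\<integral>\<^sup>+u. h (\<omega>, u) \<partial>lborel) = mean_sq S U \<omega> * indicator G \<omega>" for \<omega>
    unfolding h_def mean_sq_def by (cases "\<omega> \<in> G") (auto simp: )
  have in2: "(\<integral>\<^sup>+\<omega>. h (\<omega>, u) \<partial>M) = (\<integral>\<^sup>+\<omega>. ennreal ((norm (Psi S (exp u) \<omega>))\<^sup>2) * indicator G \<omega> \<partial>M) * indicator {..U} u" for u
    unfolding h_def by (cases "u \<le> U") (auto simp: )
  have "(\<integral>\<^sup>+u. (\<integral>\<^sup>+\<omega>. h (\<omega>, u) \<partial>M) \<partial>lborel) = (\<integral>\<^sup>+\<omega>. (\<integral>\<^sup>+u. h (\<omega>, u) \<partial>lborel) \<partial>M)"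
    by (rule Fubini') (use h in \<open>simp add: case_prod_unfold\<close>)
  then show "(\<integral>\<^sup>+\<omega>. mean_sq S U \<omega> * indicator G \<omega> \<partial>M)
    = (\<integral>\<^sup>+u. (\<integral>\<^sup>+\<omega>. ennreal ((norm (Psi S (exp u) \<omega>))\<^sup>2) * indicator G \<omega> \<partial>M) * indicator {..U} u \<partial>lborel)"
    unfolding in1 in2 by simp
  have "(\<lambda>u. \<integral>\<^sup>+\<omega>. h (\<omega>, u) \<partial>M) \<in> borel_measurable lborel"
    using h by measurable
  then show "(\<lambda>u. (\<integral>\<^sup>+\<omega>. ennreal ((norm (Psi S (exp u) \<omega>))\<^sup>2) * indicator G \<omega> \<partial>M) * indicator {..U} u) \<in> borel_measurable lborel"
    unfolding in2 .
qed

text \<open>In other words \<open>mean_sq S U / mertens S\<close> is a supermartingale in \<open>S\<close>; this takes the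
  place of Plancherel's identity for the Euler product on the critical line.\<close>
lemma mean_sq_supermartingale:
  assumes S: "S \<subseteq> {p. prime p}" and T: "T \<subseteq> {p. prime p}" "S \<inter> T = {}" "finite T" and G: "G \<in> sets (prime_sigma S)"
  shows "(\<integral>\<^sup>+\<omega>. mean_sq (S \<union> T) U \<omega> * indicator G \<omega> \<partial>M) \<le> ennreal (mertens T) * (\<integral>\<^sup>+\<omega>. mean_sq S U \<omega> * indicator G \<omega> \<partial>M)"
proof -
  have ST: "S \<union> T \<subseteq> {p. prime p}" using S T by auto
  have GM: "G \<in> events" using G sets_prime_sigma_subset[OF S] by auto
  define \<phi> where "\<phi> z = (\<integral>\<^sup>+\<omega>. ennreal ((norm (Psi S z \<omega>))\<^sup>2) * indicator G \<omega> \<partial>M)" for z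
  define I where "I = (\<integral>\<^sup>+\<omega>. mean_sq S U \<omega> * indicator G \<omega> \<partial>M)"
  have I: "I = (\<integral>\<^sup>+u. \<phi> (exp u) * indicator {..U} u \<partial>lborel)"
    unfolding I_def \<phi>_def by (rule mean_sq_Fubini(1)[OF S GM])
  have meas: "(\<lambda>u. \<phi> (exp u) * indicator {..V} u) \<in> borel_measurable borel" for V
    unfolding \<phi>_def using mean_sq_Fubini(2)[OF S GM] by simp
  let ?B = "{b. b \<in> smooth_over T \<and> real b \<le> exp U}"
  have shift: "(\<integral>\<^sup>+u. \<phi> (exp u / real b) * indicator {..U} u \<partial>lborel) \<le> I"
    and shift_meas: "(\<lambda>u. \<phi> (exp u / real b) * indicator {..U} u) \<in> borel_measurable lborel" if b: "b \<in> ?B" for b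
  proof -
    have b0: "real b \<ge> 1" using smooth_over_pos[of b T] b by auto
    then have lnb: "ln (real b) \<ge> 0" by simp
    \<comment> \<open>Division by b translates u by ln b >= 0 and the translated range stays below
      U. Each b therefore contributes at most I / b, and the sum of 1 / b is at most the Mertens
      product of T.\<close>
    have eq: "\<phi> (exp u / real b) * indicator {..U} u = \<phi> (exp (- ln (real b) + 1 * u)) * indicator {..U - ln (real b)} (- ln (real b) + 1 * u)" for u
      using b0 by (auto simp: exp_diff indicator_def)
    show "(\<lambda>u. \<phi> (exp u / real b) * indicator {..U} u) \<in> borel_measurable lborel"
      unfolding eq using meas[of "U - ln (real b)"] by measurable
    have "(\<integral>\<^sup>+u. \<phi> (exp u / real b) * indicator {..U} u \<partial>lborel) = (\<integral>\<^sup>+u. \<phi> (exp u) * indicator {..U - ln (real b)} u \<partial>lborel)"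
      unfolding eq using nn_integral_real_affine[OF meas[of "U - ln (real b)"], of 1 "- ln (real b)"] by simp
    also have "\<dots> \<le> I" unfolding I
      using lnb by (intro nn_integral_mono mult_left_mono) (auto simp: indicator_def)
    finally show "(\<integral>\<^sup>+u. \<phi> (exp u / real b) * indicator {..U} u \<partial>lborel) \<le> I" .
  qed
  have "(\<integral>\<^sup>+\<omega>. mean_sq (S \<union> T) U \<omega> * indicator G \<omega> \<partial>M)
     = (\<integral>\<^sup>+u. (\<integral>\<^sup>+\<omega>. ennreal ((norm (Psi (S \<union> T) (exp u) \<omega>))\<^sup>2) * indicator G \<omega> \<partial>M) * indicator {..U} u \<partial>lborel)"
    by (rule mean_sq_Fubini(1)[OF ST GM])
  also have "\<dots> \<le> (\<integral>\<^sup>+u. (\<Sum>b\<in>?B. ennreal (1 / real b) * (\<phi> (exp u / real b) * indicator {..U} u)) \<partial>lborel)"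
  proof (rule nn_integral_mono)
    fix u :: real
    show "(\<integral>\<^sup>+\<omega>. ennreal ((norm (Psi (S \<union> T) (exp u) \<omega>))\<^sup>2) * indicator G \<omega> \<partial>M) * indicator {..U} u
      \<le> (\<Sum>b\<in>?B. ennreal (1 / real b) * (\<phi> (exp u / real b) * indicator {..U} u))"
    proof (cases "u \<le> U")
      case True
      then have "exp u \<le> exp U" by simp
      then have "(\<Sum>b | b \<in> smooth_over T \<and> real b \<le> exp u. ennreal (1 / real b) * \<phi> (exp u / real b))
         \<le> (\<Sum>b\<in>?B. ennreal (1 / real b) * \<phi> (exp u / real b))"
        by (intro sum_mono2) (force intro: order_trans[OF _ \<open>exp u \<le> exp U\<close>])+
      then show ?thesis using True unfolding Psi_Un_second_moment[OF S T(1,2) G] \<phi>_def by simp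
    qed simp
  qed
  also have "\<dots> = (\<Sum>b\<in>?B. ennreal (1 / real b) * (\<integral>\<^sup>+u. \<phi> (exp u / real b) * indicator {..U} u \<partial>lborel))"
    using shift_meas
    by (subst nn_integral_sum) (auto intro!: sum.cong nn_integral_cmult simp: borel_measurable_times)
  also have "\<dots> \<le> (\<Sum>b\<in>?B. ennreal (1 / real b) * I)"
    by (intro sum_mono mult_left_mono shift) auto
  also have "\<dots> = ennreal (\<Sum>b\<in>?B. 1 / real b) * I"
    by (simp add: sum_distrib_right[symmetric] sum_ennreal)
  also have "\<dots> \<le> ennreal (mertens T) * I"
    using T by (intro mult_right_mono ennreal_leI sum_inverse_smooth_le) auto
  finally show ?thesis by (simp add: I_def)
qed

text \<open>The supermartingale inequality started from the empty set of primes, where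
  \<open>Psi\<close> is the indicator of z >= 1 and the mean square equals U.\<close>

lemma mean_sq_expectation_le:
  assumes "S \<subseteq> {p. prime p}" "finite S" "U \<ge> 0"
  shows "(\<integral>\<^sup>+\<omega>. mean_sq S U \<omega> \<partial>M) \<le> ennreal (U * mertens S)"
proof -
  note sp = space_in_prime_sigma[of "{}"]
  have m1: "Psi {} z \<omega> = (if z \<ge> 1 then 1 else 0)" for z \<omega>
  proof (cases "z \<ge> 1")
    case True
    then have "{n. n \<in> smooth_over {} \<and> real n \<le> z} = {1}" by (auto simp: smooth_over_empty)
    then show ?thesis using True by (simp add: Psi_def)
  qed (simp add: Psi_eq_0)
  have "mean_sq {} U \<omega> = ennreal U" for \<omega>
  proof -
    have "mean_sq {} U \<omega> = (\<integral>\<^sup>+u. indicator {0..U} u \<partial>lborel)"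
      unfolding mean_sq_def m1 by (intro nn_integral_cong) (auto simp: indicator_def)
    also have "\<dots> = ennreal U" using assms(3) by simp
    finally show ?thesis .
  qed
  then have "(\<integral>\<^sup>+\<omega>. mean_sq {} U \<omega> * indicator (space M) \<omega> \<partial>M) = ennreal U"
    by (simp add: nn_integral_cmult_indicator emeasure_space_1)
  then have "(\<integral>\<^sup>+\<omega>. mean_sq ({} \<union> S) U \<omega> * indicator (space M) \<omega> \<partial>M) \<le> ennreal (mertens S) * ennreal U"
    using mean_sq_supermartingale[of "{}" S "space M" U] assms sp by simp
  moreover have "(\<integral>\<^sup>+\<omega>. mean_sq ({} \<union> S) U \<omega> * indicator (space M) \<omega> \<partial>M) = (\<integral>\<^sup>+\<omega>. mean_sq S U \<omega> \<partial>M)"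
    by (intro nn_integral_cong) simp
  moreover have "mertens S \<ge> 1" using mertens_ge_1[OF assms(2)] assms(1) by auto
  ultimately show ?thesis using assms(3) by (simp add: ennreal_mult[symmetric] mult.commute)
qed

end

section \<open>Euler products at 1/2 and the mean square while they stay bounded\<close>

lemma primes_upto_exp_sum_le: "(\<Sum>p\<in>primes_upto (exp (2 ^ i)). 1 / real p) \<le> 3 * (real i + 1)"
proof -
  have "(\<Sum>p\<in>primes_upto (exp (2 ^ i)). 1 / real p) \<le> exp 1 * ln (1 + 2 ^ i)"
    using primes_upto_sum_le[of "exp (2 ^ i)" 1] by simp
  also have "\<dots> \<le> 3 * (real i + 1)"
  proof (rule mult_mono)
    have "(1::real) \<le> 2 ^ i" by simp
    then have "(1::real) + 2 ^ i \<le> 2 ^ Suc i" by simp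
    also have "(2::real) ^ Suc i \<le> exp 1 ^ Suc i"
      using exp_ge_add_one_self[of 1] by (intro power_mono) auto
    also have "exp 1 ^ Suc i = exp (real i + 1)"
      using exp_of_nat_mult[of "Suc i" "1::real"] by (simp only: mult_1_right of_nat_Suc add.commute)
    finally have "ln (1 + 2 ^ i) \<le> ln (exp (real i + 1))" by (intro ln_mono) (auto simp: add_pos_pos)
    then show "ln (1 + 2 ^ i) \<le> real i + 1" by simp
  qed (use exp_le in auto)
  finally show ?thesis .
qed

context unimodular_primes
begin

definition euler_prod :: "nat set \<Rightarrow> 'a \<Rightarrow> complex" where
  "euler_prod S \<omega> = (\<Prod>p\<in>S. 1 / (1 - g p \<omega> / of_real (sqrt (real p))))"

lemma euler_prod_prime_sigma: "euler_prod S \<in> borel_measurable (prime_sigma S)"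
  unfolding euler_prod_def[abs_def] by (intro borel_measurable_prod borel_measurable_divide borel_measurable_diff g_prime_sigma) auto

lemma euler_prod_M: "S \<subseteq> {p. prime p} \<Longrightarrow> euler_prod S \<in> borel_measurable M"
  using prime_sigma_M euler_prod_prime_sigma by blast

lemma Psi_tendsto_euler_prod:
  assumes "finite S" "S \<subseteq> {p. prime p}"
  shows "(\<lambda>N. Psi S (real N) \<omega>) \<longlonglongrightarrow> euler_prod S \<omega>"
proof -
  define h where "h n = F n \<omega> / of_real (sqrt (real n))" for n
  have hs: "(h has_sum (\<Prod>p\<in>S. 1 / (1 - h p))) (smooth_over S)"
  proof (rule euler_product)
    show "norm (h p) < 1" if "p \<in> S" for p
      using that assms prime_real_ge_2[of p] by (auto simp: h_def norm_divide)
    show "h (m * n) = h m * h n" if "m > 0" "n > 0" for m n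
      using that by (simp add: h_def F_mult real_sqrt_mult)
  qed (use assms in \<open>auto simp: h_def\<close>)
  also have "(\<Prod>p\<in>S. 1 / (1 - h p)) = euler_prod S \<omega>"
    unfolding euler_prod_def h_def using assms by (intro prod.cong refl) (auto simp: F_prime)
  finally have "((\<lambda>n. if n \<in> smooth_over S then h n else 0) has_sum euler_prod S \<omega>) UNIV"
    by (subst has_sum_cong_neutral[where S = UNIV and T = "smooth_over S" and g = h]) auto
  then have "(\<lambda>n. if n \<in> smooth_over S then h n else 0) sums euler_prod S \<omega>" by (rule has_sum_imp_sums)
  then have "(\<lambda>N. \<Sum>n\<le>N. if n \<in> smooth_over S then h n else 0) \<longlonglongrightarrow> euler_prod S \<omega>"
    by (simp add: sums_def_le)
  moreover have "(\<Sum>n\<le>N. if n \<in> smooth_over S then h n else 0) = Psi S (real N) \<omega>" for N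
    unfolding Psi_def h_def by (subst sum.inter_filter[symmetric]) (auto intro!: sum.cong)
  ultimately show ?thesis by simp
qed

text \<open>Rankin's trick: 1/n <= z powr (-\<alpha>) * n powr (\<alpha> - 1) for n > z, and the
  resulting sum is again an Euler product. The infinite tail is reached from finite differences of
  \<open>Psi\<close> by Fatou's lemma.\<close>

lemma tail_rankin:
  assumes "finite S" "S \<subseteq> {p. prime p}" "0 < \<alpha>" "\<alpha> < 1" "z \<ge> 1"
  shows "(\<integral>\<^sup>+\<omega>. ennreal ((norm (euler_prod S \<omega> - Psi S z \<omega>))\<^sup>2) \<partial>M)
    \<le> ennreal (z powr (-\<alpha>) * (\<Prod>p\<in>S. 1 / (1 - real p powr (\<alpha> - 1))))"
proof -
  define K where "K = z powr (-\<alpha>) * (\<Prod>p\<in>S. 1 / (1 - real p powr (\<alpha> - 1)))"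
  have [measurable]: "Psi S w \<in> borel_measurable M" for w using Psi_M[OF assms(2)] .
  have hs: "((\<lambda>n. real n powr (\<alpha> - 1)) has_sum (\<Prod>p\<in>S. 1 / (1 - real p powr (\<alpha> - 1)))) (smooth_over S)"
  proof (rule euler_product)
    show "norm (real p powr (\<alpha> - 1)) < 1" if "p \<in> S" for p
      using that assms prime_real_ge_2[of p] by (auto intro!: powr_less_one)
  qed (use assms in \<open>auto simp: powr_mult\<close>)
  have N: "(\<integral>\<^sup>+\<omega>. ennreal ((norm (Psi S (real N) \<omega> - Psi S z \<omega>))\<^sup>2) \<partial>M) \<le> ennreal K" if "real N \<ge> z" for N
  proof -
    let ?N = "{n. n \<in> smooth_over S \<and> z < real n \<and> real n \<le> real N}"
    have "(\<Sum>n\<in>?N. 1 / real n) \<le> (\<Sum>n\<in>?N. z powr (-\<alpha>) * real n powr (\<alpha> - 1))"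
    proof (rule sum_mono)
      fix n assume n: "n \<in> ?N"
      then have n0: "real n > 0" using assms(5) by auto
      have "1 / real n = real n powr (-\<alpha> + (\<alpha> - 1))" using n0 by (simp add: powr_minus divide_inverse)
      also have "\<dots> = real n powr (-\<alpha>) * real n powr (\<alpha> - 1)" by (rule powr_add)
      finally have "1 / real n = real n powr (-\<alpha>) * real n powr (\<alpha> - 1)" .
      also have "real n powr (-\<alpha>) * real n powr (\<alpha> - 1) \<le> z powr (-\<alpha>) * real n powr (\<alpha> - 1)"
        using n assms by (intro mult_right_mono powr_mono2') auto
      finally show "1 / real n \<le> z powr (-\<alpha>) * real n powr (\<alpha> - 1)" .
    qed
    also have "\<dots> \<le> K"
      unfolding K_def sum_distrib_left[symmetric]
      by (intro mult_left_mono finite_sum_le_has_sum[OF hs])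
        (auto intro: finite_subset[OF _ finite_nat_le_real[of "real N"]])
    finally show ?thesis unfolding Psi_diff_second_moment[OF assms(2) that] by (rule ennreal_leI)
  qed
  have "(\<integral>\<^sup>+\<omega>. ennreal ((norm (euler_prod S \<omega> - Psi S z \<omega>))\<^sup>2) \<partial>M)
     = (\<integral>\<^sup>+\<omega>. liminf (\<lambda>N. ennreal ((norm (Psi S (real N) \<omega> - Psi S z \<omega>))\<^sup>2)) \<partial>M)"
  proof (rule nn_integral_cong)
    fix \<omega>
    have "(\<lambda>N. ennreal ((norm (Psi S (real N) \<omega> - Psi S z \<omega>))\<^sup>2)) \<longlonglongrightarrow> ennreal ((norm (euler_prod S \<omega> - Psi S z \<omega>))\<^sup>2)"
      by (intro tendsto_ennrealI tendsto_intros Psi_tendsto_euler_prod assms)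
    then show "ennreal ((norm (euler_prod S \<omega> - Psi S z \<omega>))\<^sup>2) = liminf (\<lambda>N. ennreal ((norm (Psi S (real N) \<omega> - Psi S z \<omega>))\<^sup>2))"
      by (intro lim_imp_Liminf[symmetric]) auto
  qed
  also have "\<dots> \<le> liminf (\<lambda>N. \<integral>\<^sup>+\<omega>. ennreal ((norm (Psi S (real N) \<omega> - Psi S z \<omega>))\<^sup>2) \<partial>M)"
    by (rule nn_integral_liminf) measurable
  also have "\<dots> \<le> ennreal K"
  proof (rule Liminf_le)
    show "\<forall>\<^sub>F N in sequentially. (\<integral>\<^sup>+\<omega>. ennreal ((norm (Psi S (real N) \<omega> - Psi S z \<omega>))\<^sup>2) \<partial>M) \<le> ennreal K"
      using eventually_ge_at_top[of "nat \<lceil>z\<rceil>"] by eventually_elim (rule N, linarith)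
  qed simp
  finally show ?thesis by (simp add: K_def)
qed

text \<open>With \<alpha> = 1 / 2^i one has p powr \<alpha> <= e for every p <= exp (2^i), so the
  shifted Euler product costs at most exp (O(i + 1)), while z powr (-\<alpha>) = exp (- ln z / 2^i).
  The tail is small as soon as ln z is a large multiple of i * 2^i.\<close>

lemma tail_bound:
  assumes "i \<ge> 1" "z \<ge> 1"
  shows "(\<integral>\<^sup>+\<omega>. ennreal ((norm (euler_prod (primes_upto (exp (2 ^ i))) \<omega> - Psi (primes_upto (exp (2 ^ i))) z \<omega>))\<^sup>2) \<partial>M)
    \<le> ennreal (exp (36 * (real i + 1) - ln z / 2 ^ i))"
proof -
  let ?S = "primes_upto (exp (2 ^ i))"
  define \<alpha> :: real where "\<alpha> = 1 / 2 ^ i"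
  have "(2::real) ^ 1 \<le> 2 ^ i" using assms(1) by (intro power_increasing) auto
  then have \<alpha>: "0 < \<alpha>" "\<alpha> \<le> 1 / 2" by (auto simp: \<alpha>_def field_simps)
  have "(\<Prod>p\<in>?S. 1 / (1 - real p powr (\<alpha> - 1))) \<le> (\<Prod>p\<in>?S. exp (12 * (1 / real p)))"
  proof (rule prod_mono)
    fix p assume p: "p \<in> ?S"
    have rp: "real p \<ge> 2" using p prime_real_ge_2 primes_upto_prime by blast
    have lnp: "ln (real p) \<le> 2 ^ i"
    proof -
      have "real p \<le> exp (2 ^ i)" using p by (simp add: primes_upto_def)
      then have "ln (real p) \<le> ln (exp (2 ^ i))" using rp by (intro ln_mono) auto
      then show ?thesis by simp
    qed
    \<comment> \<open>t <= 3/4 because \<alpha> <= 1/2 and p >= 2, hence 1 / (1 - t) <= 1 + 4 * t.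
      Together with t <= 3/p this gives 12/p, and summing over p yields the exponent 12 * 3 * (i +
      1).\<close>
    define t where "t = real p powr (\<alpha> - 1)"
    have "t \<le> 2 powr (\<alpha> - 1)" unfolding t_def using rp \<alpha> by (intro powr_mono2') auto
    also have "\<dots> \<le> 2 powr (- (1/2))" using \<alpha> by (intro powr_mono) auto
    also have "\<dots> = 1 / sqrt 2"
      unfolding powr_minus by (subst powr_half_sqrt) (auto simp: divide_inverse)
    also have "\<dots> \<le> 3 / 4"
    proof -
      have "4 / 3 \<le> sqrt 2" by (rule real_le_rsqrt) (simp add: power2_eq_square)
      then show ?thesis by (simp add: field_simps)
    qed
    finally have t: "0 \<le> t" "t \<le> 3 / 4" by (auto simp: t_def)
    have "real p powr \<alpha> = exp (\<alpha> * ln (real p))" using rp by (simp add: powr_def)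
    also have "\<dots> \<le> exp 1" using lnp by (simp add: \<alpha>_def)
    also have "\<dots> \<le> 3" by (rule exp_le)
    finally have "t \<le> 3 * (1 / real p)" using rp by (simp add: t_def powr_diff divide_right_mono)
    have "1 / (1 - t) - 1 \<le> 4 * t"
    proof -
      have "1 / (1 - t) - 1 = t * (1 / (1 - t))" using t by (simp add: field_simps)
      also have "\<dots> \<le> t * 4" using t by (intro mult_left_mono) (auto simp: field_simps)
      finally show ?thesis by simp
    qed
    then have "1 / (1 - t) \<le> 1 + 12 * (1 / real p)" using \<open>t \<le> 3 * (1 / real p)\<close> by linarith
    also have "\<dots> \<le> exp (12 * (1 / real p))" by (rule exp_ge_add_one_self)
    finally show "0 \<le> 1 / (1 - real p powr (\<alpha> - 1)) \<and> 1 / (1 - real p powr (\<alpha> - 1)) \<le> exp (12 * (1 / real p))"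
      using t by (simp add: t_def)
  qed
  also have "\<dots> = exp (12 * (\<Sum>p\<in>?S. 1 / real p))" by (simp add: exp_sum[symmetric] sum_distrib_left)
  also have "\<dots> \<le> exp (36 * (real i + 1))" using primes_upto_exp_sum_le[of i] by simp
  finally have prod: "(\<Prod>p\<in>?S. 1 / (1 - real p powr (\<alpha> - 1))) \<le> exp (36 * (real i + 1))" .
  have "(\<integral>\<^sup>+\<omega>. ennreal ((norm (euler_prod ?S \<omega> - Psi ?S z \<omega>))\<^sup>2) \<partial>M)
      \<le> ennreal (z powr (-\<alpha>) * (\<Prod>p\<in>?S. 1 / (1 - real p powr (\<alpha> - 1))))"
    using \<alpha> assms by (intro tail_rankin) (auto simp: primes_upto_def)
  also have "\<dots> \<le> ennreal (z powr (-\<alpha>) * exp (36 * (real i + 1)))"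
    using prod by (intro ennreal_leI mult_left_mono) auto
  also have "z powr (-\<alpha>) * exp (36 * (real i + 1)) = exp (36 * (real i + 1) - ln z / 2 ^ i)"
    using assms(2) by (simp add: powr_def \<alpha>_def exp_add[symmetric] exp_diff exp_minus divide_inverse mult.commute)
  finally show ?thesis .
qed

text \<open>Beyond U0 the sums are close in mean square to the complete Euler product E, and |Psi|^2
  <= 2 |E|^2 + 2 |E - Psi|^2 where |E|^2 <= B on G. Lengthening the range thus costs at most twice
  the added length times B + \<tau>.\<close>

lemma mean_sq_step:
  assumes S: "S \<subseteq> {p. prime p}" and G: "G \<in> sets (prime_sigma S)" and U: "U0 \<le> U" and "B \<ge> 0" "\<tau> \<ge> 0"
    and B: "\<And>\<omega>. \<omega> \<in> G \<Longrightarrow> (norm (euler_prod S \<omega>))\<^sup>2 \<le> B"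
    and \<tau>: "\<And>u. u > U0 \<Longrightarrow> (\<integral>\<^sup>+\<omega>. ennreal ((norm (euler_prod S \<omega> - Psi S (exp u) \<omega>))\<^sup>2) \<partial>M) \<le> ennreal \<tau>"
  shows "(\<integral>\<^sup>+\<omega>. mean_sq S U \<omega> * indicator G \<omega> \<partial>M)
    \<le> (\<integral>\<^sup>+\<omega>. mean_sq S U0 \<omega> * indicator G \<omega> \<partial>M) + ennreal (2 * (U - U0) * (B + \<tau>))"
proof -
  have GM: "G \<in> events" using G sets_prime_sigma_subset[OF S] by auto
  have [measurable]: "Psi S w \<in> borel_measurable M" "euler_prod S \<in> borel_measurable M" for w
    using Psi_M[OF S] euler_prod_M[OF S] by auto
  define \<phi> where "\<phi> u = (\<integral>\<^sup>+\<omega>. ennreal ((norm (Psi S (exp u) \<omega>))\<^sup>2) * indicator G \<omega> \<partial>M)" for u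
  have \<phi>: "\<phi> u \<le> ennreal (2 * (B + \<tau>))" if u: "u > U0" for u
  proof -
    have "\<phi> u \<le> (\<integral>\<^sup>+\<omega>. ennreal (2 * B) + ennreal 2 * ennreal ((norm (euler_prod S \<omega> - Psi S (exp u) \<omega>))\<^sup>2) \<partial>M)"
      unfolding \<phi>_def
    proof (rule nn_integral_mono)
      fix \<omega>
      show "ennreal ((norm (Psi S (exp u) \<omega>))\<^sup>2) * indicator G \<omega>
        \<le> ennreal (2 * B) + ennreal 2 * ennreal ((norm (euler_prod S \<omega> - Psi S (exp u) \<omega>))\<^sup>2)"
      proof (cases "\<omega> \<in> G")
        case True
        let ?a = "norm (euler_prod S \<omega>)" and ?b = "norm (euler_prod S \<omega> - Psi S (exp u) \<omega>)"
        have "norm (Psi S (exp u) \<omega>) \<le> ?a + ?b"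
          using norm_triangle_ineq4[of "euler_prod S \<omega>" "euler_prod S \<omega> - Psi S (exp u) \<omega>"] by simp
        then have "(norm (Psi S (exp u) \<omega>))\<^sup>2 \<le> (?a + ?b)\<^sup>2" by (intro power_mono) auto
        also have "\<dots> \<le> 2 * ?a\<^sup>2 + 2 * ?b\<^sup>2"
          using zero_le_power2[of "?a - ?b"] by (simp add: power2_sum power2_diff)
        also have "\<dots> \<le> 2 * B + 2 * ?b\<^sup>2" using B[OF True] by simp
        finally have "ennreal ((norm (Psi S (exp u) \<omega>))\<^sup>2) \<le> ennreal (2 * B + 2 * ?b\<^sup>2)" by (rule ennreal_leI)
        also have "\<dots> = ennreal (2 * B) + ennreal 2 * ennreal (?b\<^sup>2)"
          using \<open>B \<ge> 0\<close> by (subst ennreal_plus) (auto simp: ennreal_mult)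
        finally show ?thesis using True by simp
      qed simp
    qed
    also have "\<dots> = ennreal (2 * B) + ennreal 2 * (\<integral>\<^sup>+\<omega>. ennreal ((norm (euler_prod S \<omega> - Psi S (exp u) \<omega>))\<^sup>2) \<partial>M)"
      by (subst nn_integral_add, measurable, subst nn_integral_cmult, measurable) (simp add: emeasure_space_1)
    also have "\<dots> \<le> ennreal (2 * B) + ennreal 2 * ennreal \<tau>"
      using \<tau>[OF u] by (intro add_left_mono mult_left_mono) auto
    also have "ennreal 2 * ennreal \<tau> = ennreal (2 * \<tau>)"
      using \<open>\<tau> \<ge> 0\<close> by (intro ennreal_mult[symmetric]) auto
    also have "ennreal (2 * B) + ennreal (2 * \<tau>) = ennreal (2 * B + 2 * \<tau>)"
      using \<open>B \<ge> 0\<close> \<open>\<tau> \<ge> 0\<close> by (intro ennreal_plus[symmetric]) auto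
    also have "2 * B + 2 * \<tau> = 2 * (B + \<tau>)" by simp
    finally show ?thesis .
  qed
  have meas: "(\<lambda>u. \<phi> u * indicator {..V} u) \<in> borel_measurable lborel" for V
    unfolding \<phi>_def by (rule mean_sq_Fubini(2)[OF S GM])
  have "(\<integral>\<^sup>+\<omega>. mean_sq S U \<omega> * indicator G \<omega> \<partial>M) = (\<integral>\<^sup>+u. \<phi> u * indicator {..U} u \<partial>lborel)"
    unfolding \<phi>_def by (rule mean_sq_Fubini(1)[OF S GM])
  also have "\<dots> \<le> (\<integral>\<^sup>+u. \<phi> u * indicator {..U0} u + ennreal (2 * (B + \<tau>)) * indicator {U0<..U} u \<partial>lborel)"
    using \<phi> by (intro nn_integral_mono) (auto simp: indicator_def)
  also have "\<dots> = (\<integral>\<^sup>+u. \<phi> u * indicator {..U0} u \<partial>lborel) + ennreal (2 * (B + \<tau>)) * ennreal (U - U0)"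
    using meas[of U0] U by (subst nn_integral_add) (auto simp: nn_integral_cmult_indicator)
  also have "(\<integral>\<^sup>+u. \<phi> u * indicator {..U0} u \<partial>lborel) = (\<integral>\<^sup>+\<omega>. mean_sq S U0 \<omega> * indicator G \<omega> \<partial>M)"
    unfolding \<phi>_def by (rule mean_sq_Fubini(1)[OF S GM, symmetric])
  also have "ennreal (2 * (B + \<tau>)) * ennreal (U - U0) = ennreal (2 * (U - U0) * (B + \<tau>))"
    using U \<open>B \<ge> 0\<close> \<open>\<tau> \<ge> 0\<close> by (subst ennreal_mult[symmetric]) (auto simp: algebra_simps)
  finally show ?thesis .
qed

text \<open>The bound is imposed at every dyadic level up to i. The events then decrease with i, and
  each one is decided by the primes of its own level, which allows an induction that conditions
  level by level.\<close>

definition euler_bounded :: "nat \<Rightarrow> real \<Rightarrow> 'a set" where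
  "euler_bounded i B = {\<omega> \<in> space M. \<forall>j\<le>i. (norm (euler_prod (primes_upto (exp (2 ^ j))) \<omega>))\<^sup>2 \<le> B}"

lemma primes_upto_subset: "primes_upto y \<subseteq> {p. prime p}"
  by (auto simp: primes_upto_def)

lemma euler_bounded_prime_sigma: "euler_bounded i B \<in> sets (prime_sigma (primes_upto (exp (2 ^ i))))"
proof -
  let ?F = "prime_sigma (primes_upto (exp (2 ^ i)))"
  have meas: "euler_prod (primes_upto (exp (2 ^ j))) \<in> borel_measurable ?F" if "j \<le> i" for j
  proof (rule prime_sigma_mono[OF _ euler_prod_prime_sigma])
    have "(2::real) ^ j \<le> 2 ^ i" using that by (intro power_increasing) auto
    then show "primes_upto (exp (2 ^ j)) \<subseteq> primes_upto (exp (2 ^ i))"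
      by (intro primes_upto_mono) simp
  qed
  have "euler_bounded i B = {\<omega> \<in> space ?F. \<forall>j\<in>{..i}. (norm (euler_prod (primes_upto (exp (2 ^ j))) \<omega>))\<^sup>2 \<le> B}"
    by (auto simp: euler_bounded_def)
  also have "\<dots> \<in> sets ?F"
  proof (rule sets.sets_Collect_finite_All')
    fix j assume "j \<in> {..i}"
    then have [measurable]: "euler_prod (primes_upto (exp (2 ^ j))) \<in> borel_measurable ?F" using meas by simp
    show "{\<omega> \<in> space ?F. (norm (euler_prod (primes_upto (exp (2 ^ j))) \<omega>))\<^sup>2 \<le> B} \<in> sets ?F" by measurable
  qed auto
  finally show ?thesis .
qed

text \<open>Raising i by one doubles the range and admits the primes up to exp (2^(i+1)). The new
  half of the range lies far enough beyond these primes to be controlled by the Euler product, at a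
  cost of order 2^(i+h) * (B + 1); on the old half the new primes are averaged out. Since the
  Mertens product at level i + 1 is at least 2^(i+1), each level adds at most 2^(h+1) * (B + 1)
  relative to it, so the loss is only linear in i.\<close>

lemma mean_square_bound:
  assumes "B \<ge> 0" "h \<ge> 1" "36 * (real K + 2) \<le> 2 ^ (h - 1)" "i \<le> K"
  shows "(\<integral>\<^sup>+\<omega>. mean_sq (primes_upto (exp (2 ^ i))) (2 ^ (i + h)) \<omega> * indicator (euler_bounded i B) \<omega> \<partial>M)
    \<le> ennreal (mertens (primes_upto (exp (2 ^ i))) * (2 ^ h + real i * (2 ^ (h + 1) * (B + 1))))"
  using assms(4)
proof (induction i)
  case 0
  have "(\<integral>\<^sup>+\<omega>. mean_sq (primes_upto (exp (2 ^ 0))) (2 ^ (0 + h)) \<omega> * indicator (euler_bounded 0 B) \<omega> \<partial>M)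
     \<le> (\<integral>\<^sup>+\<omega>. mean_sq (primes_upto (exp (2 ^ 0))) (2 ^ (0 + h)) \<omega> \<partial>M)"
    by (intro nn_integral_mono) (auto simp: indicator_def)
  also have "\<dots> \<le> ennreal (2 ^ (0 + h) * mertens (primes_upto (exp (2 ^ 0))))"
    by (intro mean_sq_expectation_le primes_upto_subset) auto
  finally show ?case by (simp add: mult.commute)
next
  case (Suc i)
  let ?S = "\<lambda>i. primes_upto (exp (2 ^ i))"
  define T where "T = ?S (Suc i) - ?S i"
  have sub: "?S i \<subseteq> ?S (Suc i)" by (intro primes_upto_mono) simp
  then have un: "?S (Suc i) = ?S i \<union> T" and disj: "?S i \<inter> T = {}" by (auto simp: T_def)
  have T: "T \<subseteq> {p. prime p}" "finite T" using primes_upto_subset by (auto simp: T_def)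
  have mm: "mertens (?S (Suc i)) = mertens (?S i) * mertens T"
    unfolding un using disj T by (intro mertens_Un) auto
  have m0: "mertens T \<ge> 1" "mertens (?S i) \<ge> 1" "mertens (?S (Suc i)) \<ge> 1"
    using T mertens_ge_1[of T] by (auto intro!: mertens_ge_1[OF finite_primes_upto] intro: primes_upto_prime)
  have mge: "2 ^ Suc i \<le> mertens (?S (Suc i))"
    using mertens_primes_upto_ge[of "exp (2 ^ Suc i)"] by simp
  define V :: real where "V = 2 ^ h + real i * (2 ^ (h + 1) * (B + 1))"
  have V0: "V \<ge> 0" using assms by (simp add: V_def)
  have hpow: "(2::real) ^ h = 2 * 2 ^ (h - 1)" using assms(2) by (cases h) auto
  have "(\<integral>\<^sup>+\<omega>. mean_sq (?S (Suc i)) (2 ^ (Suc i + h)) \<omega> * indicator (euler_bounded (Suc i) B) \<omega> \<partial>M)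
    \<le> (\<integral>\<^sup>+\<omega>. mean_sq (?S (Suc i)) (2 ^ (i + h)) \<omega> * indicator (euler_bounded (Suc i) B) \<omega> \<partial>M)
       + ennreal (2 * (2 ^ (Suc i + h) - 2 ^ (i + h)) * (B + 1))"
  proof (rule mean_sq_step[OF primes_upto_subset euler_bounded_prime_sigma])
    fix u :: real assume u: "u > 2 ^ (i + h)"
    \<comment> \<open>The lower bound on 2^(h-1) makes the exponent in \<open>tail_bound\<close>
      nonpositive on the new half of the range, so the distance to the Euler product is at most 1 in
      mean square.\<close>
    have "u / 2 ^ Suc i > 2 ^ (i + h) / 2 ^ Suc i" using u by (intro divide_strict_right_mono) auto
    also have "(2::real) ^ (i + h) / 2 ^ Suc i = 2 ^ (h - 1)" using hpow by (simp add: power_add)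
    finally have *: "36 * (real (Suc i) + 1) - u / 2 ^ Suc i \<le> 0"
      using assms(3) Suc.prems by simp
    have "0 < u" using u by (meson less_trans zero_less_power zero_less_numeral)
    then have "(\<integral>\<^sup>+\<omega>. ennreal ((norm (euler_prod (?S (Suc i)) \<omega> - Psi (?S (Suc i)) (exp u) \<omega>))\<^sup>2) \<partial>M)
        \<le> ennreal (exp (36 * (real (Suc i) + 1) - ln (exp u) / 2 ^ Suc i))"
      by (intro tail_bound) auto
    also have "\<dots> \<le> ennreal 1" using * by (intro ennreal_leI) simp
    finally show "(\<integral>\<^sup>+\<omega>. ennreal ((norm (euler_prod (?S (Suc i)) \<omega> - Psi (?S (Suc i)) (exp u) \<omega>))\<^sup>2) \<partial>M) \<le> ennreal 1" .
  qed (use assms in \<open>auto simp: euler_bounded_def\<close>)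
  \<comment> \<open>On the old range the event is enlarged to the one of level i. That event does
    not involve the primes of T, so the supermartingale inequality applies.\<close>
  also have "(\<integral>\<^sup>+\<omega>. mean_sq (?S (Suc i)) (2 ^ (i + h)) \<omega> * indicator (euler_bounded (Suc i) B) \<omega> \<partial>M)
     \<le> (\<integral>\<^sup>+\<omega>. mean_sq (?S i \<union> T) (2 ^ (i + h)) \<omega> * indicator (euler_bounded i B) \<omega> \<partial>M)"
    unfolding un by (intro nn_integral_mono mult_left_mono) (auto simp: indicator_def euler_bounded_def)
  also have "\<dots> \<le> ennreal (mertens T) * (\<integral>\<^sup>+\<omega>. mean_sq (?S i) (2 ^ (i + h)) \<omega> * indicator (euler_bounded i B) \<omega> \<partial>M)"
    by (rule mean_sq_supermartingale[OF primes_upto_subset T(1) disj T(2) euler_bounded_prime_sigma])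
  also have "\<dots> \<le> ennreal (mertens T) * ennreal (mertens (?S i) * V)"
    unfolding V_def using Suc by (intro mult_left_mono) auto
  also have "\<dots> + ennreal (2 * (2 ^ (Suc i + h) - 2 ^ (i + h)) * (B + 1))
     = ennreal (mertens T * (mertens (?S i) * V) + 2 * (2 ^ (Suc i + h) - 2 ^ (i + h)) * (B + 1))"
    using m0 V0 assms by (simp add: ennreal_mult[symmetric] ennreal_plus[symmetric] del: ennreal_plus)
  also have "\<dots> \<le> ennreal (mertens (?S (Suc i)) * (2 ^ h + real (Suc i) * (2 ^ (h + 1) * (B + 1))))"
  proof (rule ennreal_leI)
    have "2 * (2 ^ (Suc i + h) - 2 ^ (i + h)) * (B + 1) = 2 ^ Suc i * (2 ^ h * (B + 1))"
      by (simp add: power_add)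
    also have "\<dots> \<le> mertens (?S (Suc i)) * (2 ^ (h + 1) * (B + 1))"
      using mge assms m0(3) by (intro mult_mono) auto
    finally show "mertens T * (mertens (?S i) * V) + 2 * (2 ^ (Suc i + h) - 2 ^ (i + h)) * (B + 1)
      \<le> mertens (?S (Suc i)) * (2 ^ h + real (Suc i) * (2 ^ (h + 1) * (B + 1)))"
      unfolding mm V_def by (simp add: algebra_simps)
  qed
  finally show ?case by (simp add: add_right_mono)
qed

end

lemma nn_integral_lincomb2:
  assumes "f \<in> borel_measurable N" "h \<in> borel_measurable N"
  shows "(\<integral>\<^sup>+u. c * f u + d * h u \<partial>N) = c * (\<integral>\<^sup>+u. f u \<partial>N) + d * (\<integral>\<^sup>+u. h u \<partial>N)"
  using assms by (simp add: nn_integral_add nn_integral_cmult)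

lemma nn_integral_sum_cmult:
  assumes "\<And>i. i \<in> I \<Longrightarrow> f i \<in> borel_measurable N"
  shows "(\<integral>\<^sup>+u. (\<Sum>i\<in>I. c i * f i u) \<partial>N) = (\<Sum>i\<in>I. c i * (\<integral>\<^sup>+u. f i u \<partial>N))"
proof -
  have "(\<integral>\<^sup>+u. (\<Sum>i\<in>I. c i * f i u) \<partial>N) = (\<Sum>i\<in>I. \<integral>\<^sup>+u. c i * f i u \<partial>N)"
    using assms by (intro nn_integral_sum) measurable
  also have "\<dots> = (\<Sum>i\<in>I. c i * (\<integral>\<^sup>+u. f i u \<partial>N))"
    using assms by (intro sum.cong refl nn_integral_cmult)
  finally show ?thesis .
qed

subsection \<open>Increments over a block of primes\<close>

text \<open>One round of revealing: S is known and T is new. The lower bound on y makes 2^s / p at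
  most 1/2 on T, and the bound on the reciprocal sum keeps the Euler product of these weights at
  most e. The window condition with \<open>\<kappa>\<^sub>0\<close> is the place where the sieve
  enters.\<close>

locale prime_block = unimodular_primes M g
  for M :: "'a measure" and g :: "nat \<Rightarrow> 'a \<Rightarrow> complex" +
  fixes S T :: "nat set" and y \<delta> \<kappa>\<^sub>0 :: real and s :: nat
  assumes S_primes: "S \<subseteq> {p. prime p}" and T_primes: "T \<subseteq> {p. prime p}"
    and disjoint: "S \<inter> T = {}" and finite_T: "finite T"
    and T_gt: "\<And>p. p \<in> T \<Longrightarrow> y < real p" and y_ge: "2 * 2 ^ s \<le> y" and \<delta>_pos: "0 < \<delta>"
    and window: "\<And>w. w \<ge> y \<Longrightarrow> (\<Sum>p | prime p \<and> w < real p \<and> real p \<le> w * exp \<delta>. 1 / real p) \<le> \<kappa>\<^sub>0"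
    and T_sum: "(\<Sum>p\<in>T. 1 / real p) \<le> 1 / (2 * 2 ^ s)"
begin

text \<open>A majorant of d(b)^s / b, the weight produced by the moment inequality. It is completely
  multiplicative, so sums over smooth b are Euler products and a single prime factor splits off
  cleanly.\<close>

definition wt :: "nat \<Rightarrow> real" where
  "wt b = 2 ^ (s * Omega_count b) / real b"

lemma wt_nonneg [simp]: "wt b \<ge> 0" by (simp add: wt_def)

lemma wt_mult: "a > 0 \<Longrightarrow> b > 0 \<Longrightarrow> wt (a * b) = wt a * wt b"
  by (simp add: wt_def Omega_count_mult distrib_left power_add)

lemma wt_sum_le:
  assumes "finite B" "B \<subseteq> smooth_over T"
  shows "(\<Sum>b\<in>B. wt b) \<le> exp 1"
proof -
  have wtp: "wt p = 2 ^ s / real p" if "p \<in> T" for p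
    using that T_primes by (auto simp: wt_def Omega_count_prime)
  have half: "wt p \<le> 1 / 2" if "p \<in> T" for p
  proof -
    have "2 * 2 ^ s \<le> real p" using T_gt[OF that] y_ge by linarith
    then show ?thesis using wtp[OF that] T_primes that prime_gt_0_nat[of p] by (auto simp: field_simps)
  qed
  have hs: "(wt has_sum (\<Prod>p\<in>T. 1 / (1 - wt p))) (smooth_over T)"
  proof (rule euler_product)
    show "norm (wt p) < 1" if "p \<in> T" for p using half[OF that] by simp
    show "wt (m * n) = wt m * wt n" if "m > 0" "n > 0" for m n using that by (rule wt_mult)
  qed (use finite_T T_primes in \<open>auto simp: wt_def Omega_count_1\<close>)
  have "(\<Sum>b\<in>B. wt b) \<le> (\<Prod>p\<in>T. 1 / (1 - wt p))"
    by (rule finite_sum_le_has_sum[OF hs]) (use assms in auto)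
  also have "\<dots> \<le> (\<Prod>p\<in>T. exp (2 * 2 ^ s * (1 / real p)))"
  proof (rule prod_mono)
    fix p assume p: "p \<in> T"
    have "- ln (1 - wt p) \<le> 2 * wt p" using half[OF p] by (intro minus_ln_one_minus_le) auto
    then have "exp (- ln (1 - wt p)) \<le> exp (2 * wt p)" by (simp only: exp_le_cancel_iff)
    moreover have "exp (- ln (1 - wt p)) = 1 / (1 - wt p)"
    proof -
      have "exp (ln (1 - wt p)) = 1 - wt p" using half[OF p] by (intro exp_ln) simp
      then show ?thesis unfolding exp_minus by (simp only: inverse_eq_divide)
    qed
    moreover have "2 * wt p = 2 * 2 ^ s * (1 / real p)" using wtp[OF p] by simp
    moreover have "0 \<le> 1 / (1 - wt p)" using half[OF p] by simp
    ultimately show "0 \<le> 1 / (1 - wt p) \<and> 1 / (1 - wt p) \<le> exp (2 * 2 ^ s * (1 / real p))"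
      by (simp only: simp_thms)
  qed
  also have "\<dots> = exp (2 * 2 ^ s * (\<Sum>p\<in>T. 1 / real p))"
    using finite_T by (simp add: exp_sum[symmetric] sum_distrib_left)
  also have "\<dots> \<le> exp 1"
    using mult_left_mono[OF T_sum, of "2 * 2 ^ s"] by simp
  finally show ?thesis .
qed

lemma \<kappa>\<^sub>0_nonneg: "\<kappa>\<^sub>0 \<ge> 0"
  using window[of y] by (smt (verit) divide_nonneg_nonneg of_nat_0_le_iff order_refl sum_nonneg)

definition \<kappa> :: real where "\<kappa> = 2 ^ s * exp 1 * \<kappa>\<^sub>0"

lemma \<kappa>_nonneg: "\<kappa> \<ge> 0" using \<kappa>\<^sub>0_nonneg by (simp add: \<kappa>_def)

text \<open>Split off one prime factor of \<open>b\<close> and sum over it first.\<close>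
lemma wt_window_le:
  assumes "c > 0"
  shows "(\<Sum>b | b \<in> smooth_over T \<and> 1 < b \<and> c < real b \<and> real b \<le> c * exp \<delta>. wt b) \<le> \<kappa>"
proof -
  let ?A = "{b. b \<in> smooth_over T \<and> 1 < b \<and> c < real b \<and> real b \<le> c * exp \<delta>}"
  let ?B = "{b. b \<in> smooth_over T \<and> real b \<le> c * exp \<delta>}"
  define P where "P b = {p. p \<in> T \<and> c / real b < real p \<and> real p \<le> c / real b * exp \<delta>}" for b
  have finA: "finite ?A" by (rule finite_subset[OF _ finite_nat_le_real[of "c * exp \<delta>"]]) auto
  have finB: "finite ?B" by (rule finite_subset[OF _ finite_nat_le_real[of "c * exp \<delta>"]]) auto
  have finP: "finite (P b)" for b by (rule finite_subset[OF _ finite_T]) (auto simp: P_def)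
  have "(\<Sum>b\<in>?A. wt b) \<le> (\<Sum>(b, p)\<in>(SIGMA b:?B. P b). wt b * (2 ^ s * (1 / real p)))"
  proof (rule sum_le_included[where i = "\<lambda>(b, p). b * p"])
    show "\<forall>x\<in>?A. \<exists>z\<in>(SIGMA b:?B. P b). (case z of (b, p) \<Rightarrow> b * p) = x \<and> wt x \<le> (case z of (b, p) \<Rightarrow> wt b * (2 ^ s * (1 / real p)))"
    proof
      fix x assume x: "x \<in> ?A"
      then have "x \<noteq> 1" by auto
      then obtain p where p: "prime p" "p dvd x" using prime_factor_nat by blast
      then obtain b where b: "x = b * p" by (metis dvdE mult.commute)
      have "b \<noteq> 0" using x unfolding b by (intro notI) simp
      then have pos: "b > 0" "p > 0" using p(1) prime_gt_0_nat by auto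
      have bT: "b \<in> smooth_over T" "p \<in> smooth_over T" using x b smooth_over_multD[of b p T] by simp_all
      then have pT: "p \<in> T" using p by (auto simp: smooth_over_def prime_prime_factors)
      have "b \<le> x" using b pos by simp
      then have "real b \<le> c * exp \<delta>" using x by (auto intro: order_trans[of _ "real x"])
      moreover have "p \<in> P b" using x pT pos by (auto simp: P_def b field_simps)
      moreover have "wt x = wt b * (2 ^ s * (1 / real p))"
        using pos p by (simp add: b wt_mult) (simp add: wt_def Omega_count_prime)
      ultimately show "\<exists>z\<in>(SIGMA b:?B. P b). (case z of (b, p) \<Rightarrow> b * p) = x \<and> wt x \<le> (case z of (b, p) \<Rightarrow> wt b * (2 ^ s * (1 / real p)))"
        using bT b by (intro bexI[of _ "(b, p)"]) auto
    qed
  qed (use finA finB finP in \<open>auto intro!: mult_nonneg_nonneg\<close>)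
  also have "\<dots> = (\<Sum>b\<in>?B. \<Sum>p\<in>P b. wt b * (2 ^ s * (1 / real p)))"
    using finB finP by (subst sum.Sigma) auto
  also have "\<dots> = (\<Sum>b\<in>?B. wt b * (2 ^ s * (\<Sum>p\<in>P b. 1 / real p)))"
    by (simp add: sum_distrib_left)
  also have "\<dots> \<le> (\<Sum>b\<in>?B. wt b * (2 ^ s * \<kappa>\<^sub>0))"
  proof (intro sum_mono mult_left_mono)
    fix b assume "b \<in> ?B"
    \<comment> \<open>All primes of T exceed y, so a window that begins below y can be moved up to
      begin at y without losing any of them; there the sieve bound is available.\<close>
    define w where "w = max (c / real b) y"
    have "(\<Sum>p\<in>P b. 1 / real p) \<le> (\<Sum>p | prime p \<and> w < real p \<and> real p \<le> w * exp \<delta>. 1 / real p)"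
    proof (rule sum_mono2)
      show "finite {p. prime p \<and> w < real p \<and> real p \<le> w * exp \<delta>}"
        by (rule finite_subset[OF _ finite_nat_le_real[of "w * exp \<delta>"]]) auto
      have "c / real b * exp \<delta> \<le> w * exp \<delta>" by (intro mult_right_mono) (auto simp: w_def)
      then show "P b \<subseteq> {p. prime p \<and> w < real p \<and> real p \<le> w * exp \<delta>}"
        using T_primes T_gt by (auto simp: P_def w_def)
    qed auto
    also have "\<dots> \<le> \<kappa>\<^sub>0" by (rule window) (simp add: w_def)
    finally show "(\<Sum>p\<in>P b. 1 / real p) \<le> \<kappa>\<^sub>0" .
  qed auto
  also have "\<dots> = (\<Sum>b\<in>?B. wt b) * (2 ^ s * \<kappa>\<^sub>0)" by (simp add: sum_distrib_right)
  also have "\<dots> \<le> exp 1 * (2 ^ s * \<kappa>\<^sub>0)"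
    using \<kappa>\<^sub>0_nonneg finB by (intro mult_right_mono wt_sum_le) auto
  finally show ?thesis by (simp add: \<kappa>_def mult_ac)
qed

section \<open>The increment over one block and its weighted conditional variance\<close>

definition block_smooth :: "real \<Rightarrow> nat set" where
  "block_smooth x = {b. b \<in> smooth_over T \<and> 1 < b \<and> real b \<le> x}"

lemma finite_block_smooth [simp]: "finite (block_smooth x)"
  unfolding block_smooth_def by (rule finite_subset[OF _ finite_nat_le_real[of x]]) auto

text \<open>Dominates the base of the power on the right-hand side of \<open>dyadic_moment\<close>
  for the increment over the block. It is determined by S, so its size can be tested before T is
  revealed.\<close>

definition W :: "real \<Rightarrow> 'a \<Rightarrow> real" where
  "W x \<omega> = (\<Sum>b\<in>block_smooth x. wt b * (norm (Psi S (x / real b) \<omega>))\<^sup>2)"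

lemma Psi_block:
  assumes "x \<ge> 1"
  shows "Psi (S \<union> T) x \<omega> = Psi S x \<omega> + (\<Sum>b\<in>block_smooth x. Psi S (x / real b) \<omega> / of_real (sqrt (real b)) * F b \<omega>)"
proof -
  have "{b. b \<in> smooth_over T \<and> real b \<le> x} = insert 1 (block_smooth x)"
    using assms by (auto simp: block_smooth_def dest: smooth_over_pos)
  moreover have "1 \<notin> block_smooth x" by (simp add: block_smooth_def)
  ultimately show ?thesis unfolding Psi_Un[OF disjoint] by (simp add: mult_ac)
qed

lemma W_prime_sigma: "W x \<in> borel_measurable (prime_sigma S)"
proof -
  have [measurable]: "Psi S z \<in> borel_measurable (prime_sigma S)" for z using bounded_adapted_Psi[of S z] by (simp add: bounded_adapted_def)
  show ?thesis unfolding W_def[abs_def] by measurable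
qed

text \<open>The event W x <= w is decided by S and is moved into the coefficients: where it fails
  they vanish, and where it holds the weighted sum in \<open>dyadic_moment\<close> is at most
  w.\<close>

lemma block_moment:
  assumes "x \<ge> 1" "w \<ge> 0"
  shows "(\<integral>\<^sup>+\<omega>. ennreal (norm (Psi (S \<union> T) x \<omega> - Psi S x \<omega>) ^ (2 ^ Suc s)) * indicator {\<omega>\<in>space M. W x \<omega> \<le> w} \<omega> \<partial>M)
    \<le> ennreal (w ^ (2 ^ s))"
proof -
  define G where "G = {\<omega>\<in>space M. W x \<omega> \<le> w}"
  have G: "G \<in> sets (prime_sigma S)"
  proof -
    have "{\<omega>\<in>space (prime_sigma S). W x \<omega> \<le> w} \<in> sets (prime_sigma S)" using W_prime_sigma[of x] by measurable
    then show ?thesis by (simp add: G_def)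
  qed
  have admG: "bounded_adapted S (indicator G)"
    by (rule bounded_adaptedI[where C = 1]) (use G in \<open>auto simp: indicator_def\<close>)
  define A where "A b \<omega> = Psi S (x / real b) \<omega> / of_real (sqrt (real b)) * indicator G \<omega>" for b \<omega>
  have admA: "bounded_adapted S (A b)" for b
    unfolding A_def divide_inverse by (intro bounded_adapted_mult bounded_adapted_Psi bounded_adapted_const admG)
  have ST: "S \<union> T \<subseteq> {p. prime p}" using S_primes T_primes by auto
  have sub: "block_smooth x \<subseteq> smooth_over T" by (auto simp: block_smooth_def)
  have "bounded_adapted (S \<union> T) (\<lambda>\<omega>. \<Sum>b\<in>block_smooth x. A b \<omega> * F b \<omega>)"
  proof (intro bounded_adapted_sum bounded_adapted_mult)
    fix b assume b: "b \<in> block_smooth x"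
    show "bounded_adapted (S \<union> T) (A b)" by (rule bounded_adapted_mono[OF _ admA]) auto
    show "bounded_adapted (S \<union> T) (F b)" by (rule bounded_adapted_mono[of T]) (use b sub in \<open>auto intro: bounded_adapted_F\<close>)
  qed
  then have int: "integrable M (\<lambda>\<omega>. norm (\<Sum>b\<in>block_smooth x. A b \<omega> * F b \<omega>) ^ (2 ^ Suc s))"
    by (rule bounded_adapted_norm_power_integrable[OF ST])
  have "(\<integral>\<^sup>+\<omega>. ennreal (norm (Psi (S \<union> T) x \<omega> - Psi S x \<omega>) ^ (2 ^ Suc s)) * indicator G \<omega> \<partial>M)
     = (\<integral>\<^sup>+\<omega>. ennreal (norm (\<Sum>b\<in>block_smooth x. A b \<omega> * F b \<omega>) ^ (2 ^ Suc s)) \<partial>M)"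
    unfolding Psi_block[OF assms(1)] A_def by (intro nn_integral_cong) (auto simp: indicator_def)
  also have "\<dots> = ennreal (expectation (\<lambda>\<omega>. norm (\<Sum>b\<in>block_smooth x. A b \<omega> * F b \<omega>) ^ (2 ^ Suc s)))"
    using int by (intro nn_integral_eq_integral) auto
  also have "\<dots> \<le> ennreal (w ^ (2 ^ s))"
  proof (rule ennreal_leI)
    have "expectation (\<lambda>\<omega>. norm (\<Sum>b\<in>block_smooth x. A b \<omega> * F b \<omega>) ^ (2 ^ Suc s))
      \<le> expectation (\<lambda>\<omega>. (\<Sum>b\<in>block_smooth x. (norm (A b \<omega>))\<^sup>2 * real (divisor_count b) ^ s) ^ (2 ^ s))"
      by (rule dyadic_moment[OF admA S_primes T_primes disjoint finite_block_smooth sub])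
    also have "\<dots> \<le> expectation (\<lambda>_. w ^ (2 ^ s))"
    proof (rule Bochner_Integration.integral_mono')
      fix \<omega>
      have "(\<Sum>b\<in>block_smooth x. (norm (A b \<omega>))\<^sup>2 * real (divisor_count b) ^ s) \<le> w"
      proof (cases "\<omega> \<in> G")
        case True
        have "(\<Sum>b\<in>block_smooth x. (norm (A b \<omega>))\<^sup>2 * real (divisor_count b) ^ s) \<le> W x \<omega>"
          unfolding W_def
        proof (rule sum_mono)
          fix b assume "b \<in> block_smooth x"
          then have b: "b > 0" by (auto simp: block_smooth_def)
          have "real (divisor_count b) \<le> 2 ^ Omega_count b"
            using divisor_count_le_Omega[OF b] by (metis of_nat_le_iff of_nat_numeral of_nat_power)
          then have "real (divisor_count b) ^ s \<le> (2 ^ Omega_count b) ^ s" by (intro power_mono) auto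
          also have "(2 ^ Omega_count b) ^ s = (2::real) ^ (s * Omega_count b)"
            by (simp add: power_mult[symmetric] mult.commute)
          finally have d: "real (divisor_count b) ^ s \<le> 2 ^ (s * Omega_count b)" .
          have n: "(norm (A b \<omega>))\<^sup>2 = (norm (Psi S (x / real b) \<omega>))\<^sup>2 / real b"
            using True b by (simp add: A_def norm_divide power_divide)
          have "(norm (A b \<omega>))\<^sup>2 * real (divisor_count b) ^ s \<le> (norm (A b \<omega>))\<^sup>2 * 2 ^ (s * Omega_count b)"
            using d by (intro mult_left_mono) auto
          also have "\<dots> = wt b * (norm (Psi S (x / real b) \<omega>))\<^sup>2" by (simp add: n wt_def)
          finally show "(norm (A b \<omega>))\<^sup>2 * real (divisor_count b) ^ s \<le> wt b * (norm (Psi S (x / real b) \<omega>))\<^sup>2" .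
        qed
        also have "\<dots> \<le> w" using True by (simp add: G_def)
        finally show ?thesis .
      qed (use assms in \<open>simp add: A_def\<close>)
      then show "(\<Sum>b\<in>block_smooth x. (norm (A b \<omega>))\<^sup>2 * real (divisor_count b) ^ s) ^ (2 ^ s) \<le> w ^ (2 ^ s)"
        by (intro power_mono sum_nonneg) auto
    qed (use assms in auto)
    also have "\<dots> = w ^ (2 ^ s)" by (simp add: prob_space)
    finally show "expectation (\<lambda>\<omega>. norm (\<Sum>b\<in>block_smooth x. A b \<omega> * F b \<omega>) ^ (2 ^ Suc s)) \<le> w ^ (2 ^ s)" .
  qed
  finally show ?thesis by (simp add: G_def)
qed

text \<open>The loss in replacing |Psi S (x / b)|^2 by its average over a logarithmic window of
  length \<delta>. It is kept as a random variable because only its mean is estimated, through the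
  second moment of short increments.\<close>

definition Err :: "real \<Rightarrow> 'a \<Rightarrow> ennreal" where
  "Err x \<omega> = (\<Sum>b\<in>block_smooth x. ennreal (2 * wt b / \<delta>) *
     (\<integral>\<^sup>+u. ennreal ((norm (Psi S (exp u) \<omega> - Psi S (x / real b) \<omega>))\<^sup>2) * indicator {ln (x / real b)<..ln (x / real b) + \<delta>} u \<partial>lborel))"

lemma measurable_window_diff:
  "(\<lambda>z. ennreal ((norm (Psi S (exp (snd z)) (fst z) - Psi S v (fst z)))\<^sup>2) * indicator {a<..c} (snd z)) \<in> borel_measurable (M \<Otimes>\<^sub>M lborel)"
proof -
  have [measurable]: "Psi S v \<in> borel_measurable M" by (rule Psi_M[OF S_primes])
  have [measurable]: "(\<lambda>z. Psi S (exp (snd z)) (fst z) * indicator {..c} (snd z)) \<in> borel_measurable (M \<Otimes>\<^sub>M lborel)"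
    by (rule measurable_Psi_exp_trunc[OF S_primes])
  have "(\<lambda>z. ennreal ((norm (Psi S (exp (snd z)) (fst z) - Psi S v (fst z)))\<^sup>2) * indicator {a<..c} (snd z))
     = (\<lambda>z. ennreal ((norm (Psi S (exp (snd z)) (fst z) * indicator {..c} (snd z) - Psi S v (fst z)))\<^sup>2) * indicator {a<..c} (snd z))"
    by (auto simp: indicator_def)
  moreover have "\<dots> \<in> borel_measurable (M \<Otimes>\<^sub>M lborel)" by measurable
  ultimately show ?thesis by simp
qed

lemma Err_M: "Err x \<in> borel_measurable M"
proof -
  have "(\<lambda>\<omega>. \<integral>\<^sup>+u. ennreal ((norm (Psi S (exp u) \<omega> - Psi S v \<omega>))\<^sup>2) * indicator {a<..c} u \<partial>lborel) \<in> borel_measurable M" for v a c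
    using lborel.borel_measurable_nn_integral[of "\<lambda>\<omega> u. ennreal ((norm (Psi S (exp u) \<omega> - Psi S v \<omega>))\<^sup>2) * indicator {a<..c} u" M]
      measurable_window_diff[of v a c] by (simp add: case_prod_unfold)
  then show ?thesis unfolding Err_def[abs_def] by (intro borel_measurable_sum borel_measurable_times_ennreal) auto
qed

text \<open>Average \<open>|Psi S (x / b)|\<^sup>2\<close> over a window of length \<open>\<delta>\<close>; after interchanging sum and integral
  the sieve bound for the weights in short windows applies.\<close>
lemma W_le:
  assumes "x \<ge> 1"
  shows "ennreal (W x \<omega>) \<le> ennreal (2 * \<kappa> / \<delta>) * mean_sq S (ln x + \<delta>) \<omega> + Err x \<omega>"
proof -
  let ?J = "\<lambda>b. {ln (x / real b)<..ln (x / real b) + \<delta>}"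
  define f where "f u = ennreal ((norm (Psi S (exp u) \<omega>))\<^sup>2)" for u
  have step_meas: "(\<lambda>u. Psi S (exp u) \<omega> * indicator {..V} u) \<in> borel_measurable lborel" for V
  proof -
    have "(\<lambda>u. Psi S (exp u) \<omega> * indicator {..V} u)
       = (\<lambda>u. (\<Sum>n | n \<in> smooth_over S \<and> real n \<le> exp V. (if ln (real n) \<le> u then F n \<omega> / of_real (sqrt (real n)) else 0)) * indicator {..V} u)"
    proof
      fix u show "Psi S (exp u) \<omega> * indicator {..V} u = (\<Sum>n | n \<in> smooth_over S \<and> real n \<le> exp V. (if ln (real n) \<le> u then F n \<omega> / of_real (sqrt (real n)) else 0)) * indicator {..V} u"
        by (cases "u \<le> V") (simp_all add: Psi_exp_trunc[of _ V])
    qed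
    moreover have "\<dots> \<in> borel_measurable lborel" by measurable
    ultimately show ?thesis by (simp only:)
  qed
  note step_meas [measurable]
  have fmeas: "(\<lambda>u. f u * indicator {a<..c} u) \<in> borel_measurable lborel" for a c
  proof -
    have "(\<lambda>u. f u * indicator {a<..c} u) = (\<lambda>u. ennreal ((norm (Psi S (exp u) \<omega> * indicator {..c} u))\<^sup>2) * indicator {a<..c} u)"
      by (auto simp: f_def indicator_def)
    moreover have "\<dots> \<in> borel_measurable lborel" by measurable
    ultimately show ?thesis by (simp only:)
  qed
  have dmeas: "(\<lambda>u. ennreal ((norm (Psi S (exp u) \<omega> - v))\<^sup>2) * indicator {a<..c} u) \<in> borel_measurable lborel" for v a c
  proof -
    have "(\<lambda>u. ennreal ((norm (Psi S (exp u) \<omega> - v))\<^sup>2) * indicator {a<..c} u) = (\<lambda>u. ennreal ((norm (Psi S (exp u) \<omega> * indicator {..c} u - v))\<^sup>2) * indicator {a<..c} u)"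
      by (auto simp: indicator_def)
    moreover have "\<dots> \<in> borel_measurable lborel" by measurable
    ultimately show ?thesis by (simp only:)
  qed
  have single: "ennreal (wt b * (norm (Psi S (x / real b) \<omega>))\<^sup>2)
     \<le> ennreal (2 * wt b / \<delta>) * (\<integral>\<^sup>+u. f u * indicator (?J b) u \<partial>lborel)
      + ennreal (2 * wt b / \<delta>) * (\<integral>\<^sup>+u. ennreal ((norm (Psi S (exp u) \<omega> - Psi S (x / real b) \<omega>))\<^sup>2) * indicator (?J b) u \<partial>lborel)" for b
  proof -
    let ?c = "Psi S (x / real b) \<omega>"
    have "ennreal ((norm ?c)\<^sup>2) * ennreal \<delta> = (\<integral>\<^sup>+u. ennreal ((norm ?c)\<^sup>2) * indicator (?J b) u \<partial>lborel)"
      using \<delta>_pos by (simp add: nn_integral_cmult_indicator)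
    also have "\<dots> \<le> (\<integral>\<^sup>+u. ennreal 2 * (f u * indicator (?J b) u) + ennreal 2 * (ennreal ((norm (Psi S (exp u) \<omega> - ?c))\<^sup>2) * indicator (?J b) u) \<partial>lborel)"
    proof (rule nn_integral_mono)
      fix u :: real
      let ?a = "norm (Psi S (exp u) \<omega>)" and ?b = "norm (Psi S (exp u) \<omega> - ?c)"
      have "norm ?c \<le> ?a + ?b" using norm_triangle_ineq4[of "Psi S (exp u) \<omega>" "Psi S (exp u) \<omega> - ?c"] by simp
      then have "(norm ?c)\<^sup>2 \<le> (?a + ?b)\<^sup>2" by (intro power_mono) auto
      also have "\<dots> \<le> 2 * ?a\<^sup>2 + 2 * ?b\<^sup>2"
        using zero_le_power2[of "?a - ?b"] by (simp add: power2_sum power2_diff)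
      finally have "ennreal ((norm ?c)\<^sup>2) \<le> ennreal (2 * ?a\<^sup>2 + 2 * ?b\<^sup>2)" by (rule ennreal_leI)
      also have "\<dots> = ennreal 2 * ennreal (?a\<^sup>2) + ennreal 2 * ennreal (?b\<^sup>2)"
        by (subst ennreal_plus) (auto simp: ennreal_mult)
      finally show "ennreal ((norm ?c)\<^sup>2) * indicator (?J b) u \<le> ennreal 2 * (f u * indicator (?J b) u) + ennreal 2 * (ennreal (?b\<^sup>2) * indicator (?J b) u)"
        by (auto simp: indicator_def f_def)
    qed
    also have "\<dots> = ennreal 2 * (\<integral>\<^sup>+u. f u * indicator (?J b) u \<partial>lborel) + ennreal 2 * (\<integral>\<^sup>+u. ennreal ((norm (Psi S (exp u) \<omega> - ?c))\<^sup>2) * indicator (?J b) u \<partial>lborel)"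
      by (rule nn_integral_lincomb2[OF fmeas dmeas])
    finally have inner: "ennreal ((norm ?c)\<^sup>2) * ennreal \<delta> \<le> ennreal 2 * (\<integral>\<^sup>+u. f u * indicator (?J b) u \<partial>lborel) + ennreal 2 * (\<integral>\<^sup>+u. ennreal ((norm (Psi S (exp u) \<omega> - ?c))\<^sup>2) * indicator (?J b) u \<partial>lborel)" .
    have two: "ennreal (wt b / \<delta>) * ennreal 2 = ennreal (2 * wt b / \<delta>)"
      using \<delta>_pos by (subst ennreal_mult[symmetric]) auto
    have "ennreal (wt b * (norm ?c)\<^sup>2) = ennreal (wt b / \<delta> * ((norm ?c)\<^sup>2 * \<delta>))"
      using \<delta>_pos by simp
    also have "\<dots> = ennreal (wt b / \<delta>) * (ennreal ((norm ?c)\<^sup>2) * ennreal \<delta>)"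
      using \<delta>_pos by (simp only: ennreal_mult zero_le_power2 wt_nonneg less_imp_le divide_nonneg_pos mult_nonneg_nonneg)
    also have "\<dots> \<le> ennreal (wt b / \<delta>) * (ennreal 2 * (\<integral>\<^sup>+u. f u * indicator (?J b) u \<partial>lborel) + ennreal 2 * (\<integral>\<^sup>+u. ennreal ((norm (Psi S (exp u) \<omega> - ?c))\<^sup>2) * indicator (?J b) u \<partial>lborel))"
      by (rule mult_left_mono[OF inner]) simp
    finally show ?thesis unfolding distrib_left mult.assoc[symmetric] two .
  qed
  have "ennreal (W x \<omega>) = (\<Sum>b\<in>block_smooth x. ennreal (wt b * (norm (Psi S (x / real b) \<omega>))\<^sup>2))"
    unfolding W_def by (intro sum_ennreal[symmetric]) auto
  also have "\<dots> \<le> (\<Sum>b\<in>block_smooth x. ennreal (2 * wt b / \<delta>) * (\<integral>\<^sup>+u. f u * indicator (?J b) u \<partial>lborel)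
      + ennreal (2 * wt b / \<delta>) * (\<integral>\<^sup>+u. ennreal ((norm (Psi S (exp u) \<omega> - Psi S (x / real b) \<omega>))\<^sup>2) * indicator (?J b) u \<partial>lborel))"
    by (intro sum_mono single)
  also have "\<dots> = (\<Sum>b\<in>block_smooth x. ennreal (2 * wt b / \<delta>) * (\<integral>\<^sup>+u. f u * indicator (?J b) u \<partial>lborel)) + Err x \<omega>"
    by (simp add: sum.distrib Err_def)
  also have "(\<Sum>b\<in>block_smooth x. ennreal (2 * wt b / \<delta>) * (\<integral>\<^sup>+u. f u * indicator (?J b) u \<partial>lborel))
     = (\<integral>\<^sup>+u. (\<Sum>b\<in>block_smooth x. ennreal (2 * wt b / \<delta>) * (f u * indicator (?J b) u)) \<partial>lborel)"
    by (rule nn_integral_sum_cmult[symmetric]) (rule fmeas)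
  also have "\<dots> \<le> (\<integral>\<^sup>+u. ennreal (2 * \<kappa> / \<delta>) * (f u * indicator {..ln x + \<delta>} u) \<partial>lborel)"
  proof (rule nn_integral_mono)
    fix u :: real
    \<comment> \<open>For fixed u the windows that contain u belong to those b that lie in one short
      window at x * exp (-u). Their total weight is at most \<kappa>, uniformly in u.\<close>
    have mem: "u \<in> ?J b \<longleftrightarrow> x * exp (- u) < real b \<and> real b \<le> x * exp (- u) * exp \<delta>" if "b \<in> block_smooth x" for b
    proof -
      have b: "real b > 0" "x > 0" using that assms by (auto simp: block_smooth_def)
      have "ln (x / real b) < u \<longleftrightarrow> x / real b < exp u"
        using b by (metis divide_pos_pos exp_less_cancel_iff exp_ln)
      moreover have "u \<le> ln (x / real b) + \<delta> \<longleftrightarrow> exp u \<le> x / real b * exp \<delta>"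
        using b by (metis divide_pos_pos exp_add exp_le_cancel_iff exp_ln)
      ultimately show ?thesis using b by (simp add: exp_minus field_simps)
    qed
    show "(\<Sum>b\<in>block_smooth x. ennreal (2 * wt b / \<delta>) * (f u * indicator (?J b) u)) \<le> ennreal (2 * \<kappa> / \<delta>) * (f u * indicator {..ln x + \<delta>} u)"
    proof (cases "u \<le> ln x + \<delta>")
      case True
      let ?A = "{b. b \<in> smooth_over T \<and> 1 < b \<and> x * exp (- u) < real b \<and> real b \<le> x * exp (- u) * exp \<delta>}"
      have finA: "finite ?A" by (rule finite_subset[OF _ finite_nat_le_real[of "x * exp (- u) * exp \<delta>"]]) auto
      have "(\<Sum>b\<in>block_smooth x. ennreal (2 * wt b / \<delta>) * (f u * indicator (?J b) u))
         = (\<Sum>b\<in>block_smooth x. ennreal (2 * wt b / \<delta> * indicator (?J b) u)) * f u"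
        unfolding sum_distrib_right by (intro sum.cong refl) (auto simp: indicator_def)
      also have "(\<Sum>b\<in>block_smooth x. ennreal (2 * wt b / \<delta> * indicator (?J b) u)) = ennreal (\<Sum>b\<in>block_smooth x. 2 * wt b / \<delta> * indicator (?J b) u)"
        using \<delta>_pos by (intro sum_ennreal) auto
      also have "\<dots> \<le> ennreal (2 * \<kappa> / \<delta>)"
      proof (rule ennreal_leI)
        have "(\<Sum>b\<in>block_smooth x. 2 * wt b / \<delta> * indicator (?J b) u) = (\<Sum>b\<in>block_smooth x. if b \<in> ?A then 2 * wt b / \<delta> else 0)"
          using mem by (intro sum.cong refl) (auto simp: indicator_def block_smooth_def)
        also have "\<dots> = (\<Sum>b\<in>block_smooth x \<inter> ?A. 2 * wt b / \<delta>)" by (subst sum.inter_restrict) auto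
        also have "\<dots> \<le> (\<Sum>b\<in>?A. 2 * wt b / \<delta>)" using finA \<delta>_pos by (intro sum_mono2) auto
        also have "\<dots> = 2 / \<delta> * (\<Sum>b\<in>?A. wt b)" by (simp add: sum_distrib_left)
        also have "\<dots> \<le> 2 / \<delta> * \<kappa>"
          using assms \<delta>_pos by (intro mult_left_mono wt_window_le) auto
        finally show "(\<Sum>b\<in>block_smooth x. 2 * wt b / \<delta> * indicator (?J b) u) \<le> 2 * \<kappa> / \<delta>" by simp
      qed
      finally show ?thesis using True by (simp add: mult_right_mono)
    next
      case False
      have "u \<notin> ?J b" if "b \<in> block_smooth x" for b
      proof -
        have b: "real b \<ge> 1" using that by (auto simp: block_smooth_def)
        then have "x / real b \<le> x" using assms by (simp add: divide_le_eq mult_left_le)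
        then have "ln (x / real b) \<le> ln x" using b assms by (intro ln_mono) auto
        then show ?thesis using False by auto
      qed
      then have "(\<Sum>b\<in>block_smooth x. ennreal (2 * wt b / \<delta>) * (f u * indicator (?J b) u)) = 0"
        by (intro sum.neutral) auto
      then show ?thesis by (simp only: zero_le)
    qed
  qed
  also have "\<dots> = ennreal (2 * \<kappa> / \<delta>) * mean_sq S (ln x + \<delta>) \<omega>"
  proof -
    have "(\<lambda>u. f u * indicator {..ln x + \<delta>} u) = (\<lambda>u. ennreal ((norm (Psi S (exp u) \<omega> * indicator {..ln x + \<delta>} u))\<^sup>2))"
      by (auto simp: f_def indicator_def)
    moreover have "\<dots> \<in> borel_measurable lborel" by measurable
    ultimately have "(\<lambda>u. f u * indicator {..ln x + \<delta>} u) \<in> borel_measurable lborel" by (simp only:)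
    then show ?thesis unfolding mean_sq_def f_def[symmetric] by (rule nn_integral_cmult)
  qed
  finally show ?thesis by (simp add: add_right_mono)
qed

text \<open>The pairs with x/b < n <= exp \<delta> * x/b are counted the other way round: for fixed
  n, b lies in a window at x/n. Each n contributes \<kappa> / n, and the harmonic sum up to x * exp
  \<delta> gives 1 + ln x + \<delta>. The mean error thus inherits the smallness of \<kappa>, which
  is proportional to \<delta> in the application.\<close>

lemma Err_expectation:
  assumes "x \<ge> 1"
  shows "(\<integral>\<^sup>+\<omega>. Err x \<omega> \<partial>M) \<le> ennreal (2 * \<kappa> * (1 + ln x + \<delta>))"
proof -
  interpret pair_sigma_finite M lborel ..
  let ?J = "\<lambda>b. {ln (x / real b)<..ln (x / real b) + \<delta>}"
  let ?N = "\<lambda>b. {n. n \<in> smooth_over S \<and> x / real b < real n \<and> real n \<le> x / real b * exp \<delta>}"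
  define f where "f b z = ennreal ((norm (Psi S (exp (snd z)) (fst z) - Psi S (x / real b) (fst z)))\<^sup>2) * indicator (?J b) (snd z)" for b z
  have fm: "f b \<in> borel_measurable (M \<Otimes>\<^sub>M lborel)" for b
    unfolding f_def[abs_def] by (rule measurable_window_diff)
  have finN: "finite (?N b)" for b
    by (rule finite_subset[OF _ finite_nat_le_real[of "x / real b * exp \<delta>"]]) auto
  have in_meas: "(\<lambda>\<omega>. \<integral>\<^sup>+u. f b (\<omega>, u) \<partial>lborel) \<in> borel_measurable M" for b
    using fm[of b] by measurable
  have dbl: "(\<integral>\<^sup>+\<omega>. (\<integral>\<^sup>+u. f b (\<omega>, u) \<partial>lborel) \<partial>M) \<le> ennreal ((\<Sum>n\<in>?N b. 1 / real n) * \<delta>)" if b: "b \<in> block_smooth x" for b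
  proof -
    have b0: "real b > 0" "x > 0" using that assms by (auto simp: block_smooth_def)
    have xb: "0 < x / real b" using b0 by simp
    have "(\<integral>\<^sup>+\<omega>. (\<integral>\<^sup>+u. f b (\<omega>, u) \<partial>lborel) \<partial>M) = (\<integral>\<^sup>+u. (\<integral>\<^sup>+\<omega>. f b (\<omega>, u) \<partial>M) \<partial>lborel)"
      by (rule Fubini'[symmetric]) (use fm in \<open>simp add: case_prod_unfold\<close>)
    also have "\<dots> \<le> (\<integral>\<^sup>+u. ennreal (\<Sum>n\<in>?N b. 1 / real n) * indicator (?J b) u \<partial>lborel)"
    proof (rule nn_integral_mono)
      fix u :: real
      show "(\<integral>\<^sup>+\<omega>. f b (\<omega>, u) \<partial>M) \<le> ennreal (\<Sum>n\<in>?N b. 1 / real n) * indicator (?J b) u"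
      proof (cases "u \<in> ?J b")
        case True
        have lo: "x / real b \<le> exp u"
        proof -
          have "exp (ln (x / real b)) \<le> exp u" using True by simp
          then show ?thesis using xb by simp
        qed
        have hi: "exp u \<le> x / real b * exp \<delta>"
        proof -
          have "exp u \<le> exp (ln (x / real b) + \<delta>)" using True by simp
          then show ?thesis using xb by (simp add: exp_add)
        qed
        have "(\<integral>\<^sup>+\<omega>. f b (\<omega>, u) \<partial>M) = (\<integral>\<^sup>+\<omega>. ennreal ((norm (Psi S (exp u) \<omega> - Psi S (x / real b) \<omega>))\<^sup>2) \<partial>M)"
          using True by (simp add: f_def)
        also have "\<dots> = ennreal (\<Sum>n | n \<in> smooth_over S \<and> x / real b < real n \<and> real n \<le> exp u. 1 / real n)"
          by (rule Psi_diff_second_moment[OF S_primes lo])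
        also have "\<dots> \<le> ennreal (\<Sum>n\<in>?N b. 1 / real n)"
          using finN hi by (intro ennreal_leI sum_mono2) auto
        finally show ?thesis using True by simp
      qed (simp add: f_def)
    qed
    also have "\<dots> = ennreal (\<Sum>n\<in>?N b. 1 / real n) * ennreal \<delta>"
      using \<delta>_pos by (simp add: nn_integral_cmult_indicator)
    also have "\<dots> = ennreal ((\<Sum>n\<in>?N b. 1 / real n) * \<delta>)"
      using \<delta>_pos by (intro ennreal_mult[symmetric] sum_nonneg) auto
    finally show ?thesis .
  qed
  have "(\<integral>\<^sup>+\<omega>. Err x \<omega> \<partial>M) = (\<integral>\<^sup>+\<omega>. (\<Sum>b\<in>block_smooth x. ennreal (2 * wt b / \<delta>) * (\<integral>\<^sup>+u. f b (\<omega>, u) \<partial>lborel)) \<partial>M)"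
    by (simp add: Err_def f_def)
  also have "\<dots> = (\<Sum>b\<in>block_smooth x. ennreal (2 * wt b / \<delta>) * (\<integral>\<^sup>+\<omega>. (\<integral>\<^sup>+u. f b (\<omega>, u) \<partial>lborel) \<partial>M))"
    by (rule nn_integral_sum_cmult) (rule in_meas)
  also have "\<dots> \<le> (\<Sum>b\<in>block_smooth x. ennreal (2 * wt b / \<delta>) * ennreal ((\<Sum>n\<in>?N b. 1 / real n) * \<delta>))"
    by (intro sum_mono mult_left_mono dbl) auto
  also have "\<dots> = (\<Sum>b\<in>block_smooth x. ennreal (2 * (wt b * (\<Sum>n\<in>?N b. 1 / real n))))"
    using \<delta>_pos by (intro sum.cong refl) (subst ennreal_mult[symmetric], auto intro!: sum_nonneg mult_nonneg_nonneg)
  also have "\<dots> = ennreal (\<Sum>b\<in>block_smooth x. 2 * (wt b * (\<Sum>n\<in>?N b. 1 / real n)))"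
    by (intro sum_ennreal mult_nonneg_nonneg sum_nonneg) auto
  also have "\<dots> \<le> ennreal (2 * \<kappa> * (1 + ln x + \<delta>))"
  proof (rule ennreal_leI)
    let ?M = "{n. 0 < n \<and> real n \<le> x * exp \<delta>}"
    let ?A = "\<lambda>n. {b. b \<in> smooth_over T \<and> 1 < b \<and> x / real n < real b \<and> real b \<le> x / real n * exp \<delta>}"
    have finM: "finite ?M" by (rule finite_subset[OF _ finite_nat_le_real[of "x * exp \<delta>"]]) auto
    have finA: "finite (?A n)" for n by (rule finite_subset[OF _ finite_nat_le_real[of "x / real n * exp \<delta>"]]) auto
    have "(\<Sum>b\<in>block_smooth x. wt b * (\<Sum>n\<in>?N b. 1 / real n)) = (\<Sum>(b, n)\<in>(SIGMA b:block_smooth x. ?N b). wt b * (1 / real n))"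
      using finN by (simp add: sum_distrib_left sum.Sigma)
    also have "\<dots> \<le> (\<Sum>(n, b)\<in>(SIGMA n:?M. ?A n). wt b * (1 / real n))"
    proof (rule sum_le_included[where i = "\<lambda>(n, b). (b, n)"])
      show "\<forall>z\<in>(SIGMA b:block_smooth x. ?N b). \<exists>v\<in>(SIGMA n:?M. ?A n). (case v of (n, b) \<Rightarrow> (b, n)) = z \<and>
         (case z of (b, n) \<Rightarrow> wt b * (1 / real n)) \<le> (case v of (n, b) \<Rightarrow> wt b * (1 / real n))"
      proof clarify
        fix b n assume b: "b \<in> block_smooth x" and n: "n \<in> smooth_over S" "x / real b < real n" "real n \<le> x / real b * exp \<delta>"
        have pos: "real b \<ge> 1" "real n \<ge> 1" "x > 0" using b n smooth_over_pos[of n S] assms by (auto simp: block_smooth_def)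
        have "x / real b * exp \<delta> \<le> x * exp \<delta>"
          using pos by (intro mult_right_mono) (auto simp: divide_le_eq mult_left_le)
        then have "n \<in> ?M" using n pos by auto
        moreover have "b \<in> ?A n" using b n pos by (auto simp: block_smooth_def field_simps)
        ultimately show "\<exists>v\<in>(SIGMA n:?M. ?A n). (case v of (n, b) \<Rightarrow> (b, n)) = (b, n) \<and>
           wt b * (1 / real n) \<le> (case v of (n, b) \<Rightarrow> wt b * (1 / real n))"
          by (intro bexI[of _ "(n, b)"]) auto
      qed
    qed (use finN finM finA in \<open>auto intro!: mult_nonneg_nonneg\<close>)
    also have "\<dots> = (\<Sum>n\<in>?M. \<Sum>b\<in>?A n. wt b * (1 / real n))" using finM finA by (subst sum.Sigma) auto
    also have "\<dots> = (\<Sum>n\<in>?M. (\<Sum>b\<in>?A n. wt b) * (1 / real n))" by (simp only: sum_distrib_right)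
    also have "\<dots> \<le> (\<Sum>n\<in>?M. \<kappa> * (1 / real n))"
      using assms by (intro sum_mono mult_right_mono wt_window_le) auto
    also have "\<dots> = \<kappa> * (\<Sum>n\<in>?M. 1 / real n)" by (simp add: sum_distrib_left)
    also have "\<dots> \<le> \<kappa> * (1 + ln (x * exp \<delta>))"
    proof (intro mult_left_mono sum_inverse_le \<kappa>_nonneg)
      show "1 \<le> x * exp \<delta>" using assms \<delta>_pos mult_mono[of 1 x 1 "exp \<delta>"] by simp
    qed
    also have "ln (x * exp \<delta>) = ln x + \<delta>" using assms by (simp add: ln_mult)
    finally have "(\<Sum>b\<in>block_smooth x. wt b * (\<Sum>n\<in>?N b. 1 / real n)) \<le> \<kappa> * (1 + (ln x + \<delta>))" .
    then show "(\<Sum>b\<in>block_smooth x. 2 * (wt b * (\<Sum>n\<in>?N b. 1 / real n))) \<le> 2 * \<kappa> * (1 + ln x + \<delta>)"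
      by (simp add: sum_distrib_left[symmetric] add.assoc)
  qed
  finally show ?thesis .
qed

end

subsection \<open>The law of the iterated logarithm for the Euler products\<close>

lemma exp_le_quadratic: "exp u \<le> 1 + u + u\<^sup>2 / 2 * exp \<bar>u\<bar>" for u :: real
proof -
  obtain t where t: "\<bar>t\<bar> \<le> \<bar>u\<bar>" "exp u = (\<Sum>m<2. u ^ m / fact m) + exp t / fact 2 * u ^ 2"
    using Maclaurin_exp_le[of u 2] by blast
  have "exp u = 1 + u + u\<^sup>2 / 2 * exp t" using t(2) by (simp add: numeral_2_eq_2)
  also have "\<dots> \<le> 1 + u + u\<^sup>2 / 2 * exp \<bar>u\<bar>" using t(1) by (intro add_left_mono mult_left_mono) auto
  finally show ?thesis .
qed

text \<open>v = -w - w^2/2 is the beginning of the series of log (1 - w), and 1 + v + v^2/2 = 1 - w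
  + w^3/2 + w^4/8. With the Taylor remainder, |exp v - (1 - w)| <= 16 |w|^3, and |1 - w| >= 1/4
  turns 16 into 64. Working with exp v avoids branches of the logarithm.\<close>

lemma norm_inverse_one_minus_le:
  fixes w :: complex
  assumes "norm w \<le> 3 / 4"
  shows "norm (1 / (1 - w)) \<le> exp (Re w + Re (w\<^sup>2) / 2 + 64 * norm w ^ 3)"
proof -
  define v where "v = - w - w\<^sup>2 / 2"
  let ?r = "norm w"
  have r: "0 \<le> ?r" "?r \<le> 3 / 4" using assms by auto
  have "norm v \<le> norm w + norm (w\<^sup>2 / 2)" unfolding v_def using norm_triangle_ineq4[of "-w" "w\<^sup>2 / 2"] by simp
  also have "\<dots> = ?r + ?r * ?r / 2" by (simp add: norm_power norm_divide norm_mult power2_eq_square)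
  also have "\<dots> \<le> ?r + 3 / 4 * ?r / 2" using r by (intro add_left_mono divide_right_mono mult_right_mono) auto
  finally have v: "norm v \<le> 3 / 2 * ?r" using r by linarith
  have "norm (exp v - (\<Sum>k\<le>2. v ^ k / fact k)) \<le> exp \<bar>Re v\<bar> * (norm v ^ Suc 2) / fact 2"
    by (rule Taylor_exp)
  also have "\<dots> \<le> 9 * (3 / 2 * ?r) ^ 3 / 2"
  proof -
    have "\<bar>Re v\<bar> \<le> 2" using abs_Re_le_cmod[of v] v r by linarith
    then have "exp \<bar>Re v\<bar> \<le> exp 2" by simp
    also have "exp 2 = exp 1 * exp (1::real)" by (simp add: exp_add[symmetric])
    also have "\<dots> \<le> 3 * 3" using exp_le by (intro mult_mono) auto
    finally have "exp \<bar>Re v\<bar> \<le> 9" by simp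
    moreover have "norm v ^ 3 \<le> (3 / 2 * ?r) ^ 3" using v by (intro power_mono) auto
    ultimately have "exp \<bar>Re v\<bar> * norm v ^ 3 \<le> 9 * (3 / 2 * ?r) ^ 3" by (intro mult_mono) auto
    moreover have "Suc 2 = 3" "fact 2 = (2::real)" by simp_all
    ultimately show ?thesis by (simp only: divide_right_mono zero_le_numeral)
  qed
  finally have T: "norm (exp v - (\<Sum>k\<le>2. v ^ k / fact k)) \<le> 243 / 16 * ?r ^ 3" by (simp add: power_mult_distrib power_divide)
  have "(\<Sum>k\<le>2. v ^ k / fact k) = 1 + v + v\<^sup>2 / 2" by (simp add: numeral_2_eq_2)
  also have "\<dots> = (1 - w) + (w ^ 3 / 2 + w ^ 4 / 8)"
    by (simp add: v_def power2_eq_square power3_eq_cube power4_eq_xxxx field_simps)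
  finally have "exp v - (1 - w) = (exp v - (\<Sum>k\<le>2. v ^ k / fact k)) + (w ^ 3 / 2 + w ^ 4 / 8)" by simp
  then have "norm (exp v - (1 - w)) \<le> norm (exp v - (\<Sum>k\<le>2. v ^ k / fact k)) + norm (w ^ 3 / 2 + w ^ 4 / 8)"
    by (metis norm_triangle_ineq)
  also have "norm (w ^ 3 / 2 + w ^ 4 / 8) \<le> ?r ^ 3 / 2 + ?r ^ 4 / 8"
    using norm_triangle_ineq[of "w ^ 3 / 2" "w ^ 4 / 8"] by (simp add: norm_power norm_divide)
  also have "?r ^ 4 \<le> ?r ^ 3" using r by (intro power_decreasing) auto
  finally have D: "norm (exp v - (1 - w)) \<le> 16 * ?r ^ 3"
    using T zero_le_power[OF r(1), of 3] by linarith
  have n1: "1 / 4 \<le> norm (1 - w)" using norm_triangle_ineq2[of 1 w] r by simp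
  have "norm (exp v / (1 - w)) = norm (1 + (exp v - (1 - w)) / (1 - w))"
  proof -
    have "1 - w \<noteq> 0" using n1 by (metis norm_zero not_one_le_zero zero_less_divide_1_iff zero_less_numeral linorder_not_le)
    then have "1 + (exp v - (1 - w)) / (1 - w) = exp v / (1 - w)" by (simp add: diff_divide_distrib)
    then show ?thesis by (simp only:)
  qed
  also have "\<dots> \<le> 1 + norm (exp v - (1 - w)) / norm (1 - w)"
    using norm_triangle_ineq[of 1 "(exp v - (1 - w)) / (1 - w)"] by (simp add: norm_divide)
  also have "norm (exp v - (1 - w)) / norm (1 - w) \<le> 16 * ?r ^ 3 / (1 / 4)"
    using D n1 r by (intro frac_le) auto
  also have "1 + 16 * ?r ^ 3 / (1 / 4) \<le> exp (64 * ?r ^ 3)" using exp_ge_add_one_self[of "64 * ?r ^ 3"] by simp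
  finally have E: "norm (exp v / (1 - w)) \<le> exp (64 * ?r ^ 3)" by simp
  have "norm (1 / (1 - w)) = norm (exp v / (1 - w)) * exp (- Re v)"
    by (simp add: norm_divide norm_exp_eq_Re exp_minus field_simps)
  also have "\<dots> \<le> exp (64 * ?r ^ 3) * exp (- Re v)" using E by (intro mult_right_mono) auto
  also have "\<dots> = exp (Re w + Re (w\<^sup>2) / 2 + 64 * ?r ^ 3)" by (simp add: v_def exp_add[symmetric] add_ac)
  finally show ?thesis .
qed

context unimodular_primes
begin

section \<open>Exponential moments and a maximal inequality over growing sets of primes\<close>

lemma real_indep:
  fixes U V :: "'a \<Rightarrow> real"
  assumes "bounded_adapted S (\<lambda>\<omega>. of_real (U \<omega>))" "bounded_adapted T (\<lambda>\<omega>. of_real (V \<omega>))" "S \<inter> T = {}" "S \<subseteq> {p. prime p}" "T \<subseteq> {p. prime p}"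
  shows "expectation (\<lambda>\<omega>. U \<omega> * V \<omega>) = expectation U * expectation V"
proof -
  have "complex_of_real (expectation (\<lambda>\<omega>. U \<omega> * V \<omega>)) = expectation (\<lambda>\<omega>. complex_of_real (U \<omega>) * complex_of_real (V \<omega>))"
    by (simp add: integral_complex_of_real[symmetric] del: integral_complex_of_real)
  also have "\<dots> = of_real (expectation U) * of_real (expectation V)"
    using bounded_adapted_indep[OF assms] by simp
  finally show ?thesis by (metis of_real_eq_iff of_real_mult)
qed

lemma bounded_adapted_of_real:
  assumes "U \<in> borel_measurable (prime_sigma S)" "\<And>\<omega>. \<bar>U \<omega>\<bar> \<le> C"
  shows "bounded_adapted S (\<lambda>\<omega>. complex_of_real (U \<omega>))"
  by (rule bounded_adaptedI[where C = C]) (use assms in \<open>auto intro: borel_measurable_of_real\<close>)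

text \<open>j = 1 with a p = 1 / sqrt p is the main term in the logarithm of the Euler product, and
  j = 2 with a p = 1 / (2 * p) is its second-order term; both go through the same exponential
  moments.\<close>

definition Rsum :: "nat \<Rightarrow> (nat \<Rightarrow> real) \<Rightarrow> nat set \<Rightarrow> 'a \<Rightarrow> real" where
  "Rsum j a S \<omega> = (\<Sum>p\<in>S. a p * Re (g p \<omega> ^ j))"

lemma Rsum_prime_sigma [measurable]: "Rsum j a S \<in> borel_measurable (prime_sigma S)"
  unfolding Rsum_def[abs_def]
proof (rule borel_measurable_sum)
  fix p assume "p \<in> S"
  then have [measurable]: "g p \<in> borel_measurable (prime_sigma S)" by (rule g_prime_sigma)
  show "(\<lambda>\<omega>. a p * Re (g p \<omega> ^ j)) \<in> borel_measurable (prime_sigma S)" by measurable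
qed

lemma Rsum_bound: "\<bar>Rsum j a S \<omega>\<bar> \<le> (\<Sum>p\<in>S. \<bar>a p\<bar>)"
proof -
  have "\<bar>Rsum j a S \<omega>\<bar> \<le> (\<Sum>p\<in>S. \<bar>a p * Re (g p \<omega> ^ j)\<bar>)" unfolding Rsum_def by (rule sum_abs)
  also have "\<dots> \<le> (\<Sum>p\<in>S. \<bar>a p\<bar>)"
  proof (rule sum_mono)
    fix p
    have "\<bar>Re (g p \<omega> ^ j)\<bar> \<le> 1" using abs_Re_le_cmod[of "g p \<omega> ^ j"] by (simp add: norm_power)
    then show "\<bar>a p * Re (g p \<omega> ^ j)\<bar> \<le> \<bar>a p\<bar>" by (simp add: abs_mult mult_left_le)
  qed
  finally show ?thesis .
qed

lemma bounded_adapted_exp_Rsum: "bounded_adapted S (\<lambda>\<omega>. of_real (exp (Rsum j a S \<omega>)))"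
proof (rule bounded_adapted_of_real[where C = "exp (\<Sum>p\<in>S. \<bar>a p\<bar>)"])
  show "\<bar>exp (Rsum j a S \<omega>)\<bar> \<le> exp (\<Sum>p\<in>S. \<bar>a p\<bar>)" for \<omega>
    using Rsum_bound[of j a S \<omega>] by simp
qed measurable

text \<open>The square of Re (g p ^ j) has mean 1/2, by the double angle formula in
  \<open>sq\<close>; this turns the a^2/2 of the exponential series into a^2/4 and thereby fixes the
  leading constant of the final bound. The factor exp |a| is harmless for the small a used in the
  main term.\<close>

lemma exp_moment_single:
  assumes "prime p" "j > 0"
  shows "expectation (\<lambda>\<omega>. exp (a * Re (g p \<omega> ^ j))) \<le> exp (a\<^sup>2 * exp \<bar>a\<bar> / 4)"
proof -
  have p: "{p} \<subseteq> {p. prime p}" using assms by auto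
  have bounded_adapted: "bounded_adapted {p} (\<lambda>\<omega>. g p \<omega> ^ n)" for n by (intro bounded_adapted_power bounded_adapted_g) simp
  have int: "integrable M (\<lambda>\<omega>. g p \<omega> ^ n)" for n using bounded_adapted_integrable[OF p bounded_adapted] .
  have ReE: "expectation (\<lambda>\<omega>. Re (g p \<omega> ^ n)) = 0" if "n > 0" for n
    using int moment_g[OF assms(1) that] by simp
  have intRe: "integrable M (\<lambda>\<omega>. Re (g p \<omega> ^ n))" for n using int by simp
  have sq: "(Re (g p \<omega> ^ j))\<^sup>2 = (1 + Re (g p \<omega> ^ (2 * j))) / 2" for \<omega>
  proof -
    let ?z = "g p \<omega> ^ j"
    have "(Re ?z)\<^sup>2 + (Im ?z)\<^sup>2 = 1" by (simp add: cmod_power2[symmetric] norm_power)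
    moreover have "Re (?z\<^sup>2) = (Re ?z)\<^sup>2 - (Im ?z)\<^sup>2" by (simp add: power2_eq_square)
    moreover have "g p \<omega> ^ (2 * j) = ?z\<^sup>2" by (simp add: power_mult[symmetric] mult.commute)
    ultimately show ?thesis by simp
  qed
  have "expectation (\<lambda>\<omega>. exp (a * Re (g p \<omega> ^ j)))
      \<le> expectation (\<lambda>\<omega>. 1 + a * Re (g p \<omega> ^ j) + a\<^sup>2 * exp \<bar>a\<bar> / 4 * (1 + Re (g p \<omega> ^ (2 * j))))"
  proof (rule integral_mono)
    have "Rsum j (\<lambda>_. a) {p} = (\<lambda>\<omega>. a * Re (g p \<omega> ^ j))" by (simp add: Rsum_def[abs_def])
    then have "bounded_adapted {p} (\<lambda>\<omega>. complex_of_real (exp (a * Re (g p \<omega> ^ j))))" using bounded_adapted_exp_Rsum[of "{p}" j "\<lambda>_. a"] by (simp add: fun_eq_iff)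
    from bounded_adapted_norm_power_integrable[OF p this, of 1] show "integrable M (\<lambda>\<omega>. exp (a * Re (g p \<omega> ^ j)))" by simp
    show "integrable M (\<lambda>\<omega>. 1 + a * Re (g p \<omega> ^ j) + a\<^sup>2 * exp \<bar>a\<bar> / 4 * (1 + Re (g p \<omega> ^ (2 * j))))"
      using intRe by (intro Bochner_Integration.integrable_add integrable_mult_right) auto
    fix \<omega>
    let ?c = "Re (g p \<omega> ^ j)"
    have c: "\<bar>?c\<bar> \<le> 1" using abs_Re_le_cmod[of "g p \<omega> ^ j"] by (simp add: norm_power)
    have "exp (a * ?c) \<le> 1 + a * ?c + (a * ?c)\<^sup>2 / 2 * exp \<bar>a * ?c\<bar>" by (rule exp_le_quadratic)
    also have "\<dots> \<le> 1 + a * ?c + (a * ?c)\<^sup>2 / 2 * exp \<bar>a\<bar>"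
      using c by (intro add_left_mono mult_left_mono) (auto simp: abs_mult mult_left_le)
    also have "(a * ?c)\<^sup>2 / 2 * exp \<bar>a\<bar> = a\<^sup>2 * exp \<bar>a\<bar> / 4 * (1 + Re (g p \<omega> ^ (2 * j)))"
      unfolding power_mult_distrib sq by simp
    finally show "exp (a * ?c) \<le> 1 + a * ?c + a\<^sup>2 * exp \<bar>a\<bar> / 4 * (1 + Re (g p \<omega> ^ (2 * j)))" .
  qed
  also have "\<dots> = 1 + a * expectation (\<lambda>\<omega>. Re (g p \<omega> ^ j)) + a\<^sup>2 * exp \<bar>a\<bar> / 4 * (1 + expectation (\<lambda>\<omega>. Re (g p \<omega> ^ (2 * j))))"
    using intRe by (simp add: prob_space)
  also have "\<dots> = 1 + a\<^sup>2 * exp \<bar>a\<bar> / 4" using ReE[of j] ReE[of "2 * j"] assms(2) by simp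
  also have "\<dots> \<le> exp (a\<^sup>2 * exp \<bar>a\<bar> / 4)" by (rule exp_ge_add_one_self)
  finally show ?thesis .
qed

lemma exp_moment:
  assumes "finite S" "S \<subseteq> {p. prime p}" "j > 0"
  shows "expectation (\<lambda>\<omega>. exp (Rsum j a S \<omega>)) \<le> exp (\<Sum>p\<in>S. (a p)\<^sup>2 * exp \<bar>a p\<bar> / 4)"
  using assms(1,2)
proof (induction S rule: finite_induct)
  case empty
  then show ?case by (simp add: Rsum_def prob_space)
next
  case (insert p S)
  have single: "Rsum j a {p} \<omega> = a p * Re (g p \<omega> ^ j)" for \<omega> by (simp add: Rsum_def)
  have "exp (Rsum j a (insert p S) \<omega>) = exp (Rsum j a {p} \<omega>) * exp (Rsum j a S \<omega>)" for \<omega>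
    using insert by (simp add: Rsum_def exp_add)
  then have "expectation (\<lambda>\<omega>. exp (Rsum j a (insert p S) \<omega>)) = expectation (\<lambda>\<omega>. exp (Rsum j a {p} \<omega>) * exp (Rsum j a S \<omega>))"
    by simp
  also have "\<dots> = expectation (\<lambda>\<omega>. exp (Rsum j a {p} \<omega>)) * expectation (\<lambda>\<omega>. exp (Rsum j a S \<omega>))"
    by (rule real_indep[OF bounded_adapted_exp_Rsum bounded_adapted_exp_Rsum]) (use insert in auto)
  also have "\<dots> \<le> exp ((a p)\<^sup>2 * exp \<bar>a p\<bar> / 4) * exp (\<Sum>p\<in>S. (a p)\<^sup>2 * exp \<bar>a p\<bar> / 4)"
    using insert exp_moment_single[of p j "a p"] assms(3) unfolding single
    by (intro mult_mono) (auto intro: Bochner_Integration.integral_nonneg)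
  also have "\<dots> = exp (\<Sum>p\<in>insert p S. (a p)\<^sup>2 * exp \<bar>a p\<bar> / 4)"
    using insert by (simp add: exp_add)
  finally show ?case .
qed

lemma expectation_Rsum: "S \<subseteq> {p. prime p} \<Longrightarrow> j > 0 \<Longrightarrow> expectation (Rsum j a S) = 0"
proof -
  assume *: "S \<subseteq> {p. prime p}" "j > 0"
  have int: "integrable M (\<lambda>\<omega>. g p \<omega> ^ j)" if "p \<in> S" for p
    using bounded_adapted_integrable[OF *(1) bounded_adapted_power[OF bounded_adapted_g[OF that]]] .
  have "expectation (Rsum j a S) = (\<Sum>p\<in>S. a p * Re (expectation (\<lambda>\<omega>. g p \<omega> ^ j)))"
    unfolding Rsum_def[abs_def] using int by (subst Bochner_Integration.integral_sum) auto
  also have "\<dots> = 0" using * moment_g by (intro sum.neutral) auto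
  finally show ?thesis .
qed

lemma integrable_exp_Rsum: "S \<subseteq> {p. prime p} \<Longrightarrow> integrable M (\<lambda>\<omega>. exp (Rsum j a S \<omega>))"
  using bounded_adapted_norm_power_integrable[OF _ bounded_adapted_exp_Rsum[of S j a], of 1] by simp

text \<open>First-passage decomposition: given \<open>prime_sigma (S i)\<close>, the later increment has mean zero, so by
  convexity of the exponential \<open>exp (Rsum j a (S N))\<close> is at least \<open>exp (Rsum j a (S i))\<close> on average.\<close>
lemma maximal_exp:
  fixes S :: "nat \<Rightarrow> nat set"
  assumes S: "\<And>i. finite (S i)" "\<And>i. S i \<subseteq> {p. prime p}" "\<And>i k. i \<le> k \<Longrightarrow> S i \<subseteq> S k" and "j > 0"
  shows "prob {\<omega>\<in>space M. \<exists>i\<le>N. Rsum j a (S i) \<omega> \<ge> c} \<le> exp (- c + (\<Sum>p\<in>S N. (a p)\<^sup>2 * exp \<bar>a p\<bar> / 4))"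
proof -
  define A where "A i = {\<omega>\<in>space M. Rsum j a (S i) \<omega> \<ge> c \<and> (\<forall>k\<in>{..<i}. Rsum j a (S k) \<omega> < c)}" for i
  have A: "A i \<in> sets (prime_sigma (S i))" for i
  proof -
    have m: "Rsum j a (S k) \<in> borel_measurable (prime_sigma (S i))" if "k \<le> i" for k
      by (rule prime_sigma_mono[OF S(3)[OF that] Rsum_prime_sigma])
    have "{\<omega>\<in>space (prime_sigma (S i)). Rsum j a (S i) \<omega> \<ge> c} \<in> sets (prime_sigma (S i))" using m[of i] by measurable
    moreover have "{\<omega>\<in>space (prime_sigma (S i)). \<forall>k\<in>{..<i}. Rsum j a (S k) \<omega> < c} \<in> sets (prime_sigma (S i))"
    proof (rule sets.sets_Collect_finite_All)
      fix k assume "k \<in> {..<i}"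
      then have [measurable]: "Rsum j a (S k) \<in> borel_measurable (prime_sigma (S i))" using m by simp
      show "{\<omega>\<in>space (prime_sigma (S i)). Rsum j a (S k) \<omega> < c} \<in> sets (prime_sigma (S i))" by measurable
    qed auto
    ultimately have "{\<omega>\<in>space (prime_sigma (S i)). Rsum j a (S i) \<omega> \<ge> c} \<inter> {\<omega>\<in>space (prime_sigma (S i)). \<forall>k\<in>{..<i}. Rsum j a (S k) \<omega> < c} \<in> sets (prime_sigma (S i))"
      by (rule sets.Int)
    moreover have "{\<omega>\<in>space (prime_sigma (S i)). Rsum j a (S i) \<omega> \<ge> c} \<inter> {\<omega>\<in>space (prime_sigma (S i)). \<forall>k\<in>{..<i}. Rsum j a (S k) \<omega> < c} = A i"
      by (auto simp: A_def)
    ultimately show ?thesis by (simp only:)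
  qed
  have AM: "A i \<in> events" for i using A sets_prime_sigma_subset[OF S(2)] by blast
  have disj: "disjoint_family_on A {..N}"
  proof (unfold disjoint_family_on_def, intro ballI impI)
    fix m n :: nat assume "m \<noteq> n"
    then have "m < n \<or> n < m" by auto
    then show "A m \<inter> A n = {}" by (auto simp: A_def dest!: bspec)
  qed
  have un: "{\<omega>\<in>space M. \<exists>i\<le>N. Rsum j a (S i) \<omega> \<ge> c} = (\<Union>i\<in>{..N}. A i)"
  proof (intro equalityI subsetI)
    fix \<omega> assume "\<omega> \<in> {\<omega>\<in>space M. \<exists>i\<le>N. Rsum j a (S i) \<omega> \<ge> c}"
    then have w: "\<omega> \<in> space M" "\<exists>i. i \<le> N \<and> Rsum j a (S i) \<omega> \<ge> c" by auto
    define i where "i = (LEAST i. i \<le> N \<and> Rsum j a (S i) \<omega> \<ge> c)"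
    have i: "i \<le> N" "Rsum j a (S i) \<omega> \<ge> c" using LeastI_ex[OF w(2)] by (auto simp: i_def)
    have "Rsum j a (S k) \<omega> < c" if "k < i" for k
      using not_less_Least[of k "\<lambda>i. i \<le> N \<and> Rsum j a (S i) \<omega> \<ge> c"] that i by (auto simp: i_def[symmetric])
    then show "\<omega> \<in> (\<Union>i\<in>{..N}. A i)" using i w by (auto simp: A_def)
  qed (auto simp: A_def)
  have key: "exp c * prob (A i) \<le> expectation (\<lambda>\<omega>. exp (Rsum j a (S N) \<omega>) * indicator (A i) \<omega>)" if i: "i \<le> N" for i
  proof -
    define T where "T = S N - S i"
    have T: "S i \<union> T = S N" "S i \<inter> T = {}" "T \<subseteq> {p. prime p}" using S(3)[OF i] S(2) by (auto simp: T_def)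
    have split: "Rsum j a (S N) \<omega> = Rsum j a (S i) \<omega> + Rsum j a T \<omega>" for \<omega>
      unfolding Rsum_def T(1)[symmetric] using T(2) S(1) by (intro sum.union_disjoint) (auto simp: T_def)
    have admA: "bounded_adapted (S i) (\<lambda>\<omega>. complex_of_real (exp (Rsum j a (S i) \<omega>) * indicator (A i) \<omega>))"
    proof (rule bounded_adapted_of_real[where C = "exp (\<Sum>p\<in>S i. \<bar>a p\<bar>)"])
      show "(\<lambda>\<omega>. exp (Rsum j a (S i) \<omega>) * indicator (A i) \<omega>) \<in> borel_measurable (prime_sigma (S i))"
        using A[of i] by measurable
      show "\<bar>exp (Rsum j a (S i) \<omega>) * indicator (A i) \<omega>\<bar> \<le> exp (\<Sum>p\<in>S i. \<bar>a p\<bar>)" for \<omega>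
        using Rsum_bound[of j a "S i" \<omega>] by (auto simp: indicator_def)
    qed
    have admT: "bounded_adapted T (\<lambda>\<omega>. complex_of_real (Rsum j a T \<omega>))"
      by (rule bounded_adapted_of_real[OF Rsum_prime_sigma Rsum_bound])
    have zero: "expectation (\<lambda>\<omega>. (exp (Rsum j a (S i) \<omega>) * indicator (A i) \<omega>) * Rsum j a T \<omega>) = 0"
      using real_indep[OF admA admT T(2) S(2) T(3)] expectation_Rsum[OF T(3) \<open>j > 0\<close>, of a] by simp
    have int1: "integrable M (\<lambda>\<omega>. exp (Rsum j a (S i) \<omega>) * indicator (A i) \<omega>)"
      using bounded_adapted_norm_power_integrable[OF S(2) admA, of 1] by (simp add: norm_mult)
    have "bounded_adapted (S i \<union> T) (\<lambda>\<omega>. complex_of_real ((exp (Rsum j a (S i) \<omega>) * indicator (A i) \<omega>) * Rsum j a T \<omega>))"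
      unfolding of_real_mult[of "_ * _"]
      by (intro bounded_adapted_mult bounded_adapted_mono[OF _ admA] bounded_adapted_mono[OF _ admT]) auto
    then have "integrable M (\<lambda>\<omega>. complex_of_real ((exp (Rsum j a (S i) \<omega>) * indicator (A i) \<omega>) * Rsum j a T \<omega>))"
      using T S by (intro bounded_adapted_integrable) auto
    from integrable_Re[OF this] have int2: "integrable M (\<lambda>\<omega>. (exp (Rsum j a (S i) \<omega>) * indicator (A i) \<omega>) * Rsum j a T \<omega>)" by simp
    have int3: "integrable M (\<lambda>\<omega>. exp (Rsum j a (S N) \<omega>) * indicator (A i) \<omega>)"
      by (rule integrable_real_mult_indicator[OF AM integrable_exp_Rsum[OF S(2)]])
    have "exp c * prob (A i) = expectation (\<lambda>\<omega>. exp c * indicator (A i) \<omega>)" using AM by simp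
    also have "\<dots> \<le> expectation (\<lambda>\<omega>. exp (Rsum j a (S i) \<omega>) * indicator (A i) \<omega>)"
    proof (rule integral_mono)
      show "integrable M (\<lambda>\<omega>. exp c * indicat_real (A i) \<omega>)"
        by (rule integrable_real_mult_indicator[OF AM]) simp
      show "exp c * indicator (A i) \<omega> \<le> exp (Rsum j a (S i) \<omega>) * indicator (A i) \<omega>" for \<omega>
        by (auto simp: indicator_def A_def)
    qed (rule int1)
    also have "\<dots> = expectation (\<lambda>\<omega>. exp (Rsum j a (S i) \<omega>) * indicator (A i) \<omega> + (exp (Rsum j a (S i) \<omega>) * indicator (A i) \<omega>) * Rsum j a T \<omega>)"
      using int1 int2 zero by simp
    also have "\<dots> \<le> expectation (\<lambda>\<omega>. exp (Rsum j a (S N) \<omega>) * indicator (A i) \<omega>)"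
    proof (rule integral_mono)
      fix \<omega>
      have "exp (Rsum j a (S i) \<omega>) * (1 + Rsum j a T \<omega>) \<le> exp (Rsum j a (S i) \<omega>) * exp (Rsum j a T \<omega>)"
        using exp_ge_add_one_self by (intro mult_left_mono) auto
      also have "\<dots> = exp (Rsum j a (S N) \<omega>)" by (simp add: split exp_add)
      finally show "exp (Rsum j a (S i) \<omega>) * indicator (A i) \<omega> + (exp (Rsum j a (S i) \<omega>) * indicator (A i) \<omega>) * Rsum j a T \<omega>
         \<le> exp (Rsum j a (S N) \<omega>) * indicator (A i) \<omega>"
        by (simp add: indicator_def algebra_simps)
    qed (use int1 int2 int3 in auto)
    finally show ?thesis .
  qed
  have "exp c * prob {\<omega>\<in>space M. \<exists>i\<le>N. Rsum j a (S i) \<omega> \<ge> c} = (\<Sum>i\<in>{..N}. exp c * prob (A i))"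
    unfolding un using AM disj by (subst finite_measure_finite_Union) (auto simp: sum_distrib_left)
  also have "\<dots> \<le> (\<Sum>i\<in>{..N}. expectation (\<lambda>\<omega>. exp (Rsum j a (S N) \<omega>) * indicator (A i) \<omega>))"
    by (intro sum_mono key) simp
  also have "\<dots> = expectation (\<lambda>\<omega>. \<Sum>i\<in>{..N}. exp (Rsum j a (S N) \<omega>) * indicator (A i) \<omega>)"
    by (intro Bochner_Integration.integral_sum[symmetric] integrable_real_mult_indicator[OF AM integrable_exp_Rsum[OF S(2)]])
  also have "\<dots> \<le> expectation (\<lambda>\<omega>. exp (Rsum j a (S N) \<omega>))"
  proof (rule Bochner_Integration.integral_mono'[OF integrable_exp_Rsum[OF S(2)]])
    fix \<omega>
    have "(\<Sum>i\<in>{..N}. exp (Rsum j a (S N) \<omega>) * indicator (A i) \<omega>) = exp (Rsum j a (S N) \<omega>) * indicator (\<Union>i\<in>{..N}. A i) \<omega>"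
      using disj by (simp add: sum_distrib_left[symmetric] indicator_UN_disjoint)
    then show "(\<Sum>i\<in>{..N}. exp (Rsum j a (S N) \<omega>) * indicator (A i) \<omega>) \<le> exp (Rsum j a (S N) \<omega>)"
      by (simp add: indicator_def)
  qed auto
  also have "\<dots> \<le> exp (\<Sum>p\<in>S N. (a p)\<^sup>2 * exp \<bar>a p\<bar> / 4)" by (rule exp_moment[OF S(1,2) \<open>j > 0\<close>])
  finally show ?thesis by (simp add: exp_diff pos_le_divide_eq mult.commute)
qed

text \<open>After two terms of the logarithm the remainder at p is at most 64 * p powr (-3/2), and
  the sum of n powr (-3/2) is at most 1 + 1/(1/2) = 3, whence 192.\<close>

lemma norm_euler_prod_le:
  assumes "finite S" "S \<subseteq> {p. prime p}"
  shows "norm (euler_prod S \<omega>) \<le> exp (Rsum 1 (\<lambda>p. 1 / sqrt (real p)) S \<omega> + Rsum 2 (\<lambda>p. 1 / (2 * real p)) S \<omega> + 192)"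
proof -
  have "norm (euler_prod S \<omega>) = (\<Prod>p\<in>S. norm (1 / (1 - g p \<omega> / of_real (sqrt (real p)))))"
    by (simp add: euler_prod_def prod_norm)
  also have "\<dots> \<le> (\<Prod>p\<in>S. exp (1 / sqrt (real p) * Re (g p \<omega> ^ 1) + 1 / (2 * real p) * Re (g p \<omega> ^ 2) + 64 * real p powr (-1-1/2)))"
  proof (rule prod_mono, rule conjI)
    fix p assume p: "p \<in> S"
    have rp: "real p \<ge> 2" using p assms(2) prime_real_ge_2 by blast
    let ?w = "g p \<omega> / complex_of_real (sqrt (real p))"
    have nw: "norm ?w = 1 / sqrt (real p)" by (simp add: norm_divide)
    have "4 / 3 \<le> sqrt (real p)" using rp by (intro real_le_rsqrt) (simp add: power2_eq_square)
    moreover from this have "0 < sqrt (real p)" by linarith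
    ultimately have "norm ?w \<le> 3 / 4" unfolding nw by (simp add: divide_le_eq)
    then have "norm (1 / (1 - ?w)) \<le> exp (Re ?w + Re (?w\<^sup>2) / 2 + 64 * norm ?w ^ 3)"
      by (rule norm_inverse_one_minus_le)
    also have "Re ?w = 1 / sqrt (real p) * Re (g p \<omega> ^ 1)" by simp
    also have "?w\<^sup>2 = (g p \<omega>)\<^sup>2 / of_real (real p)"
      by (simp add: power_divide of_real_power[symmetric] del: of_real_power)
    also have "Re ((g p \<omega>)\<^sup>2 / of_real (real p)) / 2 = 1 / (2 * real p) * Re (g p \<omega> ^ 2)"
      by (simp only: Re_divide_of_real) simp
    also have "norm ?w ^ 3 = real p powr (-1-1/2)"
    proof -
      have "norm ?w ^ 3 = (real p powr (-1/2)) ^ 3"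
        unfolding nw using rp by (simp add: powr_minus powr_half_sqrt[symmetric] inverse_eq_divide)
      also have "\<dots> = real p powr (-1-1/2)" using rp by (simp add: powr_power)
      finally show ?thesis .
    qed
    finally show "norm (1 / (1 - ?w)) \<le> exp (1 / sqrt (real p) * Re (g p \<omega> ^ 1) + 1 / (2 * real p) * Re (g p \<omega> ^ 2) + 64 * real p powr (-1-1/2))" .
  qed simp
  also have "\<dots> = exp (Rsum 1 (\<lambda>p. 1 / sqrt (real p)) S \<omega> + Rsum 2 (\<lambda>p. 1 / (2 * real p)) S \<omega> + 64 * (\<Sum>p\<in>S. real p powr (-1-1/2)))"
    using assms(1) unfolding Rsum_def by (simp only: exp_sum[symmetric] sum.distrib sum_distrib_left)
  also have "\<dots> \<le> exp (Rsum 1 (\<lambda>p. 1 / sqrt (real p)) S \<omega> + Rsum 2 (\<lambda>p. 1 / (2 * real p)) S \<omega> + 192)"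
  proof -
    have "(\<Sum>p\<in>S. real p powr (-1-1/2)) \<le> (\<Sum>n=1..Max (insert 0 S). real n powr (-1-1/2))"
      using assms prime_gt_0_nat by (intro sum_mono2) (auto simp: Suc_le_eq)
    also have "\<dots> \<le> 1 + 1 / (1/2)" by (rule sum_powr_le) simp
    finally show ?thesis by simp
  qed
  finally show ?thesis .
qed

text \<open>Levels are cut at N n, about \<beta>^n; the maximum over all levels up to N (Suc n) is
  compared with the threshold at N n, and the exceedance probabilities are O(n powr (-\<beta>)). The
  reciprocal sum at level i is about i * ln 2, and R i has half of it as variance. The second-order
  terms V i cost a logarithm of the level. The random C takes up finitely many early V i and the
  bounded remainder.\<close>

lemma lil_upper:
  assumes "\<beta> > 1"
  shows "AE \<omega> in M. \<exists>C. \<forall>\<^sub>F k in sequentially. \<forall>i\<le>k. norm (euler_prod (primes_upto (exp (2 ^ i))) \<omega>)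
    \<le> exp (sqrt (\<beta> ^ 4 * (real k * ln 2) * ln (ln (real k))) + 2 * ln (real k + 1) + C)"
proof -
  define P where "P i = primes_upto (exp (2 ^ i))" for i :: nat
  define R where "R i = Rsum 1 (\<lambda>p. 1 / sqrt (real p)) (P i)" for i
  define V where "V i = Rsum 2 (\<lambda>p. 1 / (2 * real p)) (P i)" for i
  have P: "finite (P i)" "P i \<subseteq> {p. prime p}" for i by (auto simp: P_def primes_upto_def)
  have Pmono: "P i \<subseteq> P k" if "i \<le> k" for i k
    unfolding P_def using that by (intro primes_upto_mono) (simp add: power_increasing)
  have p2: "real p \<ge> 2" if "p \<in> P i" for p i using that P(2) prime_real_ge_2 by blast
  have RM [measurable]: "Rsum j a (P i) \<in> borel_measurable M" for j a i using prime_sigma_M[OF P(2) Rsum_prime_sigma] .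
  define N where "N n = nat \<lceil>\<beta> ^ n\<rceil>" for n
  have N: "\<beta> ^ n \<le> real (N n)" "real (N n) \<le> \<beta> ^ n + 1" for n
  proof -
    have "0 \<le> \<beta> ^ n" using assms by simp
    then have "real (N n) = real_of_int \<lceil>\<beta> ^ n\<rceil>" unfolding N_def by (intro of_nat_nat) linarith
    then show "\<beta> ^ n \<le> real (N n)" "real (N n) \<le> \<beta> ^ n + 1" by linarith+
  qed
  have NS: "real (N (Suc n)) \<le> \<beta> * real (N n) + 1" for n
  proof -
    have "\<beta> * \<beta> ^ n \<le> \<beta> * real (N n)" using N(1)[of n] assms by (intro mult_left_mono) auto
    then show ?thesis using N(2)[of "Suc n"] unfolding power_Suc by linarith
  qed
  have Nlim: "filterlim (\<lambda>n. real (N n)) at_top sequentially"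
  proof (rule filterlim_at_top_mono)
    show "filterlim (\<lambda>n. \<beta> ^ n) at_top sequentially" using assms by real_asymp
  qed (use N in auto)
  define L where "L m = ln (ln (m::real))" for m
  \<comment> \<open>s bounds the reciprocal sum at the next cut N (Suc n): one factor \<beta>
    accounts for the ratio of the cuts, the other for exp \<eta> = sqrt \<beta> and lower-order
    terms. lam = 2 * a / s minimises - lam * a + lam^2 * s / 4, with minimum - a^2 / s = - \<beta>^2
    * L; the correction exp lam spoils at most one factor \<beta>, leaving - \<beta> * L.\<close>
  define s where "s m = \<beta>\<^sup>2 * m * ln 2" for m :: real
  define a where "a m = sqrt (\<beta> ^ 4 * (m * ln 2) * L m)" for m
  define lam where "lam m = 2 * a m / s m" for m
  define \<eta> where "\<eta> = ln \<beta> / 2"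
  have \<eta>: "\<eta> > 0" using assms by (simp add: \<eta>_def)
  have "\<forall>\<^sub>F m in at_top. exp \<eta> * ((\<beta> * m + 1) * ln 2 + ln (1 + 1 / \<eta>)) \<le> s m"
  proof -
    have lim: "((\<lambda>m. (exp \<eta> * ((\<beta> * m + 1) * ln 2 + ln (1 + 1 / \<eta>))) / m) \<longlongrightarrow> exp \<eta> * \<beta> * ln 2) at_top"
      using \<eta> assms by real_asymp
    have "exp \<eta> < \<beta>" using assms by (simp add: \<eta>_def ln_less_cancel_iff[symmetric, of "exp _"] del: ln_less_cancel_iff)
    then have "exp \<eta> * \<beta> * ln 2 < \<beta>\<^sup>2 * ln 2" using assms by (simp add: power2_eq_square)
    from order_tendstoD(2)[OF lim this] show ?thesis
      using eventually_gt_at_top[of 0] by eventually_elim (simp add: s_def field_simps)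
  qed
  moreover have "\<forall>\<^sub>F m in at_top. 1 / \<beta> \<le> 2 - exp (lam m)"
  proof -
    have "(lam \<longlongrightarrow> 0) at_top" unfolding lam_def[abs_def] a_def s_def L_def using assms by real_asymp
    then have "((\<lambda>m. 2 - exp (lam m)) \<longlongrightarrow> 2 - exp 0) at_top" by (intro tendsto_intros)
    moreover have "1 / \<beta> < 2 - exp 0" using assms by (simp add: field_simps)
    ultimately have "\<forall>\<^sub>F m in at_top. 1 / \<beta> < 2 - exp (lam m)" by (rule order_tendstoD(1))
    then show ?thesis by eventually_elim simp
  qed
  moreover have "\<forall>\<^sub>F m in at_top. m > 0 \<and> L m > 0 \<and> ln m > 0"
    unfolding L_def by (intro eventually_conj; real_asymp)
  ultimately have "\<forall>\<^sub>F m in at_top. exp \<eta> * ((\<beta> * m + 1) * ln 2 + ln (1 + 1 / \<eta>)) \<le> s m \<and> 1 / \<beta> \<le> 2 - exp (lam m) \<and> m > 0 \<and> L m > 0 \<and> ln m > 0"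
    by eventually_elim auto
  from eventually_compose_filterlim[OF this Nlim]
  have ev: "\<forall>\<^sub>F n in sequentially. exp \<eta> * ((\<beta> * real (N n) + 1) * ln 2 + ln (1 + 1 / \<eta>)) \<le> s (real (N n))
     \<and> 1 / \<beta> \<le> 2 - exp (lam (real (N n))) \<and> real (N n) > 0 \<and> L (real (N n)) > 0 \<and> ln (real (N n)) > 0" .
  define A where "A n = {\<omega>\<in>space M. \<exists>i\<le>N (Suc n). R i \<omega> \<ge> a (real (N n))}" for n
  have RMi [measurable]: "R i \<in> borel_measurable M" "V i \<in> borel_measurable M" for i by (simp_all add: R_def V_def)
  have AM: "A n \<in> events" for n unfolding A_def by measurable
  have probA: "\<forall>\<^sub>F n in sequentially. norm (prob (A n)) \<le> (real n * ln \<beta>) powr (- \<beta>)"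
    using ev eventually_gt_at_top[of 0]
  proof eventually_elim
    case (elim n)
    let ?m = "real (N n)" and ?l = "lam (real (N n))"
    have s0: "s ?m > 0" using elim assms by (simp add: s_def)
    have a0: "a ?m \<ge> 0" "(a ?m)\<^sup>2 = \<beta>\<^sup>2 * s ?m * L ?m"
      using elim assms by (auto simp: a_def s_def power2_eq_square power4_eq_xxxx)
    have a_pos: "a ?m > 0" using elim assms by (simp add: a_def)
    have l0: "?l > 0" using a_pos s0 by (simp add: lam_def)
    have RR: "Rsum 1 (\<lambda>p. ?l * (1 / sqrt (real p))) (P i) \<omega> = ?l * R i \<omega>" for i \<omega>
      unfolding R_def Rsum_def by (simp add: sum_distrib_left mult.assoc)
    have "A n = {\<omega>\<in>space M. \<exists>i\<le>N (Suc n). Rsum 1 (\<lambda>p. ?l * (1 / sqrt (real p))) (P i) \<omega> \<ge> ?l * a ?m}"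
      unfolding RR A_def using l0 by simp
    then have "prob (A n) \<le> exp (- (?l * a ?m) + (\<Sum>p\<in>P (N (Suc n)). (?l * (1 / sqrt (real p)))\<^sup>2 * exp \<bar>?l * (1 / sqrt (real p))\<bar> / 4))"
      using maximal_exp[where S = P and j = 1 and N = "N (Suc n)" and a = "\<lambda>p. ?l * (1 / sqrt (real p))" and c = "?l * a ?m", OF P Pmono] by simp
    also have "\<dots> \<le> exp (- \<beta> * L ?m)"
    proof (subst exp_le_cancel_iff)
      have "(\<Sum>p\<in>P (N (Suc n)). (?l * (1 / sqrt (real p)))\<^sup>2 * exp \<bar>?l * (1 / sqrt (real p))\<bar> / 4)
         \<le> (\<Sum>p\<in>P (N (Suc n)). ?l\<^sup>2 * exp ?l / 4 * (1 / real p))"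
      proof (rule sum_mono)
        fix p assume "p \<in> P (N (Suc n))"
        then have rp: "real p \<ge> 2" by (rule p2)
        then have "1 / sqrt (real p) \<le> 1" by simp
        then have "\<bar>?l * (1 / sqrt (real p))\<bar> \<le> ?l" using l0 by (simp add: abs_mult divide_le_eq)
        then have "?l\<^sup>2 / real p * exp \<bar>?l * (1 / sqrt (real p))\<bar> \<le> ?l\<^sup>2 / real p * exp ?l"
          by (intro mult_left_mono) auto
        then show "(?l * (1 / sqrt (real p)))\<^sup>2 * exp \<bar>?l * (1 / sqrt (real p))\<bar> / 4 \<le> ?l\<^sup>2 * exp ?l / 4 * (1 / real p)"
          by (simp add: power_divide power_mult_distrib)
      qed
      also have "\<dots> = ?l\<^sup>2 * exp ?l / 4 * (\<Sum>p\<in>P (N (Suc n)). 1 / real p)" by (simp add: sum_distrib_left)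
      also have "\<dots> \<le> ?l\<^sup>2 * exp ?l / 4 * s ?m"
      proof (intro mult_left_mono)
        have "(\<Sum>p\<in>P (N (Suc n)). 1 / real p) \<le> exp \<eta> * ln (1 + 2 ^ N (Suc n) / \<eta>)"
          unfolding P_def using primes_upto_sum_le[of "exp (2 ^ N (Suc n))" \<eta>] \<eta> by simp
        also have "\<dots> \<le> exp \<eta> * (real (N (Suc n)) * ln 2 + ln (1 + 1 / \<eta>))"
        proof (rule mult_left_mono)
          have "1 + 2 ^ N (Suc n) / \<eta> \<le> 2 ^ N (Suc n) * (1 + 1 / \<eta>)" by (simp add: distrib_left)
          then have "ln (1 + 2 ^ N (Suc n) / \<eta>) \<le> ln (2 ^ N (Suc n) * (1 + 1 / \<eta>))"
            using \<eta> by (intro ln_mono) (auto intro: add_pos_pos)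
          also have "\<dots> = real (N (Suc n)) * ln 2 + ln (1 + 1 / \<eta>)"
          proof -
            have "0 < 1 + 1 / \<eta>" using \<eta> by (simp add: add_pos_pos)
            then have "ln (2 ^ N (Suc n) * (1 + 1 / \<eta>)) = ln (2 ^ N (Suc n)) + ln (1 + 1 / \<eta>)"
              by (intro ln_mult_pos) auto
            then show ?thesis by (simp add: ln_realpow)
          qed
          finally show "ln (1 + 2 ^ N (Suc n) / \<eta>) \<le> real (N (Suc n)) * ln 2 + ln (1 + 1 / \<eta>)" .
        qed simp
        also have "\<dots> \<le> exp \<eta> * ((\<beta> * ?m + 1) * ln 2 + ln (1 + 1 / \<eta>))"
          using NS[of n] by (intro mult_left_mono add_right_mono mult_right_mono) auto
        also have "\<dots> \<le> s ?m" using elim by simp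
        finally show "(\<Sum>p\<in>P (N (Suc n)). 1 / real p) \<le> s ?m" .
      qed simp
      also have "\<dots> = (a ?m)\<^sup>2 / s ?m * exp ?l"
        using s0 by (simp add: lam_def power2_eq_square field_simps)
      finally have "- (?l * a ?m) + (\<Sum>p\<in>P (N (Suc n)). (?l * (1 / sqrt (real p)))\<^sup>2 * exp \<bar>?l * (1 / sqrt (real p))\<bar> / 4)
          \<le> - (?l * a ?m) + (a ?m)\<^sup>2 / s ?m * exp ?l" by simp
      also have "\<dots> = - ((a ?m)\<^sup>2 / s ?m * (2 - exp ?l))"
        using s0 by (simp add: lam_def power2_eq_square field_simps)
      also have "\<dots> \<le> - ((a ?m)\<^sup>2 / s ?m * (1 / \<beta>))"
        using elim s0 by (simp only: neg_le_iff_le) (intro mult_left_mono; simp)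
      also have "\<dots> = - \<beta> * L ?m" unfolding a0(2) using s0 assms by (simp add: power2_eq_square)
      finally show "- (?l * a ?m) + (\<Sum>p\<in>P (N (Suc n)). (?l * (1 / sqrt (real p)))\<^sup>2 * exp \<bar>?l * (1 / sqrt (real p))\<bar> / 4) \<le> - \<beta> * L ?m" .
    qed
    also have "\<dots> = ln ?m powr (- \<beta>)"
    proof -
      have "ln ?m \<noteq> 0" using elim by linarith
      then show ?thesis by (simp only: powr_def L_def if_False)
    qed
    also have "\<dots> \<le> (real n * ln \<beta>) powr (- \<beta>)"
    proof (rule powr_mono2')
      have "ln (\<beta> ^ n) \<le> ln ?m" using N(1)[of n] assms by (intro ln_mono) auto
      then show "real n * ln \<beta> \<le> ln ?m" using assms by (simp add: ln_realpow)
    qed (use assms elim in auto)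
    finally show ?case by simp
  qed
  have sumA: "summable (\<lambda>n. (real n * ln \<beta>) powr (- \<beta>))"
  proof -
    have "summable (\<lambda>n. real n powr (- \<beta>))" using assms by (simp add: summable_real_powr_iff)
    then have "summable (\<lambda>n. real n powr (- \<beta>) * ln \<beta> powr (- \<beta>))" by (rule summable_mult2)
    then show ?thesis using assms by (simp add: powr_mult)
  qed
  have "summable (\<lambda>n. prob (A n))"
    by (rule summable_comparison_test_ev[OF probA sumA])
  then have AE1: "AE \<omega> in M. \<forall>\<^sub>F n in sequentially. \<omega> \<in> space M - A n"
    using AM by (intro borel_cantelli_AE1) (simp_all add: emeasure_eq_measure)
  \<comment> \<open>The sum of 1/p^2 converges, so the second-order terms have bounded exponential
    moments and exceed 2 * ln (i + 1) with probability O(1 / (i + 1)^2), which is summable.\<close>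
  define D where "D i = {\<omega>\<in>space M. V i \<omega> \<ge> 2 * ln (real i + 1)}" for i
  have DM: "D i \<in> events" for i unfolding D_def by measurable
  have probD: "prob (D i) \<le> exp 1 * (1 / (real i + 1)\<^sup>2)" for i
  proof -
    have "prob (D i) \<le> exp (- (2 * ln (real i + 1)) + (\<Sum>p\<in>P i. (1 / (2 * real p))\<^sup>2 * exp \<bar>1 / (2 * real p)\<bar> / 4))"
      using maximal_exp[where S = "\<lambda>_. P i" and j = 2 and N = 0 and a = "\<lambda>p. 1 / (2 * real p)" and c = "2 * ln (real i + 1)"] P by (simp add: D_def V_def)
    also have "\<dots> \<le> exp (- (2 * ln (real i + 1)) + 1)"
    proof (subst exp_le_cancel_iff, rule add_left_mono)
      have "(\<Sum>p\<in>P i. (1 / (2 * real p))\<^sup>2 * exp \<bar>1 / (2 * real p)\<bar> / 4) \<le> (\<Sum>p\<in>P i. 1 / (real p)\<^sup>2)"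
      proof (rule sum_mono)
        fix p assume "p \<in> P i"
        then have rp: "real p \<ge> 2" by (rule p2)
        then have "1 / (2 * real p) \<le> 1" by (simp add: divide_le_eq)
        then have "exp \<bar>1 / (2 * real p)\<bar> \<le> exp 1" by (simp add: exp_le_cancel_iff)
        also have "\<dots> \<le> 4" using exp_le by simp
        finally have "(1 / (2 * real p))\<^sup>2 * exp \<bar>1 / (2 * real p)\<bar> \<le> (1 / (2 * real p))\<^sup>2 * 4" by (intro mult_left_mono) auto
        also have "\<dots> = 1 / (real p)\<^sup>2" by (simp add: power2_eq_square)
        finally have "(1 / (2 * real p))\<^sup>2 * exp \<bar>1 / (2 * real p)\<bar> \<le> 1 / (real p)\<^sup>2" .
        moreover have "0 \<le> (1 / (2 * real p))\<^sup>2 * exp \<bar>1 / (2 * real p)\<bar>" by (intro mult_nonneg_nonneg) auto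
        ultimately show "(1 / (2 * real p))\<^sup>2 * exp \<bar>1 / (2 * real p)\<bar> / 4 \<le> 1 / (real p)\<^sup>2" by linarith
      qed
      also have "\<dots> \<le> 1" using P by (intro sum_inverse_square_primes_le) auto
      finally show "(\<Sum>p\<in>P i. (1 / (2 * real p))\<^sup>2 * exp \<bar>1 / (2 * real p)\<bar> / 4) \<le> 1" .
    qed
    also have "\<dots> = exp 1 * (1 / (real i + 1)\<^sup>2)"
    proof -
      have "exp (2 * ln (real i + 1)) = (exp (ln (real i + 1)))\<^sup>2" by (simp add: exp_double)
      also have "exp (ln (real i + 1)) = real i + 1" by (intro exp_ln) simp
      finally show ?thesis by (simp add: exp_diff)
    qed
    finally show ?thesis .
  qed
  have "summable (\<lambda>i. exp 1 * (1 / (real i + 1)\<^sup>2))"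
  proof (rule summable_mult)
    have "summable (\<lambda>i. 1 / real (Suc i) ^ 2)" using inverse_power_summable[of 2, where 'a = real]
      by (subst summable_Suc_iff) (simp add: inverse_eq_divide)
    then show "summable (\<lambda>i. 1 / (real i + 1)\<^sup>2)" by (simp add: add.commute)
  qed
  then have "summable (\<lambda>i. prob (D i))"
    by (rule summable_comparison_test'[where N = 0]) (use probD in simp)
  then have AE2: "AE \<omega> in M. \<forall>\<^sub>F i in sequentially. \<omega> \<in> space M - D i"
    using DM by (intro borel_cantelli_AE1) (simp_all add: emeasure_eq_measure)
  from AE1 AE2 show ?thesis
  proof eventually_elim
    case (elim \<omega>)
    then have \<omega>: "\<omega> \<in> space M" by (auto simp: eventually_sequentially)
    obtain i0 where i0: "\<And>i. i \<ge> i0 \<Longrightarrow> V i \<omega> < 2 * ln (real i + 1)"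
      using elim(2) \<omega> unfolding eventually_sequentially D_def by force
    define C where "C = (\<Sum>i<i0. \<bar>V i \<omega>\<bar>)"
    have Vb: "V i \<omega> \<le> 2 * ln (real i + 1) + C" for i
    proof (cases "i \<ge> i0")
      case True
      then show ?thesis using i0[OF True] by (simp add: C_def add_increasing2 sum_nonneg less_imp_le)
    next
      case False
      have "V i \<omega> \<le> \<bar>V i \<omega>\<bar>" by simp
      also have "\<dots> \<le> C" unfolding C_def using False by (intro member_le_sum) auto
      finally show ?thesis by (simp add: add_increasing)
    qed
    have "\<forall>\<^sub>F n in sequentially. \<omega> \<notin> A n \<and> L (real (N n)) > 0 \<and> real (N n) > 0 \<and> ln (real (N n)) > 0"
      using elim(1) ev by eventually_elim auto
    then obtain n0 where n0: "\<And>n. n \<ge> n0 \<Longrightarrow> \<omega> \<notin> A n \<and> L (real (N n)) > 0 \<and> real (N n) > 0 \<and> ln (real (N n)) > 0"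
      unfolding eventually_sequentially by blast
    have "\<forall>\<^sub>F k in sequentially. \<forall>i\<le>k. norm (euler_prod (P i) \<omega>)
      \<le> exp (sqrt (\<beta> ^ 4 * (real k * ln 2) * ln (ln (real k))) + 2 * ln (real k + 1) + (C + 192))"
      using eventually_ge_at_top[of "N n0"]
    proof eventually_elim
      case (elim k)
      have ex: "\<exists>n. N n > k"
      proof -
        have "\<forall>\<^sub>F n in sequentially. real (N n) > real k" using Nlim unfolding filterlim_at_top_dense by blast
        then show ?thesis by (auto simp: eventually_sequentially)
      qed
      \<comment> \<open>The aim is N n <= k < N (Suc n) with n' = Suc n: then the complement of
        \<open>A n\<close> controls every level i <= k, and the threshold at N n is at most the one
        at k.\<close>
      define n' where "n' = (LEAST n. N n > k)"
      have n': "N n' > k" "\<And>n. n < n' \<Longrightarrow> N n \<le> k"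
      proof -
        show "N n' > k" unfolding n'_def by (rule LeastI_ex[OF ex])
        show "N n \<le> k" if "n < n'" for n
          using not_less_Least[of n "\<lambda>n. N n > k"] that unfolding n'_def by simp
      qed
      have Nmono: "N x \<le> N y" if "x \<le> y" for x y
        unfolding N_def using that assms by (intro nat_mono ceiling_mono power_increasing) auto
      have "n' > n0"
      proof (rule ccontr)
        assume "\<not> n' > n0"
        then have "N n' \<le> N n0" by (intro Nmono) simp
        then show False using n'(1) elim by simp
      qed
      then obtain n where n: "n' = Suc n" "n \<ge> n0" by (cases n') auto
      have Nk: "N n \<le> k" "k < N (Suc n)" using n' n by auto
      note nn = n0[OF n(2)]
      have aa: "a (real (N n)) \<le> sqrt (\<beta> ^ 4 * (real k * ln 2) * ln (ln (real k)))"
      proof -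
        have lnk: "ln (real (N n)) \<le> ln (real k)" using Nk nn by (intro ln_mono) auto
        have "L (real (N n)) \<le> ln (ln (real k))" unfolding L_def using ln_mono[OF lnk] nn by blast
        then show ?thesis unfolding a_def using Nk nn assms
          by (intro real_sqrt_le_mono mult_mono) auto
      qed
      show ?case
      proof (intro allI impI)
        fix i assume i: "i \<le> k"
        have "R i \<omega> < a (real (N n))"
        proof (rule ccontr)
          assume "\<not> R i \<omega> < a (real (N n))"
          moreover have "i \<le> N (Suc n)" using i Nk by simp
          ultimately have "\<omega> \<in> A n" using \<omega> unfolding A_def by (auto simp: not_less)
          then show False using nn by blast
        qed
        moreover have "V i \<omega> \<le> 2 * ln (real k + 1) + C"
        proof -
          have "ln (real i + 1) \<le> ln (real k + 1)" using i by (intro ln_mono) auto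
          then show ?thesis using Vb[of i] by linarith
        qed
        moreover have "norm (euler_prod (P i) \<omega>) \<le> exp (R i \<omega> + V i \<omega> + 192)"
          unfolding R_def V_def by (rule norm_euler_prod_le[OF P])
        ultimately show "norm (euler_prod (P i) \<omega>) \<le> exp (sqrt (\<beta> ^ 4 * (real k * ln 2) * ln (ln (real k))) + 2 * ln (real k + 1) + (C + 192))"
          using aa by (elim order_trans) simp
      qed
    qed
    then show ?case unfolding P_def by blast
  qed
qed

end

context prime_block
begin

text \<open>The exceptional set is packaged as a nonnegative Q of small mean such that Q < 1 forces
  the bounds whenever the mean square is at most \<Lambda>. Such variables can be added over points
  and blocks, so one application of Markov's inequality suffices later. Dividing the moment by c =
  (e * w)^(2^s) makes its mean at most exp (-(2^s)), enough for exponentially many points once 2^s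
  exceeds a multiple of k.\<close>

lemma block_control:
  assumes X: "finite X" "\<And>x. x \<in> X \<Longrightarrow> 1 \<le> x \<and> ln x \<le> L" and "L + \<delta> \<le> U"
    and w: "w > 0" "\<Lambda> \<ge> 0" "2 * \<kappa> / \<delta> * \<Lambda> + 1 \<le> w"
  shows "\<exists>Q. Q \<in> borel_measurable M \<and>
    (\<integral>\<^sup>+\<omega>. Q \<omega> \<partial>M) \<le> ennreal (card X * (2 * \<kappa> * (1 + L + \<delta>) + exp (- (2 ^ s)))) \<and>
    (\<forall>\<omega>\<in>space M. Q \<omega> < 1 \<longrightarrow> mean_sq S U \<omega> \<le> ennreal \<Lambda> \<longrightarrow>
      (\<forall>x\<in>X. (norm (Psi (S \<union> T) x \<omega> - Psi S x \<omega>))\<^sup>2 \<le> exp 1 * w))"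
proof -
  define V where "V x \<omega> = ennreal (norm (Psi (S \<union> T) x \<omega> - Psi S x \<omega>) ^ (2 ^ Suc s)) * indicator {\<omega>\<in>space M. W x \<omega> \<le> w} \<omega>" for x \<omega>
  define c where "c = (exp 1 * w) ^ (2 ^ s)"
  have c0: "c > 0" using w by (simp add: c_def)
  define Q where "Q \<omega> = (\<Sum>x\<in>X. Err x \<omega> + ennreal (1 / c) * V x \<omega>)" for \<omega>
  have ST: "S \<union> T \<subseteq> {p. prime p}" using S_primes T_primes by auto
  have [measurable]: "Psi (S \<union> T) x \<in> borel_measurable M" "Psi S x \<in> borel_measurable M" "W x \<in> borel_measurable M" "Err x \<in> borel_measurable M" for x
    using Psi_M[OF ST] Psi_M[OF S_primes] prime_sigma_M[OF S_primes W_prime_sigma] Err_M by auto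
  have V_M [measurable]: "V x \<in> borel_measurable M" for x unfolding V_def[abs_def] by measurable
  have Q_M: "Q \<in> borel_measurable M" unfolding Q_def[abs_def] by measurable
  have one: "(\<integral>\<^sup>+\<omega>. Err x \<omega> + ennreal (1 / c) * V x \<omega> \<partial>M) \<le> ennreal (2 * \<kappa> * (1 + L + \<delta>) + exp (- (2 ^ s)))" if x: "x \<in> X" for x
  proof -
    have x1: "1 \<le> x" "ln x \<le> L" using X(2)[OF x] by auto
    have "(\<integral>\<^sup>+\<omega>. Err x \<omega> + ennreal (1 / c) * V x \<omega> \<partial>M) = (\<integral>\<^sup>+\<omega>. Err x \<omega> \<partial>M) + ennreal (1 / c) * (\<integral>\<^sup>+\<omega>. V x \<omega> \<partial>M)"
      using nn_integral_lincomb2[of "Err x" M "V x" 1 "ennreal (1 / c)"] by simp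
    also have "\<dots> \<le> ennreal (2 * \<kappa> * (1 + ln x + \<delta>)) + ennreal (1 / c) * ennreal (w ^ (2 ^ s))"
      unfolding V_def using w x1 by (intro add_mono mult_left_mono Err_expectation block_moment) auto
    also have "ennreal (1 / c) * ennreal (w ^ (2 ^ s)) = ennreal (exp (- (2 ^ s)))"
    proof -
      have "exp 1 ^ (2 ^ s) = exp (2 ^ s :: real)" by (simp add: exp_of_nat_mult[symmetric])
      then have "1 / c * w ^ (2 ^ s) = exp (- (2 ^ s))"
        using w by (simp add: c_def power_mult_distrib exp_minus divide_inverse)
      then show ?thesis using c0 w by (simp add: ennreal_mult[symmetric])
    qed
    also have "ennreal (2 * \<kappa> * (1 + ln x + \<delta>)) + ennreal (exp (- (2 ^ s))) = ennreal (2 * \<kappa> * (1 + ln x + \<delta>) + exp (- (2 ^ s)))"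
      using \<kappa>_nonneg \<delta>_pos x1 by (intro ennreal_plus[symmetric]) auto
    also have "\<dots> \<le> ennreal (2 * \<kappa> * (1 + L + \<delta>) + exp (- (2 ^ s)))"
      using \<kappa>_nonneg x1 by (intro ennreal_leI add_right_mono mult_left_mono) auto
    finally show ?thesis .
  qed
  have "(\<integral>\<^sup>+\<omega>. Q \<omega> \<partial>M) = (\<Sum>x\<in>X. \<integral>\<^sup>+\<omega>. Err x \<omega> + ennreal (1 / c) * V x \<omega> \<partial>M)"
    unfolding Q_def by (intro nn_integral_sum) measurable
  also have "\<dots> \<le> (\<Sum>x\<in>X. ennreal (2 * \<kappa> * (1 + L + \<delta>) + exp (- (2 ^ s))))" by (intro sum_mono one)
  also have "\<dots> = ennreal (card X * (2 * \<kappa> * (1 + L + \<delta>) + exp (- (2 ^ s))))"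
  proof (cases "X = {}")
    case False
    then obtain x where "x \<in> X" by auto
    then have "0 \<le> L" using X(2)[of x] ln_ge_zero[of x] by linarith
    then have "0 \<le> 2 * \<kappa> * (1 + L + \<delta>) + exp (- (2 ^ s))" using \<kappa>_nonneg \<delta>_pos by (intro add_nonneg_nonneg mult_nonneg_nonneg) auto
    then show ?thesis by (simp add: ennreal_of_nat_eq_real_of_nat ennreal_mult[symmetric])
  qed simp
  finally have EQ: "(\<integral>\<^sup>+\<omega>. Q \<omega> \<partial>M) \<le> ennreal (card X * (2 * \<kappa> * (1 + L + \<delta>) + exp (- (2 ^ s))))" .
  have path: "(norm (Psi (S \<union> T) x \<omega> - Psi S x \<omega>))\<^sup>2 \<le> exp 1 * w"
    if \<omega>: "\<omega> \<in> space M" "Q \<omega> < 1" "mean_sq S U \<omega> \<le> ennreal \<Lambda>" and x: "x \<in> X" for \<omega> x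
  proof -
    have x1: "1 \<le> x" "ln x \<le> L" using X(2)[OF x] by auto
    have "Err x \<omega> + ennreal (1 / c) * V x \<omega> \<le> Q \<omega>"
      unfolding Q_def using x X(1) by (intro member_le_sum) auto
    then have lt: "Err x \<omega> + ennreal (1 / c) * V x \<omega> < 1" using \<omega>(2) by (rule le_less_trans)
    have E1: "Err x \<omega> \<le> 1" using le_less_trans[OF _ lt, of "Err x \<omega>"] by (simp add: less_imp_le)
    have V1: "ennreal (1 / c) * V x \<omega> \<le> 1" using le_less_trans[OF _ lt, of "ennreal (1 / c) * V x \<omega>"] by (simp add: less_imp_le)
    have "ennreal (W x \<omega>) \<le> ennreal (2 * \<kappa> / \<delta>) * mean_sq S (ln x + \<delta>) \<omega> + Err x \<omega>" by (rule W_le[OF x1(1)])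
    also have "\<dots> \<le> ennreal (2 * \<kappa> / \<delta>) * ennreal \<Lambda> + 1"
    proof (intro add_mono mult_left_mono E1)
      have "mean_sq S (ln x + \<delta>) \<omega> \<le> mean_sq S U \<omega>" using x1 assms(3) by (intro mean_sq_mono) auto
      then show "mean_sq S (ln x + \<delta>) \<omega> \<le> ennreal \<Lambda>" using \<omega>(3) by (rule order_trans)
    qed simp
    also have "\<dots> = ennreal (2 * \<kappa> / \<delta> * \<Lambda> + 1)"
    proof -
      have nn: "0 \<le> 2 * \<kappa> / \<delta>" using \<kappa>_nonneg \<delta>_pos by simp
      have "ennreal (2 * \<kappa> / \<delta>) * ennreal \<Lambda> = ennreal (2 * \<kappa> / \<delta> * \<Lambda>)"
        using nn w(2) by (intro ennreal_mult[symmetric]) auto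
      moreover have "ennreal (2 * \<kappa> / \<delta> * \<Lambda> + 1) = ennreal (2 * \<kappa> / \<delta> * \<Lambda>) + ennreal 1"
        by (rule ennreal_plus[OF mult_nonneg_nonneg[OF nn w(2)]]) simp
      ultimately show ?thesis by simp
    qed
    also have "\<dots> \<le> ennreal w" using w(3) by (rule ennreal_leI)
    finally have "W x \<omega> \<le> w" using w(1) by simp
    then have "V x \<omega> = ennreal (norm (Psi (S \<union> T) x \<omega> - Psi S x \<omega>) ^ (2 ^ Suc s))"
      using \<omega>(1) by (simp add: V_def)
    with V1 have "ennreal (1 / c * norm (Psi (S \<union> T) x \<omega> - Psi S x \<omega>) ^ (2 ^ Suc s)) \<le> ennreal 1"
      using c0 by (subst ennreal_mult) auto
    then have "1 / c * norm (Psi (S \<union> T) x \<omega> - Psi S x \<omega>) ^ (2 ^ Suc s) \<le> 1"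
      by (subst (asm) ennreal_le_iff) auto
    then have "norm (Psi (S \<union> T) x \<omega> - Psi S x \<omega>) ^ (2 ^ Suc s) \<le> c" using c0 by (simp add: field_simps)
    then have "((norm (Psi (S \<union> T) x \<omega> - Psi S x \<omega>))\<^sup>2) ^ (2 ^ s) \<le> (exp 1 * w) ^ (2 ^ s)"
      by (simp add: c_def power_mult[symmetric])
    then show ?thesis using w(1) by (subst (asm) power_mono_iff) auto
  qed
  show ?thesis using Q_M EQ path by blast
qed

end

subsection \<open>Assembly at a dyadic scale\<close>

lemma pow2_between:
  assumes "x \<ge> 1"
  obtains h :: nat where "x \<le> 2 ^ h" "(2::real) ^ h \<le> 2 * x"
proof
  define h where "h = nat \<lceil>log 2 x\<rceil>"
  have l0: "log 2 x \<ge> 0" using assms by simp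
  then have h: "log 2 x \<le> real h" "real h \<le> log 2 x + 1" by (auto simp: h_def)
  have "x = 2 powr (log 2 x)" using assms by simp
  also have "\<dots> \<le> 2 powr real h" using h by (intro powr_mono) auto
  finally show "x \<le> 2 ^ h" by (simp add: powr_realpow)
  have "2 powr real h \<le> 2 powr (log 2 x + 1)" using h by (intro powr_mono) auto
  also have "\<dots> = 2 * x" using assms by (simp add: powr_add)
  finally show "(2::real) ^ h \<le> 2 * x" by (simp add: powr_realpow)
qed

text \<open>The mean of \<open>Err\<close> is of the order of the mesh up to powers of k, and it is
  summed over up to 2^(11 * k) test points and all blocks; the exponent 20 leaves ample
  room.\<close>

definition mesh_width :: "nat \<Rightarrow> real" where "mesh_width k = 1 / 2 ^ (20 * k)"

text \<open>Sieving up to z with ln z = 2^k / (2^16 * k^2) gives reciprocal mass about 2 / ln z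
  times the mesh, that is 2^17 * k^2 / 2^k; the constant 2^18 covers the error terms. One factor k
  more than the expected order is the price of the pure sieve.\<close>

definition window_bound :: "nat \<Rightarrow> real" where "window_bound k = mesh_width k * (2 ^ 18 * real k ^ 2 / 2 ^ k)"

text \<open>The sieve runs with r = 16 * k and t = 8. The truncation error exp (24 * (k + 1)) /
  8^(16 * k) is below k^2 / 2^k. Since (z + 1)^r <= z^(32 * k) = exp (2^k / (2048 * k)) is at most
  the square root of w, the rounding errors divided by w are far smaller than the mesh.\<close>

lemma eventually_window_le:
  "\<forall>\<^sub>F k in sequentially. \<forall>w. w \<ge> exp (2 ^ k / (1024 * real k)) \<longrightarrow>
    (\<Sum>p | prime p \<and> w < real p \<and> real p \<le> w * exp (mesh_width k). 1 / real p) \<le> window_bound k"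
proof -
  have "\<forall>\<^sub>F k::nat in sequentially. 1 \<le> real k" by real_asymp
  moreover have "\<forall>\<^sub>F k::nat in sequentially. 2 \<le> exp (2 ^ k / (2 ^ 16 * real k ^ 2))" by real_asymp
  moreover have "\<forall>\<^sub>F k::nat in sequentially. exp (24 * (real k + 1)) / 8 ^ (16 * k) \<le> real k ^ 2 / 2 ^ k"
  proof -
    have "\<forall>\<^sub>F k::nat in sequentially. 3 ^ 24 \<le> real k ^ 2" by real_asymp
    then show ?thesis
    proof eventually_elim
      case (elim k)
      have "exp (24 * (real k + 1)) = exp 1 ^ (24 * (k + 1))" by (simp add: exp_of_nat_mult[symmetric] algebra_simps)
      also have "\<dots> \<le> 3 ^ (24 * (k + 1))" using exp_le by (intro power_mono) auto
      also have "\<dots> = 3 ^ 24 * (3 ^ 24) ^ k"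
        unfolding power_mult[symmetric] power_add[symmetric] by (simp only: distrib_left mult_1_right add.commute)
      also have "\<dots> \<le> real k ^ 2 * (2 ^ 47) ^ k" using elim by (intro mult_mono power_mono) auto
      finally have "exp (24 * (real k + 1)) * 2 ^ k \<le> real k ^ 2 * ((2 ^ 47) ^ k * 2 ^ k)"
        by (simp add: mult.assoc)
      also have "(2 ^ 47) ^ k * 2 ^ k = (8 ^ (16 * k) :: real)"
        by (simp add: power_mult_distrib[symmetric] power_mult)
      finally show ?case by (simp add: field_simps)
    qed
  qed
  moreover have "\<forall>\<^sub>F k::nat in sequentially. exp (- (2 ^ k / (2048 * real k))) \<le> 1 / 2 ^ (20 * k) * (real k ^ 2 / 2 ^ k)"
    by real_asymp
  ultimately show ?thesis
  proof eventually_elim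
    case (elim k)
    define Zk where "Zk = 2 ^ k / (2 ^ 16 * real k ^ 2)"
    define z where "z = exp Zk"
    have m0: "0 < mesh_width k" "mesh_width k \<le> 1" by (auto simp: mesh_width_def)
    show ?case
    proof (intro allI impI)
      fix w :: real assume w: "w \<ge> exp (2 ^ k / (1024 * real k))"
      have w0: "w > 0" using w by (meson exp_gt_zero less_le_trans)
      have z2: "2 \<le> z" using elim(2) by (simp add: z_def Zk_def)
      have "Zk \<le> 2 ^ k / (1024 * real k)"
      proof -
        have "1024 * real k * 1 \<le> 2 ^ 16 * real k * real k" using elim(1) by (intro mult_mono) auto
        then show ?thesis unfolding Zk_def power2_eq_square using elim(1)
          by (intro divide_left_mono) (auto simp: mult_ac)
      qed
      then have zw: "z \<le> w" using w by (simp add: z_def order_trans[OF _ w])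
      have "z \<le> exp (2 ^ k)"
      proof -
        have "2 ^ k / (2 ^ 16 * real k ^ 2) \<le> 2 ^ k / 1" using elim(1)
          by (intro divide_left_mono) (auto intro!: mult_ge1_I)
        then show ?thesis by (simp add: z_def Zk_def)
      qed
      then have "primes_upto z \<subseteq> primes_upto (exp (2 ^ k))" by (rule primes_upto_mono)
      then have "(\<Sum>p\<in>primes_upto z. 1 / real p) \<le> (\<Sum>p\<in>primes_upto (exp (2 ^ k)). 1 / real p)"
        by (intro sum_mono2) auto
      also have "\<dots> \<le> 3 * (real k + 1)" by (rule primes_upto_exp_sum_le)
      finally have ps: "8 * (\<Sum>p\<in>primes_upto z. 1 / real p) \<le> 24 * (real k + 1)" by simp
      let ?Pw = "{p. prime p \<and> w < real p \<and> real p \<le> w * exp (mesh_width k)}"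
      have fin: "finite ?Pw" by (rule finite_subset[OF _ finite_nat_le_real[of "w * exp (mesh_width k)"]]) auto
      have "(\<Sum>p\<in>?Pw. 1 / real p) \<le> (\<Sum>p\<in>?Pw. 1 / w)" using w0 by (intro sum_mono divide_left_mono) auto
      also have "\<dots> = real (card ?Pw) / w" by simp
      also have "\<dots> \<le> (2 * mesh_width k * w * (1 / ln z + exp (8 * (\<Sum>p\<in>primes_upto z. 1 / real p)) / 8 ^ (16 * k)) + (z + 1) ^ (16 * k)) / w"
        using w0 m0 z2 zw by (intro divide_right_mono brun_sieve) auto
      also have "\<dots> = 2 * mesh_width k * (1 / Zk + exp (8 * (\<Sum>p\<in>primes_upto z. 1 / real p)) / 8 ^ (16 * k)) + (z + 1) ^ (16 * k) / w"
        using w0 by (simp add: z_def add_divide_distrib)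
      also have "\<dots> \<le> 2 * mesh_width k * (2 ^ 16 * real k ^ 2 / 2 ^ k + real k ^ 2 / 2 ^ k) + mesh_width k * (real k ^ 2 / 2 ^ k)"
      proof (intro add_mono mult_left_mono)
        show "1 / Zk \<le> 2 ^ 16 * real k ^ 2 / 2 ^ k" by (simp add: Zk_def)
        have "exp (8 * (\<Sum>p\<in>primes_upto z. 1 / real p)) / 8 ^ (16 * k) \<le> exp (24 * (real k + 1)) / 8 ^ (16 * k)"
          using ps by (intro divide_right_mono) auto
        then show "exp (8 * (\<Sum>p\<in>primes_upto z. 1 / real p)) / 8 ^ (16 * k) \<le> real k ^ 2 / 2 ^ k" using elim(3) by linarith
        have "2 * z \<le> z * z" using z2 by (intro mult_right_mono) auto
        then have "z + 1 \<le> z ^ 2" unfolding power2_eq_square using z2 by linarith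
        then have "(z + 1) ^ (16 * k) \<le> (z ^ 2) ^ (16 * k)" using z2 by (intro power_mono) auto
        also have "\<dots> = exp (real (32 * k) * Zk)"
          unfolding z_def exp_of_nat_mult by (simp add: power_mult[symmetric] mult.commute)
        also have "real (32 * k) * Zk = 2 ^ k / (2048 * real k)"
          using elim(1) by (simp add: Zk_def power2_eq_square field_simps)
        finally have "(z + 1) ^ (16 * k) / w \<le> exp (2 ^ k / (2048 * real k)) / exp (2 ^ k / (1024 * real k))"
          using w w0 by (intro frac_le) auto
        also have "\<dots> = exp (2 ^ k / (2048 * real k) - 2 ^ k / (1024 * real k))" by (rule exp_diff[symmetric])
        also have "2 ^ k / (2048 * real k) - 2 ^ k / (1024 * real k) = - (2 ^ k / (2048 * real k))"
          using elim(1) by (simp add: field_simps)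
        also have "exp \<dots> \<le> mesh_width k * (real k ^ 2 / 2 ^ k)" using elim(4) by (simp add: mesh_width_def)
        finally show "(z + 1) ^ (16 * k) / w \<le> mesh_width k * (real k ^ 2 / 2 ^ k)" .
      qed (use m0 in auto)
      also have "\<dots> = mesh_width k * ((2 ^ 17 + 3) * real k ^ 2 / 2 ^ k)" by (simp add: field_simps)
      also have "\<dots> \<le> window_bound k"
        unfolding window_bound_def using m0 by (intro mult_left_mono divide_right_mono mult_right_mono) auto
      finally show "(\<Sum>p\<in>?Pw. 1 / real p) \<le> window_bound k" .
    qed
  qed
qed

text \<open>With \<eta> = 1/k the factor exp \<eta> changes a logarithm of size about k * ln 2 by a
  bounded amount only. The sharp constant matters because this 2^k has to cancel against the 1/2^k
  of \<open>window_bound\<close>, leaving nothing but powers of k.\<close>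

lemma eventually_mertens_le:
  "\<forall>\<^sub>F k in sequentially. mertens (primes_upto (exp (2 ^ (k + 2)))) \<le> 2 ^ k * real k ^ 3"
proof -
  have "\<forall>\<^sub>F k::nat in sequentially. exp (2 + exp (1 / real k) * ln (1 + 2 ^ (k + 2) / (1 / real k))) \<le> 2 ^ k * real k ^ 3"
    by real_asymp
  then show ?thesis using eventually_gt_at_top[of 0]
  proof eventually_elim
    case (elim k)
    have "mertens (primes_upto (exp (2 ^ (k + 2)))) \<le> exp (2 + (\<Sum>p\<in>primes_upto (exp (2 ^ (k + 2))). 1 / real p))"
      by (intro mertens_le) (auto intro: primes_upto_prime)
    also have "\<dots> \<le> exp (2 + exp (1 / real k) * ln (1 + 2 ^ (k + 2) / (1 / real k)))"
      using primes_upto_sum_le[of "exp (2 ^ (k + 2))" "1 / real k"] elim(2) by simp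
    also have "\<dots> \<le> 2 ^ k * real k ^ 3" by (rule elim(1))
    finally show ?case .
  qed
qed

lemma window_chain:
  fixes \<delta> \<kappa> w0 w :: real
  assumes "\<And>w. w \<ge> w0 \<Longrightarrow> (\<Sum>p | prime p \<and> w < real p \<and> real p \<le> w * exp \<delta>. 1 / real p) \<le> \<kappa>"
    and "w \<ge> w0" "w0 > 0" "\<delta> > 0"
  shows "(\<Sum>p | prime p \<and> w < real p \<and> real p \<le> w * exp (real n * \<delta>). 1 / real p) \<le> real n * \<kappa>"
proof (induction n)
  case 0
  have e: "{p. prime p \<and> w < real p \<and> real p \<le> w * exp (real 0 * \<delta>)} = {}" by auto
  show ?case unfolding e by simp
next
  case (Suc n)
  let ?A = "\<lambda>n. {p. prime p \<and> w < real p \<and> real p \<le> w * exp (real n * \<delta>)}"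
  let ?w = "w * exp (real n * \<delta>)"
  have fin: "finite (?A n)" for n by (rule finite_subset[OF _ finite_nat_le_real[of "w * exp (real n * \<delta>)"]]) auto
  have "1 \<le> exp (real n * \<delta>)" using assms(4) by simp
  then have ww: "w \<le> ?w" using assms by simp
  have ex: "w * exp (real (Suc n) * \<delta>) = ?w * exp \<delta>" by (simp add: exp_add distrib_right)
  let ?C = "{p. prime p \<and> ?w < real p \<and> real p \<le> ?w * exp \<delta>}"
  have finC: "finite ?C" by (rule finite_subset[OF _ finite_nat_le_real[of "?w * exp \<delta>"]]) auto
  have "?A (Suc n) \<subseteq> ?A n \<union> ?C" unfolding ex by auto
  then have "(\<Sum>p\<in>?A (Suc n). 1 / real p) \<le> (\<Sum>p\<in>?A n \<union> ?C. 1 / real p)"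
    using fin[of n] finC by (intro sum_mono2) auto
  also have "\<dots> = (\<Sum>p\<in>?A n. 1 / real p) + (\<Sum>p\<in>?C. 1 / real p)"
    using fin[of n] finC by (intro sum.union_disjoint) auto
  also have "\<dots> \<le> real n * \<kappa> + \<kappa>" using Suc assms(1)[of ?w] assms(2) ww by (intro add_mono) auto
  finally show ?case by (simp add: distrib_right add.commute)
qed

lemma mertens_mono:
  assumes "finite T" "T \<subseteq> {p. prime p}" "S \<subseteq> T"
  shows "mertens S \<le> mertens T"
proof -
  have fS: "finite S" using assms finite_subset by blast
  have "mertens (S \<union> (T - S)) = mertens S * mertens (T - S)"
    using assms fS by (intro mertens_Un) auto
  moreover have "S \<union> (T - S) = T" using assms by auto
  moreover have "mertens (T - S) \<ge> 1" "mertens S \<ge> 1" using assms fS by (auto intro!: mertens_ge_1)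
  ultimately show ?thesis using mult_left_mono[of 1 "mertens (T - S)" "mertens S"] by simp
qed

context unimodular_primes
begin

definition half_sum :: "nat \<Rightarrow> 'a \<Rightarrow> complex" where
  "half_sum n \<omega> = (\<Sum>m=1..n. F m \<omega> / of_real (sqrt (real m)))"

lemma Psi_eq_half_sum:
  assumes "real n \<le> y"
  shows "Psi (primes_upto y) (real n) \<omega> = half_sum n \<omega>"
proof -
  have "{m. m \<in> smooth_over (primes_upto y) \<and> real m \<le> real n} = {1..n}"
  proof (intro equalityI subsetI)
    fix m assume m: "m \<in> {1..n}"
    have "real p \<le> y" if "p \<in> prime_factors m" for p
    proof -
      have "p \<le> m" using that m by (auto simp: in_prime_factors_iff intro: dvd_imp_le)
      then have "p \<le> n" using m by simp
      then have "real p \<le> real n" by simp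
      then show ?thesis using assms by (rule order_trans)
    qed
    then show "m \<in> {m. m \<in> smooth_over (primes_upto y) \<and> real m \<le> real n}"
      using m by (auto simp: smooth_over_def primes_upto_def)
  qed (auto simp: Suc_le_eq dest: smooth_over_pos)
  then show ?thesis by (simp only: Psi_def half_sum_def)
qed

text \<open>One scale, with the numerical requirements on k as hypotheses. The exceptional variable
  Z has four parts, each of mean at most 1/k^2: mean squares above \<Lambda>, increments over the
  blocks, the distance to the Euler product over the first primes, and gaps between test points.
  Where Z < 1 a telescoping sum along the blocks finishes the argument.\<close>

lemma scale_deterministic:
  assumes k: "2 ^ 67 \<le> real k"
    and win: "\<forall>w. w \<ge> exp (2 ^ k / (1024 * real k)) \<longrightarrow>
      (\<Sum>p | prime p \<and> w < real p \<and> real p \<le> w * exp (mesh_width k). 1 / real p) \<le> window_bound k"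
    and mert: "mertens (primes_upto (exp (2 ^ (k + 2)))) \<le> 2 ^ k * real k ^ 3"
    and n1: "4 * (2048 * real k) \<le> 2 ^ k" and n2: "64 * real k \<le> exp (2 ^ k / (1024 * real k))"
    and n3: "64 * real k * window_bound k \<le> 1"
    and n5: "2 ^ 26 * real k ^ 3 * (2 ^ (11 * k) * (2 ^ 28 * real k ^ 3 / 2 ^ (20 * k) + 1 / 2 ^ (16 * k))) \<le> 1 / real k ^ 2"
    and n6: "2 ^ (11 * k) * (exp 36 / 2 ^ (92 * k)) \<le> 1 / real k ^ 2"
    and n7: "2 ^ (11 * k) * (real (2 ^ (k + 1)) + 1) ^ 4 * (1 / 2 ^ (8 * k))\<^sup>2 \<le> 1 / real k ^ 2"
    and n8: "(1 + 2 ^ k)\<^sup>2 / (1 / 2 ^ (8 * k)) + 1 \<le> (2 ^ (11 * k) :: real)"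
    and B: "B \<ge> 1"
  shows "\<exists>Z\<in>borel_measurable M. (\<integral>\<^sup>+\<omega>. Z \<omega> \<partial>M) \<le> ennreal (4 / real k ^ 2) \<and>
    (\<forall>\<omega>\<in>euler_bounded k B. Z \<omega> < 1 \<longrightarrow> (\<forall>n. exp (2 ^ (k - 2)) \<le> real n \<and> real n \<le> exp (2 ^ k) \<longrightarrow>
      norm (half_sum n \<omega>) \<le> real k ^ 12 * sqrt B))"
proof -
  have k1: "real k \<ge> 1" "real k > 0" using k by auto
  define \<delta> where "\<delta> = mesh_width k"
  have \<delta>: "0 < \<delta>" "\<delta> \<le> 1" by (auto simp: \<delta>_def mesh_width_def)
  \<comment> \<open>2^h, of order k, is the ratio of the range 2^(k+1) of u to 2^K. It is large
    enough for the hypothesis of \<open>mean_square_bound\<close> and for the Euler product over p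
    <= exp (2^K) to approximate the sum at every x of the scale.\<close>
  obtain h where h: "1024 * real k \<le> 2 ^ h" "(2::real) ^ h \<le> 2 * (1024 * real k)"
    using pow2_between[of "1024 * real k"] k1 by auto
  \<comment> \<open>The moment order is fixed by exp (-(2^s)) <= 2^(-16 * k), which outweighs the at
    most 2^(11 * k) test points.\<close>
  obtain s where s: "16 * real k \<le> 2 ^ s" "(2::real) ^ s \<le> 2 * (16 * real k)"
    using pow2_between[of "16 * real k"] k1 by auto
  have "(2::real) ^ (h + 2) \<le> 2 ^ k" using h n1 by simp
  then have hk: "h + 2 \<le> k" by (rule power_le_imp_le_exp[rotated]) simp
  have h3: "h \<ge> 3"
  proof (rule ccontr)
    assume "\<not> h \<ge> 3"
    then have "(2::real) ^ h \<le> 2 ^ 3" by (intro power_increasing) auto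
    then show False using h k1 by simp
  qed
  \<comment> \<open>K + h = k + 1, so the mean square extends to u <= 2^(k+1). This leaves room for
    the shift by \<delta> beyond ln x <= 2^k.\<close>
  define K where "K = k + 1 - h"
  have K: "K + h = k + 1" "1 \<le> K" "K \<le> k" using hk h3 by (auto simp: K_def)
  have KK: "(2::real) ^ K * 2 ^ h = 2 * 2 ^ k" using K(1) by (simp add: power_add[symmetric])
  have K_le: "(2::real) ^ K \<le> 2 ^ k" using K by (intro power_increasing) auto
  have y0: "2 ^ k / (1024 * real k) \<le> (2::real) ^ K"
  proof -
    have "2 * 2 ^ k \<le> (2::real) ^ K * (2 * (1024 * real k))"
      unfolding KK[symmetric] using h by (intro mult_left_mono) auto
    then show ?thesis using k1 by (simp add: field_simps)
  qed
  have window_bound0: "window_bound k > 0" using k1 \<delta> by (simp add: window_bound_def \<delta>_def)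
  \<comment> \<open>How many windows of width \<delta> a block may contain if its reciprocal sum is
    to be at most 1 / (2 * 2^s).\<close>
  define X where "X = 1 / (2 * 2 ^ s * window_bound k)"
  define nb where "nb = nat \<lfloor>X\<rfloor>"
  have X1: "X \<ge> 1"
  proof -
    have "2 * 2 ^ s * window_bound k \<le> 64 * real k * window_bound k" using s window_bound0 by (intro mult_right_mono) auto
    then have "2 * 2 ^ s * window_bound k \<le> 1" using n3 by linarith
    moreover have "0 < 2 * 2 ^ s * window_bound k" using window_bound0 by simp
    ultimately show ?thesis unfolding X_def by (subst pos_le_divide_eq) auto
  qed
  have nb: "real nb \<le> X" "X / 2 \<le> real nb" "real nb \<ge> 1"
  proof -
    have "real nb = real_of_int \<lfloor>X\<rfloor>" unfolding nb_def using X1 by simp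
    moreover have "1 \<le> \<lfloor>X\<rfloor>" using X1 by simp
    moreover from this have "1 \<le> real_of_int \<lfloor>X\<rfloor>" by (simp only: of_int_1_le_iff)
    moreover have "X < real_of_int \<lfloor>X\<rfloor> + 1" "real_of_int \<lfloor>X\<rfloor> \<le> X" by linarith+
    ultimately show "real nb \<le> X" "X / 2 \<le> real nb" "real nb \<ge> 1" by linarith+
  qed
  define \<Delta> where "\<Delta> = real nb * \<delta>"
  have X\<delta>: "X * \<delta> = 2 ^ k / (2 * 2 ^ s * (2 ^ 18 * real k ^ 2))"
    using \<delta> k1 by (simp add: X_def window_bound_def \<delta>_def[symmetric])
  have \<Delta>0: "\<Delta> > 0" using nb \<delta> by (simp add: \<Delta>_def)
  have \<Delta>_le: "\<Delta> \<le> 2 ^ k"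
  proof -
    have "\<Delta> \<le> X * \<delta>" using nb \<delta> by (simp add: \<Delta>_def)
    also have "\<dots> \<le> 2 ^ k / 1" unfolding X\<delta>
      using k1 by (intro divide_left_mono) (auto intro!: mult_ge1_I)
    finally show ?thesis by simp
  qed
  have \<Delta>_ge: "2 ^ k \<le> \<Delta> * (2 ^ 25 * real k ^ 3)"
  proof -
    have "X * \<delta> / 2 \<le> \<Delta>" using mult_right_mono[OF nb(2), of \<delta>] \<delta> by (simp add: \<Delta>_def)
    moreover have "2 ^ k / (2 ^ 25 * real k ^ 3) \<le> X * \<delta> / 2"
    proof -
      have "2 * (2 * 2 ^ s * (2 ^ 18 * real k ^ 2)) \<le> 2 * (2 * (2 * (16 * real k)) * (2 ^ 18 * real k ^ 2))"
        using s by (intro mult_left_mono mult_right_mono) auto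
      also have "\<dots> = 2 ^ 25 * real k ^ 3" by (simp add: power2_eq_square power3_eq_cube)
      finally have "2 ^ k / (2 ^ 25 * real k ^ 3) \<le> 2 ^ k / (2 * (2 * 2 ^ s * (2 ^ 18 * real k ^ 2)))"
        using k1 by (intro divide_left_mono) auto
      then show ?thesis unfolding X\<delta> by (simp add: mult.commute)
    qed
    ultimately have "2 ^ k / (2 ^ 25 * real k ^ 3) \<le> \<Delta>" by linarith
    then show ?thesis using k1 by (simp add: pos_divide_le_eq)
  qed
  \<comment> \<open>Blocks of logarithmic length \<Delta>, at least of order 2^k / k^3, cover a
    length 2^k, so polynomially many suffice. The last one may overshoot; since \<Delta> <= 2^k the
    primes stay below exp (2^(k+2)).\<close>
  define J where "J = nat \<lceil>2 ^ k / \<Delta>\<rceil>"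
  have J: "2 ^ k \<le> real J * \<Delta>" "real J * \<Delta> \<le> 2 ^ k + \<Delta>" "real J + 1 \<le> 2 ^ 26 * real k ^ 3"
  proof -
    have q0: "0 < 2 ^ k / \<Delta>" using \<Delta>0 by simp
    then have "real J = real_of_int \<lceil>2 ^ k / \<Delta>\<rceil>" unfolding J_def by (intro of_nat_nat) linarith
    then have J': "2 ^ k / \<Delta> \<le> real J" "real J \<le> 2 ^ k / \<Delta> + 1" by linarith+
    show "2 ^ k \<le> real J * \<Delta>" using J'(1) \<Delta>0 by (simp add: pos_divide_le_eq)
    have "real J * \<Delta> \<le> (2 ^ k / \<Delta> + 1) * \<Delta>" using J'(2) \<Delta>0 by (intro mult_right_mono) auto
    then show "real J * \<Delta> \<le> 2 ^ k + \<Delta>" using \<Delta>0 by (simp add: distrib_right)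
    have "2 ^ k / \<Delta> \<le> 2 ^ 25 * real k ^ 3" using \<Delta>_ge \<Delta>0 by (simp add: pos_divide_le_eq mult.commute)
    moreover have "1 \<le> real k ^ 3" using k1 by simp
    ultimately show "real J + 1 \<le> 2 ^ 26 * real k ^ 3" using J'(2) by simp
  qed
  define yl where "yl j = 2 ^ K + real j * \<Delta>" for j
  define S where "S j = primes_upto (exp (yl j))" for j
  define T where "T j = S (Suc j) - S j" for j
  have yl_mono: "yl j \<le> yl (Suc j)" for j using \<Delta>0 by (simp add: yl_def distrib_right)
  have yl_le: "yl j \<le> 2 ^ (k + 2)" if "j \<le> J" for j
  proof -
    have "real j * \<Delta> \<le> real J * \<Delta>" using that \<Delta>0 by (intro mult_right_mono) auto
    moreover have "(2::real) ^ (k + 2) = 4 * 2 ^ k" "0 \<le> (2::real) ^ k" by simp_all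
    ultimately show ?thesis unfolding yl_def using J(2) \<Delta>_le K_le by linarith
  qed
  have yl0: "2 ^ K \<le> yl j" for j using \<Delta>0 by (simp add: yl_def)
  have S: "S j \<subseteq> {p. prime p}" "finite (S j)" for j by (auto simp: S_def primes_upto_def)
  have SS: "S j \<subseteq> S (Suc j)" for j unfolding S_def using yl_mono[of j] by (intro primes_upto_mono) simp
  have ST: "S j \<union> T j = S (Suc j)" "S j \<inter> T j = {}" "T j \<subseteq> {p. prime p}" "finite (T j)" for j
    using SS[of j] S[of "Suc j"] by (auto simp: T_def)
  have pb: "prime_block M g (S j) (T j) (exp (yl j)) \<delta> (window_bound k) s" for j
  proof (unfold_locales)
    show "exp (yl j) < real p" if "p \<in> T j" for p using that by (auto simp: T_def S_def primes_upto_def)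
    have big: "exp (2 ^ k / (1024 * real k)) \<le> exp (yl j)" using y0 yl0[of j] by simp
    show "2 * 2 ^ s \<le> exp (yl j)" using s n2 big by linarith
    show win': "(\<Sum>p | prime p \<and> w < real p \<and> real p \<le> w * exp \<delta>. 1 / real p) \<le> window_bound k" if "exp (yl j) \<le> w" for w
      using win big that unfolding \<delta>_def by (meson order_trans)
    have "yl (Suc j) = yl j + real nb * \<delta>" by (simp add: yl_def \<Delta>_def distrib_right)
    then have e: "exp (yl (Suc j)) = exp (yl j) * exp (real nb * \<delta>)" by (simp only: exp_add)
    have "T j \<subseteq> {p. prime p \<and> exp (yl j) < real p \<and> real p \<le> exp (yl j) * exp (real nb * \<delta>)}"
      unfolding T_def S_def primes_upto_def e by auto
    then have "(\<Sum>p\<in>T j. 1 / real p) \<le> (\<Sum>p | prime p \<and> exp (yl j) < real p \<and> real p \<le> exp (yl j) * exp (real nb * \<delta>). 1 / real p)"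
      by (intro sum_mono2 finite_subset[OF _ finite_nat_le_real[of "exp (yl j) * exp (real nb * \<delta>)"]]) auto
    also have "\<dots> \<le> real nb * window_bound k"
      by (rule window_chain[where ?w0.0 = "exp (yl j)", OF win']) (use \<delta> in auto)
    also have "\<dots> \<le> X * window_bound k" using nb window_bound0 by (intro mult_right_mono) auto
    also have "\<dots> = 1 / (2 * 2 ^ s)" using window_bound0 by (simp add: X_def)
    finally show "(\<Sum>p\<in>T j. 1 / real p) \<le> 1 / (2 * 2 ^ s)" .
  qed (use S ST \<delta> in auto)
  define \<kappa> where "\<kappa> = 2 ^ s * exp 1 * window_bound k"
  have \<kappa>0: "\<kappa> > 0" using window_bound0 by (simp add: \<kappa>_def)
  have \<kappa>: "2 * \<kappa> / \<delta> \<le> 2 ^ 26 * real k ^ 3 / 2 ^ k"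
  proof -
    have "2 * \<kappa> / \<delta> = 2 * 2 ^ s * exp 1 * (2 ^ 18 * real k ^ 2 / 2 ^ k)"
      using \<delta> by (simp add: \<kappa>_def window_bound_def \<delta>_def[symmetric])
    also have "\<dots> \<le> 2 * (2 * (16 * real k)) * 4 * (2 ^ 18 * real k ^ 2 / 2 ^ k)"
      using s exp_le by (intro mult_mono) auto
    also have "\<dots> \<le> 2 ^ 26 * real k ^ 3 / 2 ^ k"
      by (simp add: power2_eq_square power3_eq_cube)
    finally show ?thesis .
  qed
  \<comment> \<open>The bound for each mean square, times J + 1 for the sum over the blocks, times
    k^2 for summability over k. In 2 * \<kappa> / \<delta> * \<Lambda> the powers of two cancel down
    to 2^66 * k^13 * B, and k >= 2^67 absorbs the constant into w = k^14 * B.\<close>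
  define \<Lambda> where "\<Lambda> = (2 ^ k * real k ^ 3) * (2 ^ 14 * real k ^ 2 * B) * (real J + 1) * real k ^ 2"
  have \<Lambda>0: "\<Lambda> > 0" using k1 B by (simp add: \<Lambda>_def)
  define w where "w = real k ^ 14 * B"
  have w0: "w > 0" using k1 B by (simp add: w_def)
  have w_ge: "2 * \<kappa> / \<delta> * \<Lambda> + 1 \<le> w"
  proof -
    have "2 * \<kappa> / \<delta> * \<Lambda> \<le> (2 ^ 26 * real k ^ 3 / 2 ^ k) * ((2 ^ k * real k ^ 3) * (2 ^ 14 * real k ^ 2 * B) * (2 ^ 26 * real k ^ 3) * real k ^ 2)"
      unfolding \<Lambda>_def using \<kappa> J(3) k1 B \<kappa>0 \<delta>
      by (intro mult_mono mult_left_mono mult_right_mono) auto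
    also have "\<dots> = 2 ^ 66 * real k ^ 13 * B"
      by (simp add: field_simps eval_nat_numeral)
    finally have 1: "2 * \<kappa> / \<delta> * \<Lambda> \<le> 2 ^ 66 * real k ^ 13 * B" .
    have "1 * 1 \<le> real k ^ 13 * B" using k1 B by (intro mult_mono) auto
    moreover have "2 ^ 66 * c + 1 \<le> 2 ^ 67 * c" if "1 * 1 \<le> c" for c :: real using that by simp
    ultimately have "2 ^ 66 * (real k ^ 13 * B) + 1 \<le> 2 ^ 67 * (real k ^ 13 * B)" by blast
    also have "\<dots> \<le> real k * (real k ^ 13 * B)" using k k1 B by (intro mult_right_mono) auto
    also have "\<dots> = w" by (simp add: w_def eval_nat_numeral)
    finally show ?thesis using 1 unfolding mult.assoc by linarith
  qed
  define I where "I = {n::nat. exp (2 ^ (k - 2)) \<le> real n \<and> real n \<le> exp (2 ^ k)}"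
  define N where "N = nat \<lfloor>exp (2 ^ k :: real)\<rfloor>"
  have Nle: "real N \<le> exp (2 ^ k)" unfolding N_def by (intro of_nat_floor) simp
  have N1: "N \<ge> 1"
  proof -
    have "real 1 \<le> exp (2 ^ k :: real)" by simp
    then show ?thesis unfolding N_def by (subst (asm) real_le_iff_nat_floor) auto
  qed
  have I_N: "I \<subseteq> {1..N}"
  proof
    fix n assume n: "n \<in> I"
    have "0 < exp (2 ^ (k - 2) :: real)" by simp
    then have "real n > 0" using n unfolding I_def mem_Collect_eq by linarith
    moreover have "n \<le> N" unfolding N_def using n by (subst real_le_iff_nat_floor[symmetric]) (auto simp: I_def)
    ultimately show "n \<in> {1..N}" by simp
  qed
  have N_pow: "N \<le> 2 ^ (2 ^ (k + 1))"
  proof -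
    have "exp (2 ^ k :: real) = exp 1 ^ (2 ^ k)" by (simp add: exp_of_nat_mult[symmetric])
    also have "\<dots> \<le> 4 ^ (2 ^ k)" using exp_le by (intro power_mono) auto
    also have "(4::real) ^ (2 ^ k) = 2 ^ (2 * 2 ^ k)" by (simp add: power_mult)
    also have "(2::real) ^ (2 * 2 ^ k) = real (2 ^ (2 ^ (k + 1)))" by simp
    finally have "real N \<le> real (2 ^ (2 ^ (k + 1)))" using Nle by linarith
    then show ?thesis by (simp only: of_nat_le_iff)
  qed
  \<comment> \<open>Balances two requirements: there are about 2^(2 * k) / \<eta> = 2^(10 * k) test
    points, and the gap term has mean at most a constant times 2^(11 * k) * 2^(4 * k) * \<eta>^2 =
    2^(-k).\<close>
  define \<eta> :: real where "\<eta> = 1 / 2 ^ (8 * k)"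
  have \<eta>0: "\<eta> > 0" by (simp add: \<eta>_def)
  obtain P t R where P: "P \<subseteq> I" "real (card P) \<le> (1 + ln N)\<^sup>2 / \<eta> + 1"
    and t: "\<And>n. n \<in> I \<Longrightarrow> t n \<in> P \<and> t n \<le> n"
    and R: "R \<in> borel_measurable M" "\<And>\<omega>. R \<omega> \<ge> 0"
      "(\<integral>\<^sup>+\<omega>. ennreal (R \<omega>) \<partial>M) \<le> ennreal (card P * (real (2 ^ (k + 1)) + 1) ^ 4 * \<eta>\<^sup>2)"
      "\<And>n \<omega>. n \<in> I \<Longrightarrow> norm (\<Sum>m\<in>{t n<..n}. F m \<omega> / of_real (sqrt m)) ^ 4 \<le> R \<omega>"
  proof (rule test_points[OF \<eta>0 I_N N1 N_pow], goal_cases)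
    case (1 P t R)
    show ?case by (rule 1(1)[OF 1(2-8)])
  qed
  have finP: "finite P" by (rule finite_subset[OF subset_trans[OF P(1) I_N]]) simp
  have pk: "(1::real) \<le> 2 ^ k" by simp
  have cardP: "real (card P) \<le> 2 ^ (11 * k)"
  proof -
    have "ln (real N) \<le> ln (exp (2 ^ k))" using Nle N1 by (intro ln_mono) auto
    then have "ln (real N) \<le> 2 ^ k" by (simp only: ln_exp)
    moreover have "0 \<le> ln (real N)" using N1 by simp
    ultimately have "(1 + ln (real N))\<^sup>2 \<le> (1 + 2 ^ k)\<^sup>2" by (intro power_mono add_left_mono add_nonneg_nonneg zero_le_one)
    then have "(1 + ln (real N))\<^sup>2 / \<eta> + 1 \<le> (1 + 2 ^ k)\<^sup>2 / \<eta> + 1"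
      using \<eta>0 by (intro add_right_mono divide_right_mono) auto
    also have "\<dots> \<le> 2 ^ (11 * k)" using n8 unfolding \<eta>_def .
    finally show ?thesis using P(2) by linarith
  qed
  have x: "1 \<le> real n \<and> ln (real n) \<le> 2 ^ k" if "n \<in> P" for n
  proof -
    have n: "n \<in> I" "1 \<le> n" using that P(1) I_N by auto
    then have "ln (real n) \<le> ln (exp (2 ^ k))" by (intro ln_mono) (auto simp: I_def)
    then show ?thesis using n by simp
  qed
  define XP where "XP = real ` P"
  have XP: "finite XP" "card XP = card P" "\<And>x. x \<in> XP \<Longrightarrow> 1 \<le> x \<and> ln x \<le> 2 ^ k"
    using finP x by (auto simp: XP_def card_image)
  have KU: "(2::real) ^ k + \<delta> \<le> 2 ^ (k + 1)"
  proof -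
    have "(2::real) ^ (k + 1) = 2 * 2 ^ k" by simp
    then show ?thesis using \<delta> pk by linarith
  qed
  define ctrl where "ctrl j Q \<longleftrightarrow> Q \<in> borel_measurable M \<and>
      (\<integral>\<^sup>+\<omega>. Q \<omega> \<partial>M) \<le> ennreal (card XP * (2 * \<kappa> * (1 + 2 ^ k + \<delta>) + exp (- (2 ^ s)))) \<and>
      (\<forall>\<omega>\<in>space M. Q \<omega> < 1 \<longrightarrow> mean_sq (S j) (2 ^ (k + 1)) \<omega> \<le> ennreal \<Lambda> \<longrightarrow>
        (\<forall>x\<in>XP. (norm (Psi (S j \<union> T j) x \<omega> - Psi (S j) x \<omega>))\<^sup>2 \<le> exp 1 * w))" for j Q
  have "\<exists>Q. ctrl j Q" for j
  proof -
    have "prime_block.\<kappa> (window_bound k) s = \<kappa>" unfolding prime_block.\<kappa>_def[OF pb[of j]] \<kappa>_def ..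
    then show ?thesis
      using prime_block.block_control[OF pb[of j] XP(1,3) KU w0 less_imp_le[OF \<Lambda>0]] w_ge
      unfolding ctrl_def by simp
  qed
  then obtain Q where Q': "\<And>j. ctrl j (Q j)" using choice[of ctrl] by blast
  have Q: "\<And>j. Q j \<in> borel_measurable M"
    "\<And>j. (\<integral>\<^sup>+\<omega>. Q j \<omega> \<partial>M) \<le> ennreal (card XP * (2 * \<kappa> * (1 + 2 ^ k + \<delta>) + exp (- (2 ^ s))))"
    "\<And>j \<omega> x. \<omega> \<in> space M \<Longrightarrow> Q j \<omega> < 1 \<Longrightarrow> mean_sq (S j) (2 ^ (k + 1)) \<omega> \<le> ennreal \<Lambda> \<Longrightarrow>
        x \<in> XP \<Longrightarrow> (norm (Psi (S j \<union> T j) x \<omega> - Psi (S j) x \<omega>))\<^sup>2 \<le> exp 1 * w"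
    using Q' unfolding ctrl_def by blast+
  define G where "G = euler_bounded K B"
  have S0: "S 0 = primes_upto (exp (2 ^ K))" by (simp add: S_def yl_def)
  have G: "G \<in> sets (prime_sigma (S 0))" unfolding G_def S0 by (rule euler_bounded_prime_sigma)
  have GM: "G \<in> events" using G sets_prime_sigma_subset[OF S(1)] by blast
  define V where "V = 2 ^ h + real K * (2 ^ (h + 1) * (B + 1))"
  have V: "V \<le> 2 ^ 14 * real k ^ 2 * B" "V \<ge> 0"
  proof -
    have kk: "real k \<le> real k ^ 2" using k1 self_le_power[of "real k" 2] by simp
    have "2 ^ h \<le> 2 ^ 11 * real k * 1" using h by simp
    also have "\<dots> \<le> 2 ^ 11 * real k ^ 2 * B" using kk B by (intro mult_mono) auto
    finally have a: "2 ^ h \<le> 2048 * (real k ^ 2 * B)" by simp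
    have "real K * (2 ^ (h + 1) * (B + 1)) \<le> real k * ((2 * (2 * (1024 * real k))) * (2 * B))"
      using K h B by (intro mult_mono) auto
    also have "\<dots> = 2 ^ 13 * real k ^ 2 * B" by (simp add: power2_eq_square)
    finally have b: "real K * (2 ^ (h + 1) * (B + 1)) \<le> 8192 * (real k ^ 2 * B)" by simp
    have "0 \<le> real k ^ 2 * B" using B by simp
    then have "V \<le> 16384 * (real k ^ 2 * B)" using a b unfolding V_def by linarith
    then show "V \<le> 2 ^ 14 * real k ^ 2 * B" by simp
    show "V \<ge> 0" using B by (simp add: V_def)
  qed
  have base: "(\<integral>\<^sup>+\<omega>. mean_sq (S 0) (2 ^ (k + 1)) \<omega> * indicator G \<omega> \<partial>M) \<le> ennreal (mertens (S 0) * V)"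
  proof -
    have "36 * (real K + 2) \<le> 2 ^ (h - 1)"
    proof -
      have "(2::real) ^ h = 2 * 2 ^ (h - 1)" using h3 by (cases h) auto
      moreover have "36 * (real K + 2) \<le> 512 * real k" using K k by simp
      ultimately show ?thesis using h by linarith
    qed
    then show ?thesis
      using mean_square_bound[of B h K K] B h3 unfolding S0 G_def V_def K(1) by simp
  qed
  \<comment> \<open>All primes above exp (2^K) are averaged out in one go, as G does not involve
    them; the Mertens products of the two parts multiply to that of \<open>S j\<close>.\<close>
  have mean: "(\<integral>\<^sup>+\<omega>. mean_sq (S j) (2 ^ (k + 1)) \<omega> * indicator G \<omega> \<partial>M) \<le> ennreal (2 ^ k * real k ^ 3 * (2 ^ 14 * real k ^ 2 * B))"
    if j: "j \<le> J" for j
  proof -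
    have S0j: "S 0 \<subseteq> S j" using yl0[of j] unfolding S0 unfolding S_def by (intro primes_upto_mono) simp
    define D where "D = S j - S 0"
    have D: "S 0 \<union> D = S j" "S 0 \<inter> D = {}" "D \<subseteq> {p. prime p}" "finite D" using S0j S by (auto simp: D_def)
    have m1: "mertens D \<ge> 1" "mertens (S 0) \<ge> 1" using mertens_ge_1[OF D(4)] mertens_ge_1[OF S(2)[of 0]] D(3) S(1)[of 0] by blast+
    have "(\<integral>\<^sup>+\<omega>. mean_sq (S j) (2 ^ (k + 1)) \<omega> * indicator G \<omega> \<partial>M)
       \<le> ennreal (mertens D) * (\<integral>\<^sup>+\<omega>. mean_sq (S 0) (2 ^ (k + 1)) \<omega> * indicator G \<omega> \<partial>M)"
      using mean_sq_supermartingale[OF S(1) D(3,2,4) G] unfolding D(1) .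
    also have "\<dots> \<le> ennreal (mertens D) * ennreal (mertens (S 0) * V)" by (intro mult_left_mono base) auto
    also have "\<dots> = ennreal (mertens (S j) * V)"
      using m1 V D S mertens_Un[OF S(2)[of 0] D(4,2)] unfolding D(1) by (simp add: ennreal_mult[symmetric] mult_ac)
    also have "\<dots> \<le> ennreal (2 ^ k * real k ^ 3 * (2 ^ 14 * real k ^ 2 * B))"
    proof (intro ennreal_leI mult_mono V)
      have "mertens (S j) \<le> mertens (primes_upto (exp (2 ^ (k + 2))))"
        unfolding S_def using yl_le[OF j] primes_upto_subset by (intro mertens_mono primes_upto_mono) auto
      then show "mertens (S j) \<le> 2 ^ k * real k ^ 3" using mert by linarith
    qed (use k1 in auto)
    finally show ?thesis .
  qed
  define Z1 where "Z1 \<omega> = (\<Sum>j<J. ennreal (1 / \<Lambda>) * (mean_sq (S j) (2 ^ (k + 1)) \<omega> * indicator G \<omega>))" for \<omega>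
  define Z2 where "Z2 \<omega> = (\<Sum>j<J. Q j \<omega>)" for \<omega>
  define Z3 where "Z3 \<omega> = (\<Sum>x\<in>XP. ennreal ((norm (euler_prod (S 0) \<omega> - Psi (S 0) x \<omega>))\<^sup>2))" for \<omega>
  have [measurable]: "mean_sq (S j) U \<in> borel_measurable M" "Q j \<in> borel_measurable M" "euler_prod (S j) \<in> borel_measurable M" "Psi (S j) z \<in> borel_measurable M" "G \<in> events" for j U z
    using mean_sq_M Q euler_prod_M Psi_M S GM by auto
  note R(1)[measurable]
  have Z1M: "Z1 \<in> borel_measurable M" unfolding Z1_def[abs_def] by measurable
  have Z2M: "Z2 \<in> borel_measurable M" unfolding Z2_def[abs_def] by measurable
  have Z3M: "Z3 \<in> borel_measurable M" unfolding Z3_def[abs_def] by measurable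
  have E1: "(\<integral>\<^sup>+\<omega>. Z1 \<omega> \<partial>M) \<le> ennreal (1 / real k ^ 2)"
  proof -
    let ?m = "2 ^ k * real k ^ 3 * (2 ^ 14 * real k ^ 2 * B)"
    have m0: "?m > 0" using k1 B by simp
    have "(\<integral>\<^sup>+\<omega>. Z1 \<omega> \<partial>M) = (\<Sum>j<J. ennreal (1 / \<Lambda>) * (\<integral>\<^sup>+\<omega>. mean_sq (S j) (2 ^ (k + 1)) \<omega> * indicator G \<omega> \<partial>M))"
      unfolding Z1_def by (rule nn_integral_sum_cmult) measurable
    also have "\<dots> \<le> (\<Sum>j<J. ennreal (1 / \<Lambda>) * ennreal ?m)"
      by (intro sum_mono mult_left_mono mean) auto
    also have "\<dots> = ennreal (real J * (1 / \<Lambda> * ?m))"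
      using \<Lambda>0 m0 by (simp add: ennreal_of_nat_eq_real_of_nat ennreal_mult[symmetric])
    also have "\<dots> \<le> ennreal (1 / real k ^ 2)"
    proof (rule ennreal_leI)
      have gen: "u * (1 / (m * (u + 1) * c) * m) = u / (u + 1) * (1 / c)" if "m > 0" "c > 0" for u m c :: real
        using that by simp
      have "real J * (1 / \<Lambda> * ?m) = real J / (real J + 1) * (1 / real k ^ 2)"
        unfolding \<Lambda>_def by (rule gen[OF m0]) (use k1 in simp)
      also have "\<dots> \<le> 1 * (1 / real k ^ 2)" by (intro mult_right_mono) auto
      finally show "real J * (1 / \<Lambda> * ?m) \<le> 1 / real k ^ 2" by simp
    qed
    finally show ?thesis .
  qed
  have E2: "(\<integral>\<^sup>+\<omega>. Z2 \<omega> \<partial>M) \<le> ennreal (1 / real k ^ 2)"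
  proof -
    let ?e = "real (card XP) * (2 * \<kappa> * (1 + 2 ^ k + \<delta>) + exp (- (2 ^ s)))"
    have e0: "?e \<ge> 0" using \<kappa>0 \<delta> by (intro mult_nonneg_nonneg add_nonneg_nonneg) auto
    have "(\<integral>\<^sup>+\<omega>. Z2 \<omega> \<partial>M) = (\<Sum>j<J. (\<integral>\<^sup>+\<omega>. Q j \<omega> \<partial>M))"
      unfolding Z2_def by (rule nn_integral_sum) measurable
    also have "\<dots> \<le> (\<Sum>j<J. ennreal ?e)" by (intro sum_mono Q)
    also have "\<dots> = ennreal (real J * ?e)"
      using e0 by (simp add: ennreal_of_nat_eq_real_of_nat ennreal_mult[symmetric])
    also have "\<dots> \<le> ennreal (1 / real k ^ 2)"
    proof (rule ennreal_leI)
      have k2: "1 + 2 ^ k + \<delta> \<le> 4 * 2 ^ k" using \<delta> pk by linarith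
      have "2 * \<kappa> = (2 * \<kappa> / \<delta>) * \<delta>" using \<delta> by simp
      also have "\<dots> \<le> (2 ^ 26 * real k ^ 3 / 2 ^ k) * \<delta>" using \<kappa> \<delta> by (intro mult_right_mono) auto
      finally have "2 * \<kappa> \<le> (2 ^ 26 * real k ^ 3 / 2 ^ k) * \<delta>" .
      from mult_mono[OF this k2] have "2 * \<kappa> * (1 + 2 ^ k + \<delta>) \<le> ((2 ^ 26 * real k ^ 3 / 2 ^ k) * \<delta>) * (4 * 2 ^ k)"
        using k1 \<delta> by (simp add: add_nonneg_nonneg)
      also have "\<dots> = 2 ^ 28 * real k ^ 3 / 2 ^ (20 * k)" by (simp add: \<delta>_def mesh_width_def)
      finally have a: "2 * \<kappa> * (1 + 2 ^ k + \<delta>) \<le> 2 ^ 28 * real k ^ 3 / 2 ^ (20 * k)" .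
      have b: "exp (- (2 ^ s :: real)) \<le> 1 / 2 ^ (16 * k)"
      proof -
        have "(2::real) ^ (16 * k) \<le> exp 1 ^ (16 * k)" using exp_ge_add_one_self[of 1] by (intro power_mono) auto
        also have "\<dots> = exp (16 * real k)" by (simp add: exp_of_nat_mult[symmetric])
        also have "\<dots> \<le> exp (2 ^ s)" using s by simp
        finally show ?thesis by (simp add: exp_minus field_simps)
      qed
      have "real J * ?e \<le> (2 ^ 26 * real k ^ 3) * (2 ^ (11 * k) * (2 ^ 28 * real k ^ 3 / 2 ^ (20 * k) + 1 / 2 ^ (16 * k)))"
        unfolding XP(2) using J(3) cardP a b \<kappa>0 \<delta> by (intro mult_mono add_mono add_nonneg_nonneg) auto
      also have "\<dots> \<le> 1 / real k ^ 2" using n5 .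
      finally show "real J * ?e \<le> 1 / real k ^ 2" .
    qed
    finally show ?thesis .
  qed
  have E3: "(\<integral>\<^sup>+\<omega>. Z3 \<omega> \<partial>M) \<le> ennreal (1 / real k ^ 2)"
  proof -
    have one: "(\<integral>\<^sup>+\<omega>. ennreal ((norm (euler_prod (S 0) \<omega> - Psi (S 0) x \<omega>))\<^sup>2) \<partial>M) \<le> ennreal (exp 36 / 2 ^ (92 * k))" if "x \<in> XP" for x
    proof -
      obtain n where n: "n \<in> I" "x = real n" using \<open>x \<in> XP\<close> P(1) by (auto simp: XP_def)
      have x1: "x \<ge> 1" using XP(3)[OF that] by simp
      have "exp (2 ^ (k - 2)) \<le> x" using n by (simp add: I_def)
      then have "ln (exp (2 ^ (k - 2))) \<le> ln x" by (intro ln_mono) auto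
      then have lx: "2 ^ (k - 2) \<le> ln x" by simp
      \<comment> \<open>The lower end exp (2^(k-2)) of the scale enters here: the gain is 2^h / 8 >=
        128 * k, against the loss 36 * (K + 1) <= 36 * k + 36.\<close>
      have "(2::real) ^ (k - 2) / 2 ^ K = 2 ^ (h - 3)"
      proof -
        have "k - 2 = K + (h - 3)" using K h3 by simp
        then show ?thesis by (simp add: power_add)
      qed
      moreover have "(2::real) ^ (k - 2) / 2 ^ K \<le> ln x / 2 ^ K" using lx by (intro divide_right_mono) auto
      moreover have "(2::real) ^ h = 8 * 2 ^ (h - 3)"
      proof -
        have "h = (h - 3) + 3" using h3 by simp
        then have "(2::real) ^ h = 2 ^ (h - 3) * 2 ^ 3" by (metis power_add)
        then show ?thesis by simp
      qed
      ultimately have "128 * real k \<le> ln x / 2 ^ K" using h by linarith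
      then have ex: "36 * (real K + 1) - ln x / 2 ^ K \<le> 36 - 92 * real k" using K by simp
      have "(\<integral>\<^sup>+\<omega>. ennreal ((norm (euler_prod (S 0) \<omega> - Psi (S 0) x \<omega>))\<^sup>2) \<partial>M) \<le> ennreal (exp (36 * (real K + 1) - ln x / 2 ^ K))"
        unfolding S0 by (rule tail_bound[OF K(2) x1])
      also have "\<dots> \<le> ennreal (exp (36 - 92 * real k))" using ex by (intro ennreal_leI) simp
      also have "\<dots> \<le> ennreal (exp 36 / 2 ^ (92 * k))"
      proof (rule ennreal_leI)
        have "(2::real) ^ (92 * k) \<le> exp 1 ^ (92 * k)" using exp_ge_add_one_self[of 1] by (intro power_mono) auto
        also have "\<dots> = exp (92 * real k)" by (simp add: exp_of_nat_mult[symmetric])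
        finally show "exp (36 - 92 * real k) \<le> exp 36 / 2 ^ (92 * k)"
          unfolding exp_diff by (intro divide_left_mono) auto
      qed
      finally show ?thesis .
    qed
    have "(\<integral>\<^sup>+\<omega>. Z3 \<omega> \<partial>M) = (\<Sum>x\<in>XP. (\<integral>\<^sup>+\<omega>. ennreal ((norm (euler_prod (S 0) \<omega> - Psi (S 0) x \<omega>))\<^sup>2) \<partial>M))"
      unfolding Z3_def by (rule nn_integral_sum) measurable
    also have "\<dots> \<le> (\<Sum>x\<in>XP. ennreal (exp 36 / 2 ^ (92 * k)))" by (intro sum_mono one)
    also have "\<dots> = ennreal (real (card P) * (exp 36 / 2 ^ (92 * k)))"
      unfolding XP(2)[symmetric] by (simp add: ennreal_of_nat_eq_real_of_nat ennreal_mult[symmetric])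
    also have "\<dots> \<le> ennreal (2 ^ (11 * k) * (exp 36 / 2 ^ (92 * k)))"
      using cardP by (intro ennreal_leI mult_right_mono) auto
    also have "\<dots> \<le> ennreal (1 / real k ^ 2)" using n6 by (rule ennreal_leI)
    finally show ?thesis .
  qed
  have E4: "(\<integral>\<^sup>+\<omega>. ennreal (R \<omega>) \<partial>M) \<le> ennreal (1 / real k ^ 2)"
  proof -
    have "real (card P) * (real (2 ^ (k + 1)) + 1) ^ 4 * \<eta>\<^sup>2 \<le> 2 ^ (11 * k) * (real (2 ^ (k + 1)) + 1) ^ 4 * \<eta>\<^sup>2"
      using cardP by (intro mult_right_mono) auto
    also have "\<dots> \<le> 1 / real k ^ 2" unfolding \<eta>_def using n7 .
    finally show ?thesis using R(3) by (meson ennreal_leI order_trans)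
  qed
  define Z where "Z \<omega> = Z1 \<omega> + Z2 \<omega> + Z3 \<omega> + ennreal (R \<omega>)" for \<omega>
  have ZM: "Z \<in> borel_measurable M" unfolding Z_def[abs_def] using Z1M Z2M Z3M by measurable
  have "(\<integral>\<^sup>+\<omega>. Z \<omega> \<partial>M) = (\<integral>\<^sup>+\<omega>. Z1 \<omega> \<partial>M) + (\<integral>\<^sup>+\<omega>. Z2 \<omega> \<partial>M) + (\<integral>\<^sup>+\<omega>. Z3 \<omega> \<partial>M) + (\<integral>\<^sup>+\<omega>. ennreal (R \<omega>) \<partial>M)"
    unfolding Z_def using Z1M Z2M Z3M by (simp add: nn_integral_add)
  also have "\<dots> \<le> ennreal (1 / real k ^ 2) + ennreal (1 / real k ^ 2) + ennreal (1 / real k ^ 2) + ennreal (1 / real k ^ 2)"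
    by (intro add_mono E1 E2 E3 E4)
  also have "\<dots> = ennreal (4 / real k ^ 2)" by (simp add: ennreal_plus[symmetric] del: ennreal_plus)
  finally have EZ: "(\<integral>\<^sup>+\<omega>. Z \<omega> \<partial>M) \<le> ennreal (4 / real k ^ 2)" .
  have path: "norm (half_sum n \<omega>) \<le> real k ^ 12 * sqrt B" if \<omega>: "\<omega> \<in> euler_bounded k B" "Z \<omega> < 1" and n: "n \<in> I" for \<omega> n
  proof -
    have \<omega>M: "\<omega> \<in> space M" using \<omega>(1) by (simp add: euler_bounded_def)
    have \<omega>G: "\<omega> \<in> G" using \<omega>(1) K(3) by (auto simp: G_def euler_bounded_def)
    have lt: "Z1 \<omega> < 1" "Z2 \<omega> < 1" "Z3 \<omega> < 1" "ennreal (R \<omega>) < 1"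
    proof -
      have "Z1 \<omega> \<le> Z \<omega>" "Z2 \<omega> \<le> Z \<omega>" "Z3 \<omega> \<le> Z \<omega>" "ennreal (R \<omega>) \<le> Z \<omega>"
        unfolding Z_def by (simp_all add: add_increasing add_increasing2)
      then show "Z1 \<omega> < 1" "Z2 \<omega> < 1" "Z3 \<omega> < 1" "ennreal (R \<omega>) < 1" using \<omega>(2) by (blast intro: le_less_trans)+
    qed
    have sB: "sqrt B \<ge> 1" using B by simp
    define m where "m = t n"
    have m: "m \<in> P" "m \<le> n" "real m \<in> XP" using t[OF n] by (auto simp: m_def XP_def)
    have "norm (\<Sum>i\<in>{m<..n}. F i \<omega> / of_real (sqrt i)) ^ 4 \<le> R \<omega>" unfolding m_def by (rule R(4)[OF n])
    also have "R \<omega> \<le> 1" using lt(4) R(2)[of \<omega>] by simp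
    finally have gap: "norm (\<Sum>i\<in>{m<..n}. F i \<omega> / of_real (sqrt i)) \<le> 1"
      by (metis norm_ge_zero one_power2 power_le_one_iff zero_neq_numeral)
    have un: "{1..n} = {1..m} \<union> {m<..n}" using m by auto
    have "half_sum n \<omega> = half_sum m \<omega> + (\<Sum>i\<in>{m<..n}. F i \<omega> / of_real (sqrt i))"
      unfolding half_sum_def un by (rule sum.union_disjoint) auto
    then have "norm (half_sum n \<omega>) \<le> norm (half_sum m \<omega>) + norm (\<Sum>i\<in>{m<..n}. F i \<omega> / of_real (sqrt i))"
      by (simp only: norm_triangle_ineq)
    then have a: "norm (half_sum n \<omega>) \<le> norm (half_sum m \<omega>) + 1" using gap by linarith
    have "real m \<le> exp (yl J)"
    proof -
      have "m \<in> I" using m P(1) by auto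
      then have "real m \<le> exp (2 ^ k)" by (simp add: I_def)
      also have "\<dots> \<le> exp (yl J)" using J(1) by (simp add: yl_def add_increasing)
      finally show ?thesis .
    qed
    then have MP: "half_sum m \<omega> = Psi (S J) (real m) \<omega>" unfolding S_def by (rule Psi_eq_half_sum[symmetric])
    have diff: "norm (Psi (S (Suc j)) (real m) \<omega> - Psi (S j) (real m) \<omega>) \<le> 2 * (real k ^ 7 * sqrt B)" if j: "j < J" for j
    proof -
      have "ennreal (1 / \<Lambda>) * (mean_sq (S j) (2 ^ (k + 1)) \<omega> * indicator G \<omega>) \<le> Z1 \<omega>"
        unfolding Z1_def using j by (intro member_le_sum) auto
      then have "ennreal (1 / \<Lambda>) * mean_sq (S j) (2 ^ (k + 1)) \<omega> \<le> 1" using lt(1) \<omega>G by simp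
      from mult_left_mono[OF this, of "ennreal \<Lambda>"]
      have "(ennreal \<Lambda> * ennreal (1 / \<Lambda>)) * mean_sq (S j) (2 ^ (k + 1)) \<omega> \<le> ennreal \<Lambda>" by (simp add: mult.assoc)
      moreover have "ennreal \<Lambda> * ennreal (1 / \<Lambda>) = 1" using \<Lambda>0 by (simp add: ennreal_mult[symmetric])
      ultimately have I1: "mean_sq (S j) (2 ^ (k + 1)) \<omega> \<le> ennreal \<Lambda>" by simp
      have "Q j \<omega> \<le> Z2 \<omega>" unfolding Z2_def using j by (intro member_le_sum) auto
      then have Q1: "Q j \<omega> < 1" using lt(2) by (rule le_less_trans)
      have "(norm (Psi (S (Suc j)) (real m) \<omega> - Psi (S j) (real m) \<omega>))\<^sup>2 \<le> exp 1 * w"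
        using Q(3)[OF \<omega>M Q1 I1 m(3)] by (simp add: ST)
      also have "\<dots> \<le> 4 * w" using exp_le w0 by (intro mult_right_mono) auto
      also have "\<dots> = (2 * (real k ^ 7 * sqrt B))\<^sup>2"
        using B by (simp add: w_def power_mult_distrib power_mult[symmetric])
      finally show ?thesis by (rule power2_le_imp_le) (use k1 B in simp)
    qed
    have start: "norm (Psi (S 0) (real m) \<omega>) \<le> sqrt B + 1"
    proof -
      have "ennreal ((norm (euler_prod (S 0) \<omega> - Psi (S 0) (real m) \<omega>))\<^sup>2) \<le> Z3 \<omega>"
        unfolding Z3_def using m(3) XP(1) by (intro member_le_sum) auto
      then have "ennreal ((norm (euler_prod (S 0) \<omega> - Psi (S 0) (real m) \<omega>))\<^sup>2) < 1" using lt(3) by (rule le_less_trans)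
      then have "(norm (euler_prod (S 0) \<omega> - Psi (S 0) (real m) \<omega>))\<^sup>2 \<le> 1" by simp
      then have d: "norm (euler_prod (S 0) \<omega> - Psi (S 0) (real m) \<omega>) \<le> 1" by (simp add: power_le_one_iff abs_square_le_1)
      have "(norm (euler_prod (S 0) \<omega>))\<^sup>2 \<le> B" using \<omega>G unfolding G_def euler_bounded_def S0 by auto
      then have "norm (euler_prod (S 0) \<omega>) \<le> sqrt B" by (rule real_le_rsqrt)
      then show ?thesis using d norm_triangle_sub[of "Psi (S 0) (real m) \<omega>" "euler_prod (S 0) \<omega>"] by (simp add: norm_minus_commute)
    qed
    have tele: "norm (Psi (S j) (real m) \<omega>) \<le> sqrt B + 1 + real j * (2 * (real k ^ 7 * sqrt B))" if "j \<le> J" for j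
      using that
    proof (induction j)
      case 0 then show ?case using start by simp
    next
      case (Suc j)
      have "norm (Psi (S (Suc j)) (real m) \<omega>) \<le> norm (Psi (S j) (real m) \<omega>) + norm (Psi (S (Suc j)) (real m) \<omega> - Psi (S j) (real m) \<omega>)"
        by (metis add.commute diff_add_cancel norm_triangle_ineq)
      then show ?case using Suc diff[of j] by (simp add: algebra_simps)
    qed
    \<comment> \<open>At most 2^26 * k^3 increments of size 2 * k^7 * sqrt B make k^10 * sqrt B up
      to a constant, which two further powers of k absorb.\<close>
    have "norm (half_sum n \<omega>) \<le> sqrt B + 2 + real J * (2 * (real k ^ 7 * sqrt B))" using a tele[of J] MP by simp
    also have "\<dots> \<le> 3 * sqrt B * real k ^ 10 + (2 ^ 26 * real k ^ 3) * (2 * (real k ^ 7 * sqrt B))"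
    proof (rule add_mono)
      have "sqrt B + 2 \<le> 3 * sqrt B * 1" using sB by simp
      also have "\<dots> \<le> 3 * sqrt B * real k ^ 10" using k1 B by (intro mult_left_mono) auto
      finally show "sqrt B + 2 \<le> 3 * sqrt B * real k ^ 10" .
      show "real J * (2 * (real k ^ 7 * sqrt B)) \<le> (2 ^ 26 * real k ^ 3) * (2 * (real k ^ 7 * sqrt B))"
        using J(3) B by (intro mult_right_mono) auto
    qed
    also have "\<dots> = (3 + 2 ^ 27) * (real k ^ 10 * sqrt B)" by (simp add: algebra_simps eval_nat_numeral)
    also have "\<dots> \<le> real k ^ 2 * (real k ^ 10 * sqrt B)"
    proof (rule mult_right_mono)
      have "3 + 2 ^ 27 \<le> real k" using k by simp
      also have "\<dots> \<le> real k ^ 2" using k1 self_le_power[of "real k" 2] by simp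
      finally show "3 + 2 ^ 27 \<le> real k ^ 2" .
    qed (use B in auto)
    also have "\<dots> = real k ^ 12 * sqrt B" by (simp add: power_add[symmetric] mult.assoc[symmetric])
    finally show ?thesis .
  qed
  show ?thesis
    using ZM EZ path unfolding I_def by blast
qed

text \<open>The quantifier over B stands inside the eventuality: the threshold for k is uniform in
  B, so B can be chosen as a function of k afterwards.\<close>

lemma scale_bound:
  "\<forall>\<^sub>F k in sequentially. \<forall>B\<ge>1. \<exists>Z\<in>borel_measurable M. (\<integral>\<^sup>+\<omega>. Z \<omega> \<partial>M) \<le> ennreal (4 / real k ^ 2) \<and>
    (\<forall>\<omega>\<in>euler_bounded k B. Z \<omega> < 1 \<longrightarrow> (\<forall>n. exp (2 ^ (k - 2)) \<le> real n \<and> real n \<le> exp (2 ^ k) \<longrightarrow>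
      norm (half_sum n \<omega>) \<le> real k ^ 12 * sqrt B))"
proof -
  have "\<forall>\<^sub>F k::nat in sequentially. 2 ^ 67 \<le> real k" by real_asymp
  moreover note eventually_window_le
  moreover note eventually_mertens_le
  moreover have "\<forall>\<^sub>F k::nat in sequentially. 4 * (2048 * real k) \<le> 2 ^ k" by real_asymp
  moreover have "\<forall>\<^sub>F k::nat in sequentially. 64 * real k \<le> exp (2 ^ k / (1024 * real k))" by real_asymp
  moreover have "\<forall>\<^sub>F k::nat in sequentially. 64 * real k * window_bound k \<le> 1"
    unfolding window_bound_def mesh_width_def by real_asymp
  moreover have "\<forall>\<^sub>F k::nat in sequentially. 2 ^ 26 * real k ^ 3 * (2 ^ (11 * k) * (2 ^ 28 * real k ^ 3 / 2 ^ (20 * k) + 1 / 2 ^ (16 * k))) \<le> 1 / real k ^ 2"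
    by real_asymp
  moreover have "\<forall>\<^sub>F k::nat in sequentially. 2 ^ (11 * k) * (exp 36 / 2 ^ (92 * k)) \<le> 1 / real k ^ 2"
    by real_asymp
  moreover have "\<forall>\<^sub>F k::nat in sequentially. 2 ^ (11 * k) * (real (2 ^ (k + 1)) + 1) ^ 4 * (1 / 2 ^ (8 * k))\<^sup>2 \<le> 1 / real k ^ 2"
    by real_asymp
  moreover have "\<forall>\<^sub>F k::nat in sequentially. (1 + 2 ^ k)\<^sup>2 / (1 / 2 ^ (8 * k)) + 1 \<le> (2 ^ (11 * k) :: real)"
    by real_asymp
  ultimately show ?thesis
  proof eventually_elim
    case (elim k)
    show ?case using scale_deterministic[OF elim] by blast
  qed
qed

text \<open>Borel--Cantelli over the scales, with B chosen so that sqrt (B k) dominates the almost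
  sure size of all Euler products up to level k. The means 4 / k^2 from \<open>scale_bound\<close>
  are summable, so almost surely all but finitely many scales are good.\<close>

lemma half_sum_bound:
  assumes "\<epsilon> > 0"
  shows "AE \<omega> in M. \<forall>\<^sub>F x in at_top. norm (half_sum (nat \<lfloor>x\<rfloor>) \<omega>)
    \<le> exp ((1 + \<epsilon>) * sqrt (ln (ln x) * ln (ln (ln (ln x)))))"
proof -
  \<comment> \<open>The slack 1 + \<epsilon> = \<beta>^6 is shared out: \<beta>^2 for the law of the
    iterated logarithm, one more \<beta> for 2 * ln (k + 1) + C, and the rest for k^12 and for the
    passage from k to x. C is random whereas B k has to be deterministic, so C must be absorbed by a
    power of \<beta>.\<close>
  define \<beta> where "\<beta> = (1 + \<epsilon>) powr (1 / 6)"
  have \<beta>: "\<beta> > 1" using assms by (simp add: \<beta>_def)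
  have "\<beta> ^ 3 = (1 + \<epsilon>) powr (1 / 2)" using assms by (simp add: \<beta>_def powr_power)
  also have "\<dots> < (1 + \<epsilon>) powr 1" using assms by (intro powr_less_mono) auto
  finally have \<beta>3: "\<beta> ^ 3 < 1 + \<epsilon>" using assms by simp
  define H where "H k = sqrt (real k * ln 2 * ln (ln (real k)))" for k :: nat
  define B where "B k = (exp (\<beta> ^ 3 * H k))\<^sup>2" for k
  have H0: "H k \<ge> 0" if "ln (ln (real k)) \<ge> 0" for k using that by (simp add: H_def)
  have B1: "B k \<ge> 1" if "ln (ln (real k)) \<ge> 0" for k using H0[OF that] \<beta> by (simp add: B_def)
  have ev1: "\<forall>\<^sub>F k::nat in sequentially. ln (ln (real k)) \<ge> 0" by real_asymp
  define good where "good k Z \<longleftrightarrow> Z \<in> borel_measurable M \<and> (\<integral>\<^sup>+\<omega>. Z \<omega> \<partial>M) \<le> ennreal (4 / real k ^ 2) \<and>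
    (\<forall>\<omega>\<in>euler_bounded k (B k). Z \<omega> < 1 \<longrightarrow> (\<forall>n. exp (2 ^ (k - 2)) \<le> real n \<and> real n \<le> exp (2 ^ k) \<longrightarrow>
      norm (half_sum n \<omega>) \<le> real k ^ 12 * sqrt (B k)))" for k Z
  have "\<forall>\<^sub>F k in sequentially. \<exists>Z. good k Z"
    using scale_bound ev1
  proof eventually_elim
    case (elim k)
    show ?case using elim(1)[rule_format, OF B1[OF elim(2)]] unfolding good_def by blast
  qed
  then obtain k0 where k0: "\<And>k. k \<ge> k0 \<Longrightarrow> \<exists>Z. good k Z" unfolding eventually_sequentially by blast
  have "\<exists>Z. k \<ge> k0 \<longrightarrow> good k Z" for k using k0 by blast
  then obtain Z where Z: "\<And>k. k \<ge> k0 \<Longrightarrow> good k (Z k)" using choice[of "\<lambda>k Z. k \<ge> k0 \<longrightarrow> good k Z"] by blast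
  define A where "A k = (if k \<ge> k0 then {\<omega>\<in>space M. 1 \<le> 1 * Z k \<omega>} else {})" for k
  have AM: "A k \<in> events" for k
  proof (cases "k \<ge> k0")
    case True
    then have [measurable]: "Z k \<in> borel_measurable M" using Z by (auto simp: good_def)
    have "{\<omega>\<in>space M. 1 \<le> 1 * Z k \<omega>} \<in> events" by measurable
    then show ?thesis using True by (simp add: A_def)
  qed (simp add: A_def)
  have probA: "prob (A k) \<le> 4 * (1 / real k ^ 2)" for k
  proof (cases "k \<ge> k0")
    case True
    then have Zk: "Z k \<in> borel_measurable M" "(\<integral>\<^sup>+\<omega>. Z k \<omega> \<partial>M) \<le> ennreal (4 / real k ^ 2)" using Z by (auto simp: good_def)
    have "emeasure M (A k) \<le> 1 * (\<integral>\<^sup>+\<omega>. Z k \<omega> * indicator (space M) \<omega> \<partial>M)"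
    proof -
      have eq: "A k = {\<omega>\<in>space M. 1 \<le> 1 * Z k \<omega>}" using True by (simp add: A_def)
      show ?thesis unfolding eq using nn_integral_Markov_inequality[where u = "Z k" and A = "space M" and c = 1 and M = M] Zk(1) by simp
    qed
    also have "\<dots> = (\<integral>\<^sup>+\<omega>. Z k \<omega> \<partial>M)"
    proof -
      have "(\<integral>\<^sup>+\<omega>. Z k \<omega> * indicator (space M) \<omega> \<partial>M) = (\<integral>\<^sup>+\<omega>. Z k \<omega> \<partial>M)"
        by (intro nn_integral_cong) simp
      then show ?thesis by simp
    qed
    also have "\<dots> \<le> ennreal (4 / real k ^ 2)" by (rule Zk(2))
    finally have "ennreal (prob (A k)) \<le> ennreal (4 / real k ^ 2)" by (simp add: emeasure_eq_measure)
    then show ?thesis by (subst (asm) ennreal_le_iff) auto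
  qed (simp add: A_def)
  have "summable (\<lambda>k. 4 * (1 / real k ^ 2))"
    using inverse_power_summable[of 2, where 'a = real] by (intro summable_mult) (simp add: inverse_eq_divide)
  then have "summable (\<lambda>k. prob (A k))"
    by (rule summable_comparison_test'[where N = 0]) (use probA in simp)
  then have AE1: "AE \<omega> in M. \<forall>\<^sub>F k in sequentially. \<omega> \<in> space M - A k"
    using AM by (intro borel_cantelli_AE1) (simp_all add: emeasure_eq_measure)
  \<comment> \<open>k - 1 appears on the right because k is a ceiling: only 2^(k-1) <= ln x is
    known, and the final bound has to be expressed through x.\<close>
  have asym: "\<forall>\<^sub>F k::nat in sequentially. ln (real k ^ 12) + \<beta> ^ 3 * H k
     \<le> (1 + \<epsilon>) * sqrt ((real k - 1) * ln 2 * ln (ln ((real k - 1) * ln 2)))"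
  proof -
    have "((\<lambda>k::nat. (ln (real k ^ 12) + \<beta> ^ 3 * H k) / sqrt ((real k - 1) * ln 2 * ln (ln ((real k - 1) * ln 2)))) \<longlongrightarrow> \<beta> ^ 3) sequentially"
      unfolding H_def using \<beta> by real_asymp
    from order_tendstoD(2)[OF this \<beta>3]
    have "\<forall>\<^sub>F k::nat in sequentially. (ln (real k ^ 12) + \<beta> ^ 3 * H k) / sqrt ((real k - 1) * ln 2 * ln (ln ((real k - 1) * ln 2))) < 1 + \<epsilon>" .
    moreover have "\<forall>\<^sub>F k::nat in sequentially. sqrt ((real k - 1) * ln 2 * ln (ln ((real k - 1) * ln 2))) > 0" by real_asymp
    ultimately show ?thesis by eventually_elim (simp add: pos_divide_less_eq)
  qed
  have pos: "\<forall>\<^sub>F k::nat in sequentially. real k \<ge> 3 \<and> (real k - 1) * ln 2 > 0 \<and> ln ((real k - 1) * ln 2) > 0 \<and> ln (ln ((real k - 1) * ln 2)) > 0"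
    by (intro eventually_conj; real_asymp)
  from AE1 lil_upper[OF \<beta>] show ?thesis
  proof eventually_elim
    case (elim \<omega>)
    have \<omega>: "\<omega> \<in> space M" using elim(1) by (auto simp: eventually_sequentially)
    obtain C where C: "\<forall>\<^sub>F k in sequentially. \<forall>i\<le>k. norm (euler_prod (primes_upto (exp (2 ^ i))) \<omega>)
      \<le> exp (sqrt (\<beta> ^ 4 * (real k * ln 2) * ln (ln (real k))) + 2 * ln (real k + 1) + C)" using elim(2) by blast
    have "\<forall>\<^sub>F k::nat in sequentially. sqrt (\<beta> ^ 4 * (real k * ln 2) * ln (ln (real k))) + 2 * ln (real k + 1) + C \<le> \<beta> ^ 3 * H k"
    proof -
      have "sqrt (\<beta> ^ 4) = \<beta>\<^sup>2" using real_sqrt_abs[of "\<beta>\<^sup>2"] by (simp flip: power_mult)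
      then have sqrt_eq: "sqrt (\<beta> ^ 4 * (real k * ln 2) * ln (ln (real k))) = \<beta>\<^sup>2 * sqrt (real k * ln 2 * ln (ln (real k)))" for k
        by (simp add: real_sqrt_mult mult_ac)
      have "((\<lambda>k::nat. (\<beta>\<^sup>2 * sqrt (real k * ln 2 * ln (ln (real k))) + 2 * ln (real k + 1) + C) / sqrt (real k * ln 2 * ln (ln (real k)))) \<longlongrightarrow> \<beta>\<^sup>2) sequentially"
        using \<beta> by real_asymp
      moreover have "\<beta>\<^sup>2 < \<beta> ^ 3" using \<beta> by (intro power_strict_increasing) auto
      ultimately have "\<forall>\<^sub>F k::nat in sequentially. (\<beta>\<^sup>2 * sqrt (real k * ln 2 * ln (ln (real k))) + 2 * ln (real k + 1) + C) / sqrt (real k * ln 2 * ln (ln (real k))) < \<beta> ^ 3"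
        by (rule order_tendstoD(2))
      moreover have "\<forall>\<^sub>F k::nat in sequentially. sqrt (real k * ln 2 * ln (ln (real k))) > 0" by real_asymp
      ultimately show ?thesis unfolding H_def sqrt_eq by eventually_elim (simp add: pos_divide_less_eq)
    qed
    with C have "\<forall>\<^sub>F k in sequentially. \<omega> \<in> euler_bounded k (B k)"
    proof eventually_elim
      case (elim k)
      have "(norm (euler_prod (primes_upto (exp (2 ^ i))) \<omega>))\<^sup>2 \<le> B k" if "i \<le> k" for i
      proof -
        have "norm (euler_prod (primes_upto (exp (2 ^ i))) \<omega>) \<le> exp (\<beta> ^ 3 * H k)"
          using elim that by (meson exp_le_cancel_iff order_trans)
        then show ?thesis unfolding B_def by (intro power_mono) auto
      qed
      then show ?case using \<omega> by (auto simp: euler_bounded_def)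
    qed
    with elim(1) have "\<forall>\<^sub>F k in sequentially. \<forall>n. exp (2 ^ (k - 2)) \<le> real n \<and> real n \<le> exp (2 ^ k) \<longrightarrow>
      norm (half_sum n \<omega>) \<le> real k ^ 12 * sqrt (B k)"
      using eventually_ge_at_top[of k0]
    proof eventually_elim
      case (elim k)
      then have "Z k \<omega> < 1" using \<omega> by (auto simp: A_def not_le)
      then show ?case using Z[of k] elim by (auto simp: good_def)
    qed
    with asym pos have ev: "\<forall>\<^sub>F k in sequentially. (\<forall>n. exp (2 ^ (k - 2)) \<le> real n \<and> real n \<le> exp (2 ^ k) \<longrightarrow>
      norm (half_sum n \<omega>) \<le> exp ((1 + \<epsilon>) * sqrt ((real k - 1) * ln 2 * ln (ln ((real k - 1) * ln 2))))) \<and>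
      (real k \<ge> 3 \<and> (real k - 1) * ln 2 > 0 \<and> ln ((real k - 1) * ln 2) > 0 \<and> ln (ln ((real k - 1) * ln 2)) > 0)"
    proof eventually_elim
      case (elim k)
      have k3: "real k \<ge> 3" using elim by blast
      have "real k ^ 12 * sqrt (B k) = exp (ln (real k ^ 12) + \<beta> ^ 3 * H k)"
        using k3 by (simp add: B_def exp_add)
      also have "\<dots> \<le> exp ((1 + \<epsilon>) * sqrt ((real k - 1) * ln 2 * ln (ln ((real k - 1) * ln 2))))"
        using elim by simp
      finally show ?case using elim by (meson order_trans)
    qed
    have klim: "filterlim (\<lambda>x::real. nat \<lceil>log 2 (ln x)\<rceil>) sequentially at_top"
    proof (subst filterlim_at_top, intro allI)
      fix Z :: nat
      have "filterlim (\<lambda>x::real. log 2 (ln x)) at_top at_top" by real_asymp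
      then have "\<forall>\<^sub>F x in at_top. real Z \<le> log 2 (ln x)" unfolding filterlim_at_top by blast
      then show "\<forall>\<^sub>F x::real in at_top. Z \<le> nat \<lceil>log 2 (ln x)\<rceil>"
        by eventually_elim linarith
    qed
    have big: "\<forall>\<^sub>F x::real in at_top. 1 < log 2 (ln x) \<and> 1 < ln x \<and> 1 < x"
      by (intro eventually_conj; real_asymp)
    from eventually_compose_filterlim[OF ev klim] big
    show "\<forall>\<^sub>F x in at_top. norm (half_sum (nat \<lfloor>x\<rfloor>) \<omega>) \<le> exp ((1 + \<epsilon>) * sqrt (ln (ln x) * ln (ln (ln (ln x)))))"
    proof eventually_elim
      case (elim x)
      define k where "k = nat \<lceil>log 2 (ln x)\<rceil>"
      define n where "n = nat \<lfloor>x\<rfloor>"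
      have x: "1 < log 2 (ln x)" "1 < ln x" "1 < x" using elim by blast+
      have "real k = real_of_int \<lceil>log 2 (ln x)\<rceil>" unfolding k_def using x by (intro of_nat_nat) linarith
      then have k: "log 2 (ln x) \<le> real k" "real k - 1 < log 2 (ln x)" by linarith+
      have k3: "real k \<ge> 3" "(real k - 1) * ln 2 > 0" "ln ((real k - 1) * ln 2) > 0" "ln (ln ((real k - 1) * ln 2)) > 0"
        using elim unfolding k_def by blast+
      have "ln x = 2 powr (log 2 (ln x))" using x by simp
      also have "\<dots> \<le> 2 powr real k" using k by (intro powr_mono) auto
      also have "\<dots> = 2 ^ k" by (simp add: powr_realpow)
      finally have "exp (ln x) \<le> exp (2 ^ k)" by simp
      then have x_le: "x \<le> exp (2 ^ k)" using x by simp
      have "2 ^ (k - 1) = 2 powr (real k - 1)" using k3 by (simp add: powr_realpow[symmetric] of_nat_diff)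
      also have "\<dots> \<le> 2 powr (log 2 (ln x))" using k by (intro powr_mono) auto
      also have "\<dots> = ln x" using x by simp
      finally have "exp (2 ^ (k - 1)) \<le> exp (ln x)" by simp
      then have x_ge: "exp (2 ^ (k - 1)) \<le> x" using x by simp
      have nx: "real n \<le> x" "x - 1 \<le> real n"
      proof -
        have "real n = real_of_int \<lfloor>x\<rfloor>" unfolding n_def using x by simp
        then show "real n \<le> x" "x - 1 \<le> real n" by linarith+
      qed
      \<comment> \<open>Rounding x down loses at most 1, which is affordable since exp (2^(k-1)) is
        the square of exp (2^(k-2)). This is why the scales reach down to k - 2 although x itself is
        at least exp (2^(k-1)).\<close>
      have "exp (2 ^ (k - 2)) \<le> real n"
      proof -
        have "k - 1 = Suc (k - 2)" using k3 by linarith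
        then have "exp (2 ^ (k - 1) :: real) = exp (2 ^ (k - 2)) * exp (2 ^ (k - 2))"
          by (simp add: exp_add[symmetric])
        moreover have "(1::real) \<le> 2 ^ (k - 2)" by simp
        then have "2 \<le> exp (2 ^ (k - 2) :: real)" using exp_ge_add_one_self[of "2 ^ (k - 2)"] by linarith
        then have "exp (2 ^ (k - 2)) * 2 \<le> exp (2 ^ (k - 2)) * exp (2 ^ (k - 2) :: real)" by (intro mult_left_mono) auto
        ultimately show ?thesis using x_ge nx(2) \<open>2 \<le> exp (2 ^ (k - 2) :: real)\<close> by linarith
      qed
      then have "norm (half_sum n \<omega>) \<le> exp ((1 + \<epsilon>) * sqrt ((real k - 1) * ln 2 * ln (ln ((real k - 1) * ln 2))))"
        using elim nx(1) x_le unfolding k_def by (meson order_trans)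
      also have "\<dots> \<le> exp ((1 + \<epsilon>) * sqrt (ln (ln x) * ln (ln (ln (ln x)))))"
      proof -
        have l1: "(real k - 1) * ln 2 \<le> ln (ln x)"
        proof -
          have "(real k - 1) * ln 2 \<le> log 2 (ln x) * ln 2" using k by (intro mult_right_mono) auto
          then show ?thesis by (simp add: log_def)
        qed
        have l2: "ln ((real k - 1) * ln 2) \<le> ln (ln (ln x))" using l1 k3(2) by (rule ln_mono)
        have l3: "ln (ln ((real k - 1) * ln 2)) \<le> ln (ln (ln (ln x)))" using l2 k3(3) by (rule ln_mono)
        have "(real k - 1) * ln 2 * ln (ln ((real k - 1) * ln 2)) \<le> ln (ln x) * ln (ln (ln (ln x)))"
          using l1 l3 k3 by (intro mult_mono) linarith+
        then show ?thesis using assms by simp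
      qed
      finally show ?case by (simp add: n_def)
    qed
  qed
qed

end

subsection \<open>Transfer to Steinhaus functions\<close>

text \<open>The integrand has an antiderivative of period 1, so its integral over [0, 1] is
  zero.\<close>

lemma uniform_circle_moment:
  assumes "n > 0"
  shows "integral\<^sup>L uniform_circle (\<lambda>z. z ^ n) = 0"
proof -
  let ?c = "\<lambda>t::real. cis (2 * pi * t)"
  define F where "F t = cis (2 * pi * real n * t) / (2 * pi * real n * \<i>)" for t :: real
  have "integral\<^sup>L uniform_circle (\<lambda>z. z ^ n) = integral\<^sup>L (uniform_measure lborel {0..1}) (\<lambda>t. ?c t ^ n)"
    unfolding uniform_circle_def using cis_2pi_measurable by (subst integral_distr) auto
  also have "\<dots> = integral\<^sup>L (density lborel (indicator {0..1})) (\<lambda>t. ?c t ^ n)"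
    by (simp add: uniform_measure_def divide_ennreal_def)
  also have "\<dots> = integral\<^sup>L (density lborel (\<lambda>t. ennreal (indicator {0..1} t))) (\<lambda>t. ?c t ^ n)"
    by (simp add: ennreal_indicator)
  also have "\<dots> = integral\<^sup>L lborel (\<lambda>t. indicator {0..1} t *\<^sub>R ?c t ^ n)"
    by (subst integral_density) (use cis_2pi_measurable in auto)
  also have "\<dots> = F 1 - F 0"
  proof (rule integral_FTC_atLeastAtMost)
    fix t :: real
    show "(F has_vector_derivative ?c t ^ n) (at t within {0..1})"
    proof -
      have "F = (\<lambda>t. exp (\<i> * of_real (2 * pi * real n) * of_real t) / (2 * pi * real n * \<i>))"
        by (simp add: F_def cis_conv_exp fun_eq_iff mult_ac)
      moreover have "((\<lambda>t. exp (\<i> * of_real (2 * pi * real n) * of_real t) / (2 * pi * real n * \<i>)) has_vector_derivative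
         exp (\<i> * of_real (2 * pi * real n) * of_real t)) (at t within {0..1})"
      proof -
        have "((\<lambda>z. exp (\<i> * of_real (2 * pi * real n) * z) / (2 * pi * real n * \<i>)) has_field_derivative
          exp (\<i> * of_real (2 * pi * real n) * of_real t)) (at (of_real t))"
          by (rule derivative_eq_intros refl)+ (use assms in \<open>auto simp: field_simps\<close>)
        from has_vector_derivative_real_field[OF this] show ?thesis by (simp add: o_def)
      qed
      moreover have "?c t ^ n = exp (\<i> * of_real (2 * pi * real n) * of_real t)"
        by (subst Complex.DeMoivre) (simp add: cis_conv_exp mult_ac)
      ultimately show ?thesis by simp
    qed
    show "continuous_on {0..1} (\<lambda>t. ?c t ^ n)" by (intro continuous_intros)
  qed auto
  also have "\<dots> = 0"
  proof -
    have "cis (2 * pi * real n) = 1" using cis_multiple_2pi[of "of_nat n"] by (simp add: mult_ac)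
    then show ?thesis by (simp add: F_def)
  qed
  finally show ?thesis .
qed

text \<open>Sending every value off the circle to 1 is a Borel map, hence preserves independence;
  the law is carried by the circle, so the moments do not change either.\<close>

lemma steinhaus_unimodular_primes:
  assumes "prob_space M" "steinhaus M f"
  shows "unimodular_primes M (\<lambda>p \<omega>. if norm (f p \<omega>) = 1 then f p \<omega> else 1)"
proof -
  interpret prob_space M by fact
  define c where "c z = (if norm z = 1 then z else 1)" for z :: complex
  have c_meas [measurable]: "c \<in> borel_measurable borel" unfolding c_def[abs_def] by measurable
  have ind: "indep_vars (\<lambda>_. borel) f {p. prime p}" and distr: "\<And>p. prime p \<Longrightarrow> distr M borel (f p) = uniform_circle"
    using assms(2) by (auto simp: steinhaus_def)
  have f_meas: "f p \<in> borel_measurable M" if "prime p" for p using ind that by (auto simp: indep_vars_def)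
  have "unimodular_primes M (\<lambda>p \<omega>. c (f p \<omega>))"
  proof
    show "indep_vars (\<lambda>_. borel) (\<lambda>p \<omega>. c (f p \<omega>)) {p. prime p}"
      by (rule indep_vars_compose2[OF ind]) simp
    show "norm (c (f p \<omega>)) = 1" for p \<omega> by (simp add: c_def)
    fix p n :: nat assume p: "prime p" and n: "n > 0"
    have "expectation (\<lambda>\<omega>. c (f p \<omega>) ^ n) = integral\<^sup>L (distr M borel (f p)) (\<lambda>z. c z ^ n)"
      using f_meas[OF p] by (subst integral_distr) auto
    also have "\<dots> = integral\<^sup>L uniform_circle (\<lambda>z. c z ^ n)" by (simp add: distr[OF p])
    also have "\<dots> = integral\<^sup>L uniform_circle (\<lambda>z. z ^ n)"
    proof (rule integral_cong_AE)
      have s: "sets uniform_circle = sets borel" by (simp add: uniform_circle_def)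
      show "(\<lambda>z. c z ^ n) \<in> borel_measurable uniform_circle" "(\<lambda>z. z ^ n) \<in> borel_measurable uniform_circle"
        using measurable_cong_sets[OF s refl, of "borel :: complex measure"] by (auto intro: measurable_compose[OF c_meas])
      show "AE z in uniform_circle. c z ^ n = z ^ n"
        using AE_uniform_circle_norm by eventually_elim (simp add: c_def)
    qed
    also have "\<dots> = 0" by (rule uniform_circle_moment[OF n])
    finally show "expectation (\<lambda>\<omega>. c (f p \<omega>) ^ n) = 0" .
  qed
  then show ?thesis by (simp add: c_def[abs_def])
qed

theorem theorem1:
  fixes M :: "'a measure" and f :: "nat \<Rightarrow> 'a \<Rightarrow> complex" and \<epsilon> :: real
  assumes "prob_space M" and "steinhaus M f" and "\<epsilon> > 0"
  shows "AE \<omega> in M. \<exists>C::real. \<forall>\<^sub>F x in at_top.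
           norm (weighted_partial_sum (\<lambda>n. f n \<omega>) x)
             \<le> C * exp ((1 + \<epsilon>) * sqrt (iter_ln 2 x * iter_ln 4 x))"
proof -
  define g where "g = (\<lambda>p \<omega>. if norm (f p \<omega>) = 1 then f p \<omega> else 1)"
  interpret unimodular_primes M g
    unfolding g_def by (rule steinhaus_unimodular_primes[OF assms(1,2)])
  have ind: "indep_vars (\<lambda>_. borel) f {p. prime p}" and distr: "\<And>p. prime p \<Longrightarrow> distr M borel (f p) = uniform_circle"
    and f_eq: "\<And>n \<omega>. n \<ge> 1 \<Longrightarrow> \<omega> \<in> space M \<Longrightarrow> f n \<omega> = (\<Prod>p\<in>prime_factors n. f p \<omega> ^ multiplicity p n)"
    using assms(2) by (auto simp: steinhaus_def)
  have "AE \<omega> in M. prime p \<longrightarrow> norm (f p \<omega>) = 1" for p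
  proof (cases "prime p")
    case True
    then have m: "f p \<in> borel_measurable M" using ind by (auto simp: indep_vars_def)
    have "AE z in distr M borel (f p). norm z = 1" unfolding distr[OF True] by (rule AE_uniform_circle_norm)
    then show ?thesis using m by (subst (asm) AE_distr_iff) auto
  qed simp
  \<comment> \<open>There are countably many primes, so the exceptional null sets can be united. Off
    their union f and g agree at all primes, hence f and F at all positive integers.\<close>
  then have AE1: "AE \<omega> in M. \<forall>p. prime p \<longrightarrow> norm (f p \<omega>) = 1" by (subst AE_all_countable) blast
  from AE1 AE_space half_sum_bound[OF assms(3)] show ?thesis
  proof eventually_elim
    case (elim \<omega>)
    have fF: "f n \<omega> = F n \<omega>" if "n \<ge> 1" for n
    proof -
      have "(\<Prod>p\<in>prime_factors n. f p \<omega> ^ multiplicity p n) = (\<Prod>p\<in>prime_factors n. g p \<omega> ^ multiplicity p n)"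
        using elim(1) by (intro prod.cong refl) (auto simp: g_def)
      then show ?thesis using f_eq[OF that elim(2)] by (simp add: F_def)
    qed
    have wM: "weighted_partial_sum (\<lambda>n. f n \<omega>) x = half_sum (nat \<lfloor>x\<rfloor>) \<omega>" if "x \<ge> 0" for x
    proof -
      have "{n. 1 \<le> n \<and> real n \<le> x} = {1..nat \<lfloor>x\<rfloor>}"
        unfolding real_le_iff_nat_floor[OF that] by auto
      then show ?thesis unfolding weighted_partial_sum_def half_sum_def using fF by (intro sum.cong) auto
    qed
    have il: "iter_ln 2 x = ln (ln x)" "iter_ln 4 x = ln (ln (ln (ln x)))" for x
      by (simp_all add: iter_ln_def eval_nat_numeral)
    \<comment> \<open>C = 1 is a valid witness, since every constant has already been absorbed by
      the slack in \<epsilon>.\<close>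
    have "\<forall>\<^sub>F x in at_top. norm (weighted_partial_sum (\<lambda>n. f n \<omega>) x)
        \<le> 1 * exp ((1 + \<epsilon>) * sqrt (iter_ln 2 x * iter_ln 4 x))"
      using elim(3) eventually_ge_at_top[of 0] by eventually_elim (simp add: wM il)
    then show ?case by blast
  qed
qed

end
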